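(* Consider the Feedback MAB problem and the policy Threshold-Whittle$(\lambda^* )$ defined in the context, where $\lambda^*$ satisfies $\lambda^*=\sum_{i=1}^n H_i(\lambda^* )$. Then Threshold-Whittle$(\lambda^* )$ is a $2$-approximation: its time-average expected reward is at least half the value of an optimal policy.
   Context: Feedback MAB: $n$ arms; arm $i$ has states $g_i$ (good) and $b_i$ (bad) and reward $r_i$; its state evolves as a two-state Markov chain, independently of other arms and of plays, with $\Pr[b_i\to g_i]=\alpha_i$, $\Pr[g_i\to b_i]=\beta_i$ per step, $\alpha_i+\beta_i\le1-\delta$ for a given $\delta>0$. At each step at most one arm is played; playing arm $i$ yields $r_i$ if it is in $g_i$ (else $0$) and reveals its current state; unplayed arms are unobserved. The value of a policy is its infinite-horizon time-average expected reward. The state of arm $i$ from the policy's perspective is $(s,t)$: last observed $t\ge1$ steps ago in state $s\in\{g,b\}$. Single-arm problem with penalty $\lambda$: for arm $i$ alone, a policy decides at each step whether to play arm $i$ (observing its state only when played); its value is the time-average reward minus $\lambda$ times the time-average number of plays. $H_i(\lambda)$ denotes the optimal value of this single-arm problem. The Whittle index $\Pi_i(s,t)$ of state $(s,t)$ of arm $i$ is the largest penalty $\lambda$ at which the decision of an optimal single-arm policy in state $(s,t)$ switches between "play" and "not play" (i.e. the largest $\lambda$ for which playing in $(s,t)$ is optimal). Threshold-Whittle$(\lambda)$: at each step, if some arm $i$ is in state $(g,1)$ and $r_i(1-\beta_i)\ge\lambda$, play such an arm; otherwise play the arm whose current state has the highest Whittle index. *)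

theory Defs
  imports "HOL-Probability.Probability"
begin

section \<open>The hidden process, policies and their values\<close>

text \<open>
  Arms are the elements of a finite type. For both hidden states and observations,
  \<^term>\<open>True\<close> means good and \<^term>\<open>False\<close> means bad. Arm \<open>i\<close> has parameters
  \<open>\<alpha> i\<close> (bad to good), \<open>\<beta> i\<close> (good to bad) and \<open>r i\<close> (reward).
\<close>

definition trans_pmf :: "real \<Rightarrow> real \<Rightarrow> bool \<Rightarrow> bool pmf" where
  "trans_pmf a b s = bernoulli_pmf (if s then 1 - b else a)"

primrec steps_pmf :: "real \<Rightarrow> real \<Rightarrow> nat \<Rightarrow> bool \<Rightarrow> bool pmf" where
  "steps_pmf a b 0 s = return_pmf s"
| "steps_pmf a b (Suc t) s = bind_pmf (steps_pmf a b t s) (trans_pmf a b)"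

text \<open>
  An information state \<open>(s, t)\<close> says that the arm was last observed \<open>t\<close> steps ago, in
  state \<open>s\<close>; always \<open>t \<ge> 1\<close> at decision times.
  A history lists, most recent step first, the arm played with the state it revealed, or
  \<^term>\<open>None\<close> for a step without a play. A policy may depend on the whole history and
  may randomise.
\<close>

type_synonym info = "bool \<times> nat"
type_synonym 'a history = "('a \<times> bool) option list"
type_synonym 'a policy = "'a history \<Rightarrow> 'a option pmf"

primrec info_of :: "('a \<Rightarrow> info) \<Rightarrow> 'a history \<Rightarrow> 'a \<Rightarrow> info" where
  "info_of x0 [] = x0"
| "info_of x0 (e # h) = (\<lambda>i.
     let aged = (fst (info_of x0 h i), Suc (snd (info_of x0 h i)))
     in case e of None \<Rightarrow> aged | Some (j, s) \<Rightarrow> if j = i then (s, 1) else aged)"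

text \<open>
  Joint distribution of the hidden states and the history after \<open>T\<close> steps, when each arm
  \<open>i\<close> starts in information state \<open>x0 i\<close>. All arms move in every step, independently of
  each other and of what is played. The observation precedes the move.
\<close>

primrec run ::
  "('a::finite \<Rightarrow> real) \<Rightarrow> ('a \<Rightarrow> real) \<Rightarrow> ('a \<Rightarrow> info) \<Rightarrow> 'a policy \<Rightarrow> nat
    \<Rightarrow> (('a \<Rightarrow> bool) \<times> 'a history) pmf"
where
  "run \<alpha> \<beta> x0 \<pi> 0 =
     map_pmf (\<lambda>z. (z, []))
       (Pi_pmf UNIV False (\<lambda>i. steps_pmf (\<alpha> i) (\<beta> i) (snd (x0 i)) (fst (x0 i))))"
| "run \<alpha> \<beta> x0 \<pi> (Suc T) =
     bind_pmf (run \<alpha> \<beta> x0 \<pi> T) (\<lambda>(z, h).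
     bind_pmf (\<pi> h) (\<lambda>act.
     map_pmf (\<lambda>z'. (z', map_option (\<lambda>i. (i, z i)) act # h))
       (Pi_pmf UNIV False (\<lambda>i. trans_pmf (\<alpha> i) (\<beta> i) (z i)))))"

text \<open>Every play costs the penalty \<open>lam\<close>; the unpenalised problem has \<open>lam = 0\<close>.\<close>

definition net_reward :: "('a \<Rightarrow> real) \<Rightarrow> real \<Rightarrow> 'a history \<Rightarrow> real" where
  "net_reward r lam h =
     (\<Sum>e\<leftarrow>h. (case e of None \<Rightarrow> 0 | Some (i, s) \<Rightarrow> (if s then r i else 0) - lam))"

definition total ::
  "('a::finite \<Rightarrow> real) \<Rightarrow> ('a \<Rightarrow> real) \<Rightarrow> ('a \<Rightarrow> real) \<Rightarrow> real \<Rightarrow> ('a \<Rightarrow> info) \<Rightarrow> 'a policy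
    \<Rightarrow> nat \<Rightarrow> real" where
  "total \<alpha> \<beta> r lam x0 \<pi> T =
     measure_pmf.expectation (run \<alpha> \<beta> x0 \<pi> T) (\<lambda>(z, h). net_reward r lam h)"

text \<open>
  The averages of an arbitrary policy need not converge. As usual for average-reward
  problems, the performance guaranteed by a given policy is the limes inferior, while the
  optimum is taken over the limites superiores, so that no policy is undervalued as a
  competitor.
\<close>

definition avg_value ::
  "('a::finite \<Rightarrow> real) \<Rightarrow> ('a \<Rightarrow> real) \<Rightarrow> ('a \<Rightarrow> real) \<Rightarrow> real \<Rightarrow> ('a \<Rightarrow> info) \<Rightarrow> 'a policy
    \<Rightarrow> ereal" where
  "avg_value \<alpha> \<beta> r lam x0 \<pi> = liminf (\<lambda>T. ereal (total \<alpha> \<beta> r lam x0 \<pi> T / real T))"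

definition opt_value ::
  "('a::finite \<Rightarrow> real) \<Rightarrow> ('a \<Rightarrow> real) \<Rightarrow> ('a \<Rightarrow> real) \<Rightarrow> real \<Rightarrow> ('a \<Rightarrow> info) \<Rightarrow> ereal" where
  "opt_value \<alpha> \<beta> r lam x0 =
     (SUP \<pi>. limsup (\<lambda>T. ereal (total \<alpha> \<beta> r lam x0 \<pi> T / real T)))"


section \<open>The single-arm problem and the Whittle index\<close>

text \<open>
  The single-arm problem is the instance with arm type \<^typ>\<open>unit\<close>. Its optimal value
  depends on the start \<open>x\<close> only in the degenerate case \<open>a = b = 0\<close>, where the chain is frozen.
\<close>

definition H_single :: "real \<Rightarrow> real \<Rightarrow> real \<Rightarrow> info \<Rightarrow> real \<Rightarrow> ereal" where
  "H_single a b \<rho> x lam = opt_value (\<lambda>_::unit. a) (\<lambda>_. b) (\<lambda>_. \<rho>) lam (\<lambda>_. x)"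

definition stationary_policy :: "info \<Rightarrow> (info \<Rightarrow> bool) \<Rightarrow> unit policy" where
  "stationary_policy x f =
     (\<lambda>h. return_pmf (if f (info_of (\<lambda>_. x) h ()) then Some () else None))"

definition gain_optimal :: "real \<Rightarrow> real \<Rightarrow> real \<Rightarrow> real \<Rightarrow> (info \<Rightarrow> bool) \<Rightarrow> bool" where
  "gain_optimal a b \<rho> lam f \<longleftrightarrow>
     (\<forall>x. snd x \<ge> 1 \<longrightarrow>
        avg_value (\<lambda>_. a) (\<lambda>_. b) (\<lambda>_. \<rho>) lam (\<lambda>_. x) (stationary_policy x f)
          = H_single a b \<rho> x lam)"

text \<open>
  The bias (Cesaro limit of the total reward in excess of the optimal average) is needed
  because the average alone does not determine the decision in states that are left for
  good: if no further plays are worthwhile after an observed bad state, playing in a state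
  \<open>(True, t)\<close> costs nothing on average, for an arbitrarily large penalty.
\<close>

definition bias :: "real \<Rightarrow> real \<Rightarrow> real \<Rightarrow> real \<Rightarrow> (info \<Rightarrow> bool) \<Rightarrow> info \<Rightarrow> ereal" where
  "bias a b \<rho> lam f x =
     liminf (\<lambda>N. ereal
       ((\<Sum>T<N. total (\<lambda>_. a) (\<lambda>_. b) (\<lambda>_. \<rho>) lam (\<lambda>_. x) (stationary_policy x f) T
                 - real T * real_of_ereal (H_single a b \<rho> x lam)) / real N))"

definition optimal_single :: "real \<Rightarrow> real \<Rightarrow> real \<Rightarrow> real \<Rightarrow> (info \<Rightarrow> bool) \<Rightarrow> bool" where
  "optimal_single a b \<rho> lam f \<longleftrightarrow>
     gain_optimal a b \<rho> lam f \<and>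
     (\<forall>f' x. gain_optimal a b \<rho> lam f' \<longrightarrow> snd x \<ge> 1 \<longrightarrow>
        bias a b \<rho> lam f' x \<le> bias a b \<rho> lam f x)"

definition whittle_index :: "real \<Rightarrow> real \<Rightarrow> real \<Rightarrow> info \<Rightarrow> ereal" where
  "whittle_index a b \<rho> x = (SUP lam\<in>{lam. \<exists>f. optimal_single a b \<rho> lam f \<and> f x}. ereal lam)"


section \<open>The policy Threshold-Whittle\<close>

text \<open>Ties are broken arbitrarily, possibly depending on the history and at random.\<close>

definition threshold_whittle ::
  "('a::finite \<Rightarrow> real) \<Rightarrow> ('a \<Rightarrow> real) \<Rightarrow> ('a \<Rightarrow> real) \<Rightarrow> ('a \<Rightarrow> info) \<Rightarrow> real \<Rightarrow> 'a policy
    \<Rightarrow> bool" where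
  "threshold_whittle \<alpha> \<beta> r x0 lam \<pi> \<longleftrightarrow>
     (\<forall>h. let x = info_of x0 h;
              E = {i. x i = (True, 1) \<and> r i * (1 - \<beta> i) \<ge> lam};
              W = (\<lambda>i. whittle_index (\<alpha> i) (\<beta> i) (r i) (x i))
          in set_pmf (\<pi> h) \<subseteq> Some ` (if E \<noteq> {} then E else {i. \<forall>j. W j \<le> W i}))"

end

(*
  Relative values of the single arms at penalty lam give a Lagrangian bound: the optimum is
  at most lam + sum H_i = 2 lam. Conversely, a potential (the sum over the arms of a variant
  of the relative value) shows that every step of Threshold-Whittle after the first gains
  lam: if the index of some arm reaches lam, playing an arm of maximal index gains lam while
  the potential of the other arms does not drop; otherwise every arm gains H_i.
  Both directions need the Whittle index only through its comparison with lam. After a bad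
  observation, the policies "wait until the arm is s steps old" have gains F lam s, which
  are affine in lam with slopes monotone in s; so the optimal threshold is monotone in lam.
  If b = 0 < a, all these policies have the same gain, and only the
  bias, on which the index is based, determines the threshold.
*)
theory Submission
  imports Defs
begin

section \<open>Beliefs\<close>

text \<open>The relative value itself cannot serve as the potential: the belief in a good arm falls
  while the arm waits, so unplayed arms would lose value. The variant is flattened until waiting
  cannot lower it. Where exploitation can occur, aged good states all get \<open>- lam\<close>, a
  debt large enough for any play of them to gain \<open>lam\<close>, and bad states stop growing at
  the optimal threshold. The only drop left is at a fresh good state \<open>(True, 1)\<close>, and
  the exploitation rule prevents it: after a step at most one arm is fresh, which is why the first
  step is not counted. The index is a supremum, and several thresholds may tie at
  \<open>lam\<close>. For \<open>b > 0\<close> it is therefore approached through penalties slightly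
  below \<open>lam\<close>, where strict inequalities between the gains persist and the slopes break
  ties in favour of the least optimal threshold. A frozen arm (\<open>a = b = 0\<close>) has a gain
  that depends on its hidden state, so every certificate lives on an invariant set of information
  states.\<close>

primrec belief :: "real \<Rightarrow> real \<Rightarrow> bool \<Rightarrow> nat \<Rightarrow> real" where
  "belief a b s 0 = of_bool s"
| "belief a b s (Suc t) = a + (1 - a - b) * belief a b s t"

lemma belief_bounds:
  assumes "0 \<le> a" "0 \<le> b" "a + b \<le> 1"
  shows "0 \<le> belief a b s t \<and> belief a b s t \<le> 1"
proof (induction t)
  case (Suc t)
  have "(1 - a - b) * belief a b s t \<le> (1 - a - b) * 1"
    using Suc assms by (intro mult_left_mono) auto
  moreover have "0 \<le> (1 - a - b) * belief a b s t"
    using Suc assms by auto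
  ultimately show ?case using assms by simp
qed simp

lemma steps_pmf_eq_bernoulli:
  assumes "0 \<le> a" "0 \<le> b" "a + b \<le> 1"
  shows "steps_pmf a b t s = bernoulli_pmf (belief a b s t)"
proof (induction t)
  case 0
  show ?case by (cases s) (auto intro!: pmf_eqI simp: pmf_return split: split_indicator)
next
  case (Suc t)
  let ?q = "belief a b s t"
  have q: "0 \<le> ?q" "?q \<le> 1" "0 \<le> belief a b s (Suc t)" "belief a b s (Suc t) \<le> 1"
    using belief_bounds[OF assms] by blast+
  have "pmf (steps_pmf a b (Suc t) s) x = pmf (bernoulli_pmf (belief a b s (Suc t))) x" for x
    using q assms by (cases x) (simp_all add: Suc pmf_bind trans_pmf_def algebra_simps)
  thus ?case by (intro pmf_eqI)
qed

lemma expectation_steps: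
  assumes "0 \<le> a" "0 \<le> b" "a + b \<le> 1"
  shows "measure_pmf.expectation (steps_pmf a b t s) \<phi> =
    belief a b s t * \<phi> True + (1 - belief a b s t) * \<phi> (False :: bool)"
  using belief_bounds[OF assms, of s t]
  by (simp add: steps_pmf_eq_bernoulli[OF assms] algebra_simps)

lemma set_steps_pmf:
  assumes "0 \<le> a" "0 \<le> b" "a + b \<le> 1" and "y \<in> set_pmf (steps_pmf a b t s)"
  shows "if y then belief a b s t \<noteq> 0 else belief a b s t \<noteq> 1"
  using assms(4) belief_bounds[OF assms(1-3), of s t]
  by (cases y) (auto simp: steps_pmf_eq_bernoulli[OF assms(1-3)] set_pmf_iff)

section \<open>The history process\<close>

text \<open>The observation is drawn afresh from the law given by the information state, without
  carrying a hidden state along; \<open>run_eq_hist\<close> shows that the histories have the same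
  law.\<close>

definition observe ::
  "('a \<Rightarrow> real) \<Rightarrow> ('a \<Rightarrow> real) \<Rightarrow> ('a \<Rightarrow> info) \<Rightarrow> 'a history \<Rightarrow> 'a option \<Rightarrow> 'a history pmf"
where
  "observe \<alpha> \<beta> x0 h act = (case act of
     None \<Rightarrow> return_pmf (None # h)
   | Some i \<Rightarrow> map_pmf (\<lambda>s. Some (i, s) # h)
       (steps_pmf (\<alpha> i) (\<beta> i) (snd (info_of x0 h i)) (fst (info_of x0 h i))))"

primrec hist ::
  "('a \<Rightarrow> real) \<Rightarrow> ('a \<Rightarrow> real) \<Rightarrow> ('a \<Rightarrow> info) \<Rightarrow> 'a policy \<Rightarrow> nat \<Rightarrow> 'a history pmf"
where
  "hist \<alpha> \<beta> x0 \<pi> 0 = return_pmf []"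
| "hist \<alpha> \<beta> x0 \<pi> (Suc T) =
     bind_pmf (hist \<alpha> \<beta> x0 \<pi> T) (\<lambda>h. bind_pmf (\<pi> h) (observe \<alpha> \<beta> x0 h))"

definition hidden ::
  "('a::finite \<Rightarrow> real) \<Rightarrow> ('a \<Rightarrow> real) \<Rightarrow> ('a \<Rightarrow> info) \<Rightarrow> ('a \<Rightarrow> bool) pmf"
where
  "hidden \<alpha> \<beta> x = Pi_pmf UNIV False (\<lambda>i. steps_pmf (\<alpha> i) (\<beta> i) (snd (x i)) (fst (x i)))"

lemma hidden_step:
  "bind_pmf (hidden \<alpha> \<beta> x) (\<lambda>z. Pi_pmf UNIV False (\<lambda>i. trans_pmf (\<alpha> i) (\<beta> i) (z i)))
     = hidden \<alpha> \<beta> (\<lambda>i. (fst (x i), Suc (snd (x i))))"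
  unfolding hidden_def by (simp add: Pi_pmf_bind[where d' = False])

text \<open>A product law conditioned on its coordinate \<open>j\<close>. Age \<open>0\<close>
  encodes a state known at present, since \<open>steps_pmf\<close> with no step is a point mass;
  \<open>hidden_step\<close> then ages it to \<open>1\<close>.\<close>

lemma hidden_condition:
  "hidden \<alpha> \<beta> x = bind_pmf (steps_pmf (\<alpha> j) (\<beta> j) (snd (x j)) (fst (x j)))
     (\<lambda>s. hidden \<alpha> \<beta> (x(j := (s, 0))))"
proof -
  define p where "p i = steps_pmf (\<alpha> i) (\<beta> i) (snd (x i)) (fst (x i))" for i
  have U: "(UNIV :: 'a set) = insert j (UNIV - {j})" by auto
  have split: "Pi_pmf UNIV False q =
      bind_pmf (q j) (\<lambda>y. bind_pmf (Pi_pmf (UNIV - {j}) False q) (\<lambda>f. return_pmf (f(j := y))))"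
    for q :: "'a \<Rightarrow> bool pmf"
    by (subst U, subst Pi_pmf_insert') auto
  have "hidden \<alpha> \<beta> (x(j := (s, 0))) =
      bind_pmf (Pi_pmf (UNIV - {j}) False p) (\<lambda>f. return_pmf (f(j := s)))" for s
  proof -
    have eq: "Pi_pmf (UNIV - {j}) False
        (\<lambda>i. steps_pmf (\<alpha> i) (\<beta> i) (snd ((x(j := (s, 0))) i)) (fst ((x(j := (s, 0))) i)))
        = Pi_pmf (UNIV - {j}) False p"
      by (intro Pi_pmf_cong) (auto simp: p_def)
    show ?thesis unfolding hidden_def by (subst split) (simp add: eq bind_return_pmf del: fun_upd_apply, simp add: bind_return_pmf)
  qed
  thus ?thesis unfolding hidden_def[of \<alpha> \<beta> x] p_def[symmetric] by (subst split) simp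
qed

lemma hidden_deterministic:
  assumes "z \<in> set_pmf (hidden \<alpha> \<beta> (x(j := (s, 0))))"
  shows "z j = s"
  using assms unfolding hidden_def by (subst (asm) set_Pi_pmf) (auto simp: PiE_dflt_def dest!: spec[of _ j])

text \<open>
  Given the history, the hidden states are independent with the laws prescribed by the
  information states; this makes the information states a sufficient statistic.
\<close>

lemma run_eq_hist:
  "run \<alpha> \<beta> x0 \<pi> T =
     bind_pmf (hist \<alpha> \<beta> x0 \<pi> T) (\<lambda>h. map_pmf (\<lambda>z. (z, h)) (hidden \<alpha> \<beta> (info_of x0 h)))"
proof (induction T)
  case 0
  show ?case by (simp add: hidden_def bind_return_pmf)
next
  case (Suc T)
  let ?tr = "\<lambda>z. Pi_pmf UNIV False (\<lambda>i. trans_pmf (\<alpha> i) (\<beta> i) (z i))"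
  have step: "bind_pmf (hidden \<alpha> \<beta> (info_of x0 h))
        (\<lambda>z. map_pmf (\<lambda>z'. (z', map_option (\<lambda>i. (i, z i)) act # h)) (?tr z)) =
      bind_pmf (observe \<alpha> \<beta> x0 h act) (\<lambda>h. map_pmf (\<lambda>z. (z, h)) (hidden \<alpha> \<beta> (info_of x0 h)))"
    for h act
  proof (cases act)
    case None
    have "bind_pmf (hidden \<alpha> \<beta> (info_of x0 h)) (\<lambda>z. map_pmf (\<lambda>z'. (z', None # h)) (?tr z)) =
        map_pmf (\<lambda>z'. (z', None # h)) (bind_pmf (hidden \<alpha> \<beta> (info_of x0 h)) ?tr)"
      by (simp add: map_bind_pmf)
    thus ?thesis using None by (simp add: observe_def bind_return_pmf hidden_step)
  next
    case (Some j)
    let ?x = "info_of x0 h"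
    have "bind_pmf (hidden \<alpha> \<beta> (?x(j := (s, 0))))
          (\<lambda>z. map_pmf (\<lambda>z'. (z', Some (j, z j) # h)) (?tr z)) =
        map_pmf (\<lambda>z. (z, Some (j, s) # h)) (hidden \<alpha> \<beta> (info_of x0 (Some (j, s) # h)))" for s
    proof -
      have "bind_pmf (hidden \<alpha> \<beta> (?x(j := (s, 0))))
          (\<lambda>z. map_pmf (\<lambda>z'. (z', Some (j, z j) # h)) (?tr z)) =
        bind_pmf (hidden \<alpha> \<beta> (?x(j := (s, 0))))
          (\<lambda>z. map_pmf (\<lambda>z'. (z', Some (j, s) # h)) (?tr z))"
        by (intro bind_pmf_cong refl) (simp add: hidden_deterministic)
      also have "\<dots> = map_pmf (\<lambda>z'. (z', Some (j, s) # h))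
          (bind_pmf (hidden \<alpha> \<beta> (?x(j := (s, 0)))) ?tr)"
        by (simp add: map_bind_pmf)
      also have "bind_pmf (hidden \<alpha> \<beta> (?x(j := (s, 0)))) ?tr =
          hidden \<alpha> \<beta> (info_of x0 (Some (j, s) # h))"
        unfolding hidden_step by (rule arg_cong[where f = "hidden \<alpha> \<beta>"]) (auto simp: fun_eq_iff Let_def)
      finally show ?thesis .
    qed
    thus ?thesis using Some
      by (subst hidden_condition[of _ _ _ j])
         (simp add: observe_def bind_assoc_pmf bind_map_pmf del: info_of.simps)
  qed
  \<comment> \<open>The action is drawn from the history alone, so its draw can be moved in front of
    that of the hidden states.\<close>
  have "run \<alpha> \<beta> x0 \<pi> (Suc T) = bind_pmf (hist \<alpha> \<beta> x0 \<pi> T) (\<lambda>h. bind_pmf (\<pi> h) (\<lambda>act.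
      bind_pmf (hidden \<alpha> \<beta> (info_of x0 h))
        (\<lambda>z. map_pmf (\<lambda>z'. (z', map_option (\<lambda>i. (i, z i)) act # h)) (?tr z))))"
    by (simp add: Suc bind_assoc_pmf bind_map_pmf bind_commute_pmf[of "hidden \<alpha> \<beta> _"])
  also have "\<dots> = bind_pmf (hist \<alpha> \<beta> x0 \<pi> (Suc T))
      (\<lambda>h. map_pmf (\<lambda>z. (z, h)) (hidden \<alpha> \<beta> (info_of x0 h)))"
    unfolding step by (simp add: bind_assoc_pmf)
  finally show ?case .
qed

lemma total_eq_hist:
  "total \<alpha> \<beta> r c x0 \<pi> T = measure_pmf.expectation (hist \<alpha> \<beta> x0 \<pi> T) (net_reward r c)"
proof -
  have "map_pmf snd (run \<alpha> \<beta> x0 \<pi> T) = hist \<alpha> \<beta> x0 \<pi> T"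
    by (simp add: run_eq_hist map_bind_pmf pmf.map_comp o_def map_pmf_const bind_return_pmf')
  moreover have "total \<alpha> \<beta> r c x0 \<pi> T =
      measure_pmf.expectation (map_pmf snd (run \<alpha> \<beta> x0 \<pi> T)) (net_reward r c)"
    by (simp add: total_def case_prod_beta')
  ultimately show ?thesis by simp
qed

lemma set_observe_length:
  "h' \<in> set_pmf (observe \<alpha> \<beta> x0 h act) \<Longrightarrow> length h' = Suc (length h)"
  by (auto simp: observe_def split: option.splits)

lemma set_hist_length:
  "h \<in> set_pmf (hist \<alpha> \<beta> x0 \<pi> T) \<Longrightarrow> length h = T"
  by (induction T arbitrary: h) (auto dest!: set_observe_length)

lemma finite_set_observe [simp]: "finite (set_pmf (observe \<alpha> \<beta> x0 h act))"
  by (auto simp: observe_def split: option.splits)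

text \<open>Finitely many arms and Boolean observations: all expectations below are finite sums,
  whatever the policy, and integrability is automatic.\<close>

lemma finite_set_hist [simp]:
  fixes \<alpha> :: "'a::finite \<Rightarrow> real"
  shows "finite (set_pmf (hist \<alpha> \<beta> x0 \<pi> T))"
  by (induction T) auto

lemma expectation_bind_finite:
  assumes "finite (set_pmf p)" "\<And>x. x \<in> set_pmf p \<Longrightarrow> finite (set_pmf (f x))"
  shows "measure_pmf.expectation (bind_pmf p f) \<phi> =
    measure_pmf.expectation p (\<lambda>x. measure_pmf.expectation (f x) (\<phi> :: _ \<Rightarrow> real))"
  using assms
  by (subst pmf_expectation_bind[of "set_pmf p"]) (auto simp: integral_measure_pmf[of "set_pmf p"])

lemma expectation_mono_finite:
  assumes "finite (set_pmf p)" "\<And>x. x \<in> set_pmf p \<Longrightarrow> \<phi> x \<le> (\<psi> x :: real)"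
  shows "measure_pmf.expectation p \<phi> \<le> measure_pmf.expectation p \<psi>"
  using assms by (intro integral_mono_AE integrable_measure_pmf_finite) (auto simp: AE_measure_pmf_iff)

lemma expectation_hist_Suc:
  fixes \<alpha> :: "'a::finite \<Rightarrow> real" and \<phi> :: "'a history \<Rightarrow> real"
  shows "measure_pmf.expectation (hist \<alpha> \<beta> x0 \<pi> (Suc T)) \<phi> =
    measure_pmf.expectation (hist \<alpha> \<beta> x0 \<pi> T)
      (\<lambda>h. measure_pmf.expectation (\<pi> h) (\<lambda>act. measure_pmf.expectation (observe \<alpha> \<beta> x0 h act) \<phi>))"
  by (simp add: expectation_bind_finite)

text \<open>A drift condition, required only on reachable histories and actions. Applied to a
  negated function it also yields lower bounds.\<close>

lemma expectation_hist_growth: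
  fixes \<alpha> :: "'a::finite \<Rightarrow> real" and \<Psi> :: "'a history \<Rightarrow> real"
  assumes "\<And>h act. h \<in> set_pmf (hist \<alpha> \<beta> x0 \<pi> T) \<Longrightarrow> act \<in> set_pmf (\<pi> h) \<Longrightarrow>
      measure_pmf.expectation (observe \<alpha> \<beta> x0 h act) \<Psi> \<le> \<Psi> h + c"
  shows "measure_pmf.expectation (hist \<alpha> \<beta> x0 \<pi> (Suc T)) \<Psi> \<le>
    measure_pmf.expectation (hist \<alpha> \<beta> x0 \<pi> T) \<Psi> + c"
proof -
  have "measure_pmf.expectation (\<pi> h) (\<lambda>act. measure_pmf.expectation (observe \<alpha> \<beta> x0 h act) \<Psi>)
      \<le> \<Psi> h + c" if "h \<in> set_pmf (hist \<alpha> \<beta> x0 \<pi> T)" for h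
    using expectation_mono_finite[of "\<pi> h"
        "\<lambda>act. measure_pmf.expectation (observe \<alpha> \<beta> x0 h act) \<Psi>" "\<lambda>_. \<Psi> h + c"]
      assms[OF that] by simp
  hence "measure_pmf.expectation (hist \<alpha> \<beta> x0 \<pi> (Suc T)) \<Psi> \<le>
      measure_pmf.expectation (hist \<alpha> \<beta> x0 \<pi> T) (\<lambda>h. \<Psi> h + c)"
    unfolding expectation_hist_Suc by (intro expectation_mono_finite) auto
  thus ?thesis by (simp add: integrable_measure_pmf_finite)
qed

section \<open>One-step operators on information states\<close>

definition act_rew :: "real \<Rightarrow> real \<Rightarrow> real \<Rightarrow> real \<Rightarrow> bool \<Rightarrow> info \<Rightarrow> real" where
  "act_rew a b \<rho> c play x = (if play then belief a b (fst x) (snd x) * \<rho> - c else 0)"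

definition act_next :: "real \<Rightarrow> real \<Rightarrow> bool \<Rightarrow> (info \<Rightarrow> real) \<Rightarrow> info \<Rightarrow> real" where
  "act_next a b play \<phi> x =
     (if play
      then belief a b (fst x) (snd x) * \<phi> (True, 1) + (1 - belief a b (fst x) (snd x)) * \<phi> (False, 1)
      else \<phi> (fst x, Suc (snd x)))"

lemma net_reward_Cons:
  "net_reward r c (e # h) =
    (case e of None \<Rightarrow> 0 | Some (i, s) \<Rightarrow> (if s then r i else 0) - c) + net_reward r c h"
  by (simp add: net_reward_def)

text \<open>The problem decouples here: a sum of functions of single arms changes arm by arm, and
  only the summand of the played arm is random.\<close>

lemma expectation_observe:
  fixes \<alpha> \<beta> r :: "'a::finite \<Rightarrow> real"
  assumes "\<And>i. 0 \<le> \<alpha> i" "\<And>i. 0 \<le> \<beta> i" "\<And>i. \<alpha> i + \<beta> i \<le> 1"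
  shows "measure_pmf.expectation (observe \<alpha> \<beta> x0 h act)
      (\<lambda>h. net_reward r c h + (\<Sum>i\<in>UNIV. \<phi> i (info_of x0 h i))) =
    net_reward r c h +
      (\<Sum>i\<in>UNIV. act_rew (\<alpha> i) (\<beta> i) (r i) c (act = Some i) (info_of x0 h i)
        + act_next (\<alpha> i) (\<beta> i) (act = Some i) (\<phi> i) (info_of x0 h i))"
proof (cases act)
  case None
  thus ?thesis
    by (simp add: observe_def act_rew_def act_next_def net_reward_Cons Let_def)
next
  case (Some j)
  let ?x = "info_of x0 h"
  let ?p = "belief (\<alpha> j) (\<beta> j) (fst (?x j)) (snd (?x j))"
  define R where "R = (\<Sum>i\<in>UNIV - {j}. \<phi> i (fst (?x i), Suc (snd (?x i))))"
  have sum: "(\<Sum>i\<in>UNIV. \<phi> i (info_of x0 (Some (j, s) # h) i)) = \<phi> j (s, 1) + R" for s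
  proof -
    have "(\<Sum>i\<in>UNIV. \<phi> i (info_of x0 (Some (j, s) # h) i)) =
       \<phi> j (info_of x0 (Some (j, s) # h) j) +
       (\<Sum>i\<in>UNIV - {j}. \<phi> i (info_of x0 (Some (j, s) # h) i))"
      by (rule sum.remove) auto
    also have "(\<Sum>i\<in>UNIV - {j}. \<phi> i (info_of x0 (Some (j, s) # h) i)) = R"
      unfolding R_def by (intro sum.cong) (auto simp: Let_def)
    finally show ?thesis by (simp add: Let_def)
  qed
  have sum2: "(\<Sum>i\<in>UNIV. act_rew (\<alpha> i) (\<beta> i) (r i) c (act = Some i) (?x i)
        + act_next (\<alpha> i) (\<beta> i) (act = Some i) (\<phi> i) (?x i)) =
      ?p * r j - c + (?p * \<phi> j (True, 1) + (1 - ?p) * \<phi> j (False, 1)) + R"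
  proof -
    have "(\<Sum>i\<in>UNIV. act_rew (\<alpha> i) (\<beta> i) (r i) c (act = Some i) (?x i)
        + act_next (\<alpha> i) (\<beta> i) (act = Some i) (\<phi> i) (?x i)) =
       (act_rew (\<alpha> j) (\<beta> j) (r j) c (act = Some j) (?x j)
        + act_next (\<alpha> j) (\<beta> j) (act = Some j) (\<phi> j) (?x j)) +
       (\<Sum>i\<in>UNIV - {j}. act_rew (\<alpha> i) (\<beta> i) (r i) c (act = Some i) (?x i)
        + act_next (\<alpha> i) (\<beta> i) (act = Some i) (\<phi> i) (?x i))"
      by (rule sum.remove) auto
    also have "(\<Sum>i\<in>UNIV - {j}. act_rew (\<alpha> i) (\<beta> i) (r i) c (act = Some i) (?x i)
        + act_next (\<alpha> i) (\<beta> i) (act = Some i) (\<phi> i) (?x i)) = R"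
      unfolding R_def using Some by (intro sum.cong) (auto simp: act_rew_def act_next_def)
    finally show ?thesis using Some by (simp add: act_rew_def act_next_def)
  qed
  have "measure_pmf.expectation (observe \<alpha> \<beta> x0 h act)
      (\<lambda>h. net_reward r c h + (\<Sum>i\<in>UNIV. \<phi> i (info_of x0 h i))) =
    measure_pmf.expectation (steps_pmf (\<alpha> j) (\<beta> j) (snd (?x j)) (fst (?x j)))
      (\<lambda>s. (if s then r j else 0) - c + net_reward r c h + (\<phi> j (s, 1) + R))"
    using Some by (simp add: observe_def net_reward_Cons sum del: info_of.simps)
  also have "\<dots> = ?p * (r j - c + net_reward r c h + (\<phi> j (True, 1) + R)) +
      (1 - ?p) * (0 - c + net_reward r c h + (\<phi> j (False, 1) + R))"
    using assms by (subst expectation_steps) auto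
  finally show ?thesis unfolding sum2 by (simp add: algebra_simps)
qed

text \<open>Only observations of positive probability are followed, so that a frozen arm can be
  confined to the information states that agree with its initial observation.\<close>

definition closed_info :: "real \<Rightarrow> real \<Rightarrow> info set \<Rightarrow> bool" where
  "closed_info a b S \<longleftrightarrow> (\<forall>x\<in>S. (fst x, Suc (snd x)) \<in> S \<and>
     (belief a b (fst x) (snd x) \<noteq> 0 \<longrightarrow> (True, 1) \<in> S) \<and>
     (belief a b (fst x) (snd x) \<noteq> 1 \<longrightarrow> (False, 1) \<in> S))"

lemma info_of_in_closed:
  assumes "\<And>i. 0 \<le> \<alpha> i" "\<And>i. 0 \<le> \<beta> i" "\<And>i. \<alpha> i + \<beta> i \<le> 1"
    and "\<And>i. closed_info (\<alpha> i) (\<beta> i) (S i)" "\<And>i. x0 i \<in> S i"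
    and "h \<in> set_pmf (hist \<alpha> \<beta> x0 \<pi> T)"
  shows "info_of x0 h i \<in> S i"
  using assms(6)
proof (induction T arbitrary: h i)
  case 0
  thus ?case using assms(5) by simp
next
  case (Suc T)
  then obtain g act where g: "g \<in> set_pmf (hist \<alpha> \<beta> x0 \<pi> T)"
    and h: "h \<in> set_pmf (observe \<alpha> \<beta> x0 g act)" by auto
  note IH = Suc.IH[OF g]
  show ?case
  proof (cases act)
    case None
    thus ?thesis using h IH[of i] assms(4)[of i]
      by (auto simp: observe_def closed_info_def Let_def)
  next
    case (Some j)
    then obtain s where s: "s \<in> set_pmf (steps_pmf (\<alpha> j) (\<beta> j) (snd (info_of x0 g j)) (fst (info_of x0 g j)))"
      and [simp]: "h = Some (j, s) # g" using h by (auto simp: observe_def)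
    have "(s, 1) \<in> S j"
      using set_steps_pmf[OF assms(1-3) s] IH[of j] assms(4)[of j]
      by (cases s) (auto simp: closed_info_def)
    thus ?thesis using IH[of i] assms(4)[of i] by (auto simp: closed_info_def Let_def)
  qed
qed

text \<open>The average-reward optimality equation relaxed to an inequality, which suffices to bound
  the gain of every policy by \<open>H\<close>.\<close>

definition supersolution ::
  "real \<Rightarrow> real \<Rightarrow> real \<Rightarrow> real \<Rightarrow> info set \<Rightarrow> real \<Rightarrow> (info \<Rightarrow> real) \<Rightarrow> bool"
where
  "supersolution a b \<rho> lam S H \<phi> \<longleftrightarrow>
     (\<forall>x\<in>S. \<forall>play. act_rew a b \<rho> lam play x + act_next a b play \<phi> x \<le> H + \<phi> x)"

text \<open>
  Lagrangian bound: a policy plays at most one arm per step, so charging \<open>lam\<close> per play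
  instead of \<open>c\<close> costs it at most \<open>lam - c\<close> per step and decouples the arms.
\<close>

lemma total_le_supersolution:
  fixes \<alpha> \<beta> r :: "'a::finite \<Rightarrow> real"
  assumes arm: "\<And>i. 0 \<le> \<alpha> i" "\<And>i. 0 \<le> \<beta> i" "\<And>i. \<alpha> i + \<beta> i \<le> 1"
    and cl: "\<And>i. closed_info (\<alpha> i) (\<beta> i) (S i)" "\<And>i. x0 i \<in> S i"
    and sup: "\<And>i. supersolution (\<alpha> i) (\<beta> i) (r i) lam (S i) (H i) (\<phi> i)"
    and bnd: "\<And>i x. x \<in> S i \<Longrightarrow> \<bar>\<phi> i x\<bar> \<le> M i"
    and c: "c \<le> lam"
  shows "total \<alpha> \<beta> r c x0 \<pi> T \<le> real T * (lam - c + (\<Sum>i\<in>UNIV. H i)) + 2 * (\<Sum>i\<in>UNIV. M i)"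
proof -
  \<comment> \<open>The drift of \<open>\<Psi>\<close> is at most \<open>?g\<close>. With
    \<open>c = 0\<close> this bounds the unpenalised problem; with \<open>c = lam\<close> it shows
    that \<open>H\<close> bounds the single-arm problem.\<close>
  define \<Psi> where "\<Psi> h = net_reward r c h + (\<Sum>i\<in>UNIV. \<phi> i (info_of x0 h i))" for h
  let ?E = "\<lambda>T. measure_pmf.expectation (hist \<alpha> \<beta> x0 \<pi> T)"
  let ?g = "lam - c + (\<Sum>i\<in>UNIV. H i)"
  have step: "measure_pmf.expectation (observe \<alpha> \<beta> x0 h act) \<Psi> \<le> \<Psi> h + ?g"
    if h: "h \<in> set_pmf (hist \<alpha> \<beta> x0 \<pi> T)" for h act T
  proof -
    let ?x = "info_of x0 h"
    have "act_rew (\<alpha> i) (\<beta> i) (r i) c (act = Some i) (?x i)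
        + act_next (\<alpha> i) (\<beta> i) (act = Some i) (\<phi> i) (?x i)
      \<le> (if act = Some i then lam - c else 0) + (H i + \<phi> i (?x i))" for i
    proof -
      have "?x i \<in> S i" by (rule info_of_in_closed[OF arm cl h])
      hence "act_rew (\<alpha> i) (\<beta> i) (r i) lam (act = Some i) (?x i)
        + act_next (\<alpha> i) (\<beta> i) (act = Some i) (\<phi> i) (?x i) \<le> H i + \<phi> i (?x i)"
        using sup[of i] unfolding supersolution_def by blast
      thus ?thesis by (auto simp: act_rew_def)
    qed
    hence "(\<Sum>i\<in>UNIV. act_rew (\<alpha> i) (\<beta> i) (r i) c (act = Some i) (?x i)
        + act_next (\<alpha> i) (\<beta> i) (act = Some i) (\<phi> i) (?x i))
      \<le> (\<Sum>i\<in>UNIV. (if act = Some i then lam - c else 0) + (H i + \<phi> i (?x i)))"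
      by (intro sum_mono)
    also have "\<dots> = (\<Sum>i\<in>UNIV. if act = Some i then lam - c else 0)
        + ((\<Sum>i\<in>UNIV. H i) + (\<Sum>i\<in>UNIV. \<phi> i (?x i)))"
      by (simp add: sum.distrib)
    finally have "(\<Sum>i\<in>UNIV. act_rew (\<alpha> i) (\<beta> i) (r i) c (act = Some i) (?x i)
        + act_next (\<alpha> i) (\<beta> i) (act = Some i) (\<phi> i) (?x i))
      \<le> (\<Sum>i\<in>UNIV. if act = Some i then lam - c else 0)
        + ((\<Sum>i\<in>UNIV. H i) + (\<Sum>i\<in>UNIV. \<phi> i (?x i)))" .
    moreover have "(\<Sum>i\<in>UNIV. if act = Some i then lam - c else 0) \<le> lam - c"
      using c by (cases act) auto
    ultimately show ?thesis
      unfolding \<Psi>_def expectation_observe[OF arm, where \<phi> = \<phi>] by linarith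
  qed
  have E: "?E T \<Psi> \<le> \<Psi> [] + real T * ?g" for T
  proof (induction T)
    case (Suc T)
    have "?E (Suc T) \<Psi> \<le> ?E T \<Psi> + ?g"
      by (rule expectation_hist_growth) (rule step)
    thus ?case using Suc by (simp add: algebra_simps)
  qed simp
  have "?E T (\<lambda>h. net_reward r c h - (\<Sum>i\<in>UNIV. M i)) \<le> ?E T \<Psi>"
  proof (rule expectation_mono_finite)
    fix h assume h: "h \<in> set_pmf (hist \<alpha> \<beta> x0 \<pi> T)"
    have "- M i \<le> \<phi> i (info_of x0 h i)" for i
      using bnd[OF info_of_in_closed[OF arm cl h, of i]] by (auto simp: abs_le_iff)
    hence "(\<Sum>i\<in>UNIV. - M i) \<le> (\<Sum>i\<in>UNIV. \<phi> i (info_of x0 h i))" by (intro sum_mono)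
    thus "net_reward r c h - (\<Sum>i\<in>UNIV. M i) \<le> \<Psi> h" by (simp add: \<Psi>_def sum_negf)
  qed simp
  moreover have "\<Psi> [] \<le> (\<Sum>i\<in>UNIV. M i)"
    using bnd[OF cl(2)] by (auto simp: \<Psi>_def net_reward_def abs_le_iff intro!: sum_mono)
  ultimately show ?thesis using E[of T]
    by (simp add: total_eq_hist integrable_measure_pmf_finite)
qed

section \<open>Stationary policies of a single arm\<close>

abbreviation total1 ::
  "real \<Rightarrow> real \<Rightarrow> real \<Rightarrow> real \<Rightarrow> (info \<Rightarrow> bool) \<Rightarrow> info \<Rightarrow> nat \<Rightarrow> real"
where
  "total1 a b \<rho> lam f x \<equiv>
     total (\<lambda>_. a) (\<lambda>_. b) (\<lambda>_. \<rho>) lam (\<lambda>_. x) (stationary_policy x f)"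

text \<open>The Markov operator of the chain that the decision rule \<open>f\<close> induces on
  information states; its powers replace histories.\<close>

definition chain_op :: "real \<Rightarrow> real \<Rightarrow> (info \<Rightarrow> bool) \<Rightarrow> (info \<Rightarrow> real) \<Rightarrow> info \<Rightarrow> real" where
  "chain_op a b f \<phi> x = act_next a b (f x) \<phi> x"

definition chain_rew :: "real \<Rightarrow> real \<Rightarrow> real \<Rightarrow> real \<Rightarrow> (info \<Rightarrow> bool) \<Rightarrow> info \<Rightarrow> real" where
  "chain_rew a b \<rho> lam f x = act_rew a b \<rho> lam (f x) x"

lemma expectation_stationary_Suc:
  assumes "0 \<le> a" "0 \<le> b" "a + b \<le> 1"
  shows "measure_pmf.expectation (hist (\<lambda>_. a) (\<lambda>_. b) (\<lambda>_. x) (stationary_policy x f) (Suc T))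
      (\<lambda>h. net_reward (\<lambda>_. \<rho>) c h + \<phi> (info_of (\<lambda>_. x) h ())) =
    measure_pmf.expectation (hist (\<lambda>_. a) (\<lambda>_. b) (\<lambda>_. x) (stationary_policy x f) T)
      (\<lambda>h. net_reward (\<lambda>_. \<rho>) c h + (chain_rew a b \<rho> c f (info_of (\<lambda>_. x) h ())
        + chain_op a b f \<phi> (info_of (\<lambda>_. x) h ())))"
proof -
  have eq: "measure_pmf.expectation (observe (\<lambda>_. a) (\<lambda>_. b) (\<lambda>_. x) h act)
      (\<lambda>h. net_reward (\<lambda>_. \<rho>) c h + \<phi> (info_of (\<lambda>_. x) h ())) =
    net_reward (\<lambda>_. \<rho>) c h + (act_rew a b \<rho> c (act = Some ()) (info_of (\<lambda>_. x) h ())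
        + act_next a b (act = Some ()) \<phi> (info_of (\<lambda>_. x) h ()))" for h act
    using expectation_observe[of "\<lambda>_. a" "\<lambda>_. b" "\<lambda>_. x" h act "\<lambda>_. \<rho>" c "\<lambda>_. \<phi>"] assms
    by (simp add: UNIV_unit)
  have if_Some: "((if P then Some () else None) = Some ()) = P" for P by simp
  show ?thesis
    unfolding expectation_hist_Suc eq
    by (simp add: stationary_policy_def chain_rew_def chain_op_def if_Some)
qed

text \<open>The last step is absorbed into the terminal payoff \<open>\<phi>\<close>, which is
  therefore arbitrary in the induction.\<close>

lemma expectation_stationary:
  assumes "0 \<le> a" "0 \<le> b" "a + b \<le> 1"
  shows "measure_pmf.expectation (hist (\<lambda>_. a) (\<lambda>_. b) (\<lambda>_. x) (stationary_policy x f) T)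
      (\<lambda>h. net_reward (\<lambda>_. \<rho>) c h + \<phi> (info_of (\<lambda>_. x) h ())) =
    (\<Sum>k<T. (chain_op a b f ^^ k) (chain_rew a b \<rho> c f) x) + (chain_op a b f ^^ T) \<phi> x"
proof (induction T arbitrary: \<phi>)
  case 0
  show ?case by (simp add: net_reward_def)
next
  case (Suc T)
  let ?P = "chain_op a b f" and ?R = "chain_rew a b \<rho> c f"
  have lin: "(?P ^^ k) (\<lambda>y. \<psi> y + \<xi> y) = (\<lambda>y. (?P ^^ k) \<psi> y + (?P ^^ k) \<xi> y)" for k \<psi> \<xi>
    by (induction k) (auto simp: chain_op_def act_next_def fun_eq_iff algebra_simps)
  show ?case
    unfolding expectation_stationary_Suc[OF assms, where \<phi> = \<phi>]
    by (subst Suc[of "\<lambda>y. ?R y + ?P \<phi> y"]) (simp add: lin funpow_swap1)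
qed

lemma total1_eq:
  assumes "0 \<le> a" "0 \<le> b" "a + b \<le> 1"
  shows "total1 a b \<rho> c f x T = (\<Sum>k<T. (chain_op a b f ^^ k) (chain_rew a b \<rho> c f) x)"
proof -
  have "(chain_op a b f ^^ T) (\<lambda>_. 0) x = 0"
    by (induction T arbitrary: x) (auto simp: chain_op_def act_next_def)
  thus ?thesis using expectation_stationary[OF assms, of x f T \<rho> c "\<lambda>_. 0"]
    by (simp add: total_eq_hist)
qed

text \<open>Closure under the actions of \<open>f\<close> only: a rule that plays bad arms at some
  age never leaves the ages up to it, as \<open>optimal_play_best\<close> exploits.\<close>

definition closed_chain :: "real \<Rightarrow> real \<Rightarrow> (info \<Rightarrow> bool) \<Rightarrow> info set \<Rightarrow> bool" where
  "closed_chain a b f S \<longleftrightarrow> (\<forall>x\<in>S.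
     if f x then (belief a b (fst x) (snd x) \<noteq> 0 \<longrightarrow> (True, 1) \<in> S) \<and>
                 (belief a b (fst x) (snd x) \<noteq> 1 \<longrightarrow> (False, 1) \<in> S)
     else (fst x, Suc (snd x)) \<in> S)"

lemma closed_info_chain: "closed_info a b S \<Longrightarrow> closed_chain a b f S"
  by (auto simp: closed_info_def closed_chain_def)

text \<open>The negated advantage function: how far an action falls short in the optimality equation
  with gain \<open>H\<close> and relative value \<open>\<phi>\<close>.\<close>

definition loss ::
  "real \<Rightarrow> real \<Rightarrow> real \<Rightarrow> real \<Rightarrow> real \<Rightarrow> (info \<Rightarrow> real) \<Rightarrow> bool \<Rightarrow> info \<Rightarrow> real"
where
  "loss a b \<rho> lam H \<phi> play x = H + \<phi> x - act_rew a b \<rho> lam play x - act_next a b play \<phi> x"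

lemma supersolution_loss:
  "supersolution a b \<rho> lam S H \<phi> \<longleftrightarrow> (\<forall>x\<in>S. \<forall>play. 0 \<le> loss a b \<rho> lam H \<phi> play x)"
proof -
  have "0 \<le> loss a b \<rho> lam H \<phi> play x \<longleftrightarrow>
      act_rew a b \<rho> lam play x + act_next a b play \<phi> x \<le> H + \<phi> x" for play x
    unfolding loss_def by linarith
  thus ?thesis by (simp add: supersolution_def)
qed

lemma chain_pow_linear:
  "(chain_op a b f ^^ k) (\<lambda>y. c * \<phi> y + d * \<psi> y) =
    (\<lambda>y. c * (chain_op a b f ^^ k) \<phi> y + d * (chain_op a b f ^^ k) \<psi> y)"
  by (induction k) (auto simp: chain_op_def act_next_def fun_eq_iff algebra_simps)

lemma chain_pow_const: "(chain_op a b f ^^ k) (\<lambda>_. c) = (\<lambda>_. c)"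
  by (induction k) (auto simp: chain_op_def act_next_def fun_eq_iff algebra_simps)

lemma sum_chain_telescope:
  "(\<Sum>k<N. (chain_op a b f ^^ k) (\<lambda>y. chain_op a b f \<phi> y - \<phi> y) x) =
    (chain_op a b f ^^ N) \<phi> x - \<phi> x"
proof (induction N)
  case (Suc N)
  have "(chain_op a b f ^^ N) (\<lambda>y. chain_op a b f \<phi> y - \<phi> y) x =
      (chain_op a b f ^^ Suc N) \<phi> x - (chain_op a b f ^^ N) \<phi> x"
    using fun_cong[OF chain_pow_linear[of N a b f 1 "chain_op a b f \<phi>" "-1" \<phi>], of x]
    by (simp add: funpow_swap1)
  thus ?case using Suc by simp
qed simp

text \<open>A Markov operator is positive. Successors of probability zero may lie outside
  \<open>S\<close>, hence the cases of belief \<open>0\<close> and \<open>1\<close>.\<close>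

lemma chain_pow_mono:
  assumes arm: "0 \<le> a" "0 \<le> b" "a + b \<le> 1"
    and cl: "closed_chain a b f S" and x: "x \<in> S"
    and le: "\<And>y. y \<in> S \<Longrightarrow> \<phi> y \<le> \<psi> y"
  shows "(chain_op a b f ^^ k) \<phi> x \<le> (chain_op a b f ^^ k) \<psi> x"
  using x
proof (induction k arbitrary: x)
  case 0
  thus ?case using le by simp
next
  case (Suc k)
  let ?p = "belief a b (fst x) (snd x)"
  let ?A = "(chain_op a b f ^^ k) \<phi>" and ?B = "(chain_op a b f ^^ k) \<psi>"
  have p: "0 \<le> ?p" "?p \<le> 1" using belief_bounds[OF arm] by auto
  have "act_next a b (f x) ?A x \<le> act_next a b (f x) ?B x"
  proof (cases "f x")
    case True
    have "?p * ?A (True, 1) \<le> ?p * ?B (True, 1)"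
    proof (cases "?p = 0")
      case False
      hence "(True, 1) \<in> S" using cl Suc.prems True by (auto simp: closed_chain_def)
      thus ?thesis using p by (intro mult_left_mono Suc.IH) auto
    qed simp
    moreover have "(1 - ?p) * ?A (False, 1) \<le> (1 - ?p) * ?B (False, 1)"
    proof (cases "?p = 1")
      case False
      hence "(False, 1) \<in> S" using cl Suc.prems True by (auto simp: closed_chain_def)
      thus ?thesis using p by (intro mult_left_mono Suc.IH) auto
    qed simp
    ultimately show ?thesis using True by (simp add: act_next_def)
  next
    case False
    hence "(fst x, Suc (snd x)) \<in> S" using cl Suc.prems by (auto simp: closed_chain_def)
    thus ?thesis using False Suc.IH by (simp add: act_next_def)
  qed
  thus ?case by (simp add: chain_op_def[of _ _ _ _ x])
qed

lemma chain_pow_bounded: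
  assumes arm: "0 \<le> a" "0 \<le> b" "a + b \<le> 1"
    and cl: "closed_chain a b f S" and x: "x \<in> S"
    and bnd: "\<forall>y\<in>S. \<bar>\<phi> y\<bar> \<le> M"
  shows "\<bar>(chain_op a b f ^^ k) \<phi> x\<bar> \<le> M"
proof -
  have "(chain_op a b f ^^ k) \<phi> x \<le> (chain_op a b f ^^ k) (\<lambda>_. M) x"
    using bnd by (intro chain_pow_mono[OF arm cl x]) (auto simp: abs_le_iff)
  moreover have "(chain_op a b f ^^ k) (\<lambda>_. - M) x \<le> (chain_op a b f ^^ k) \<phi> x"
    using bnd by (intro chain_pow_mono[OF arm cl x]) (auto simp: abs_le_iff)
  ultimately show ?thesis by (simp add: chain_pow_const abs_le_iff)
qed

definition cum_loss ::
  "real \<Rightarrow> real \<Rightarrow> real \<Rightarrow> real \<Rightarrow> real \<Rightarrow> (info \<Rightarrow> real) \<Rightarrow> (info \<Rightarrow> bool) \<Rightarrow> info \<Rightarrow> nat \<Rightarrow> real"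
where
  "cum_loss a b \<rho> lam H \<phi> f x T =
     (\<Sum>k<T. (chain_op a b f ^^ k) (\<lambda>y. loss a b \<rho> lam H \<phi> (f y) y) x)"

text \<open>Solving the definition of \<open>loss\<close> for the reward and telescoping
  \<open>\<phi>\<close> gives an exact account: the gain, two boundary terms and the accumulated
  losses.\<close>

lemma total1_loss:
  assumes "0 \<le> a" "0 \<le> b" "a + b \<le> 1"
  shows "total1 a b \<rho> lam f x T =
    real T * H + \<phi> x - (chain_op a b f ^^ T) \<phi> x - cum_loss a b \<rho> lam H \<phi> f x T"
proof -
  let ?P = "chain_op a b f"
  have "(?P ^^ k) (chain_rew a b \<rho> lam f) x = H - (?P ^^ k) (\<lambda>y. ?P \<phi> y - \<phi> y) x
      - (?P ^^ k) (\<lambda>y. loss a b \<rho> lam H \<phi> (f y) y) x" for k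
  proof -
    have 1: "chain_rew a b \<rho> lam f = (\<lambda>y. 1 * (1 * H + (-1) * (?P \<phi> y - \<phi> y))
        + (-1) * loss a b \<rho> lam H \<phi> (f y) y)"
      by (simp add: fun_eq_iff chain_rew_def chain_op_def loss_def)
    show ?thesis unfolding 1 chain_pow_linear chain_pow_const by simp
  qed
  hence "(\<Sum>k<T. (?P ^^ k) (chain_rew a b \<rho> lam f) x) =
      real T * H - (\<Sum>k<T. (?P ^^ k) (\<lambda>y. ?P \<phi> y - \<phi> y) x) - cum_loss a b \<rho> lam H \<phi> f x T"
    by (simp add: sum_subtractf cum_loss_def)
  thus ?thesis unfolding total1_eq[OF assms] sum_chain_telescope by simp
qed

lemma cum_loss_nonneg:
  assumes arm: "0 \<le> a" "0 \<le> b" "a + b \<le> 1"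
    and cl: "closed_chain a b f S" and x: "x \<in> S"
    and L: "\<forall>y\<in>S. 0 \<le> loss a b \<rho> lam H \<phi> (f y) y"
  shows "0 \<le> cum_loss a b \<rho> lam H \<phi> f x T"
  unfolding cum_loss_def
  using chain_pow_mono[OF arm cl x, of "\<lambda>_. 0" "\<lambda>y. loss a b \<rho> lam H \<phi> (f y) y"] L
  by (intro sum_nonneg) (simp add: chain_pow_const)

lemma cum_loss_zero:
  assumes arm: "0 \<le> a" "0 \<le> b" "a + b \<le> 1"
    and cl: "closed_chain a b f S" and x: "x \<in> S"
    and L: "\<forall>y\<in>S. loss a b \<rho> lam H \<phi> (f y) y = 0"
  shows "cum_loss a b \<rho> lam H \<phi> f x T = 0"
proof -
  have "(chain_op a b f ^^ k) (\<lambda>y. loss a b \<rho> lam H \<phi> (f y) y) x = 0" for k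
    using chain_pow_mono[OF arm cl x, of "\<lambda>_. 0" "\<lambda>y. loss a b \<rho> lam H \<phi> (f y) y" k]
      chain_pow_mono[OF arm cl x, of "\<lambda>y. loss a b \<rho> lam H \<phi> (f y) y" "\<lambda>_. 0" k] L
    by (simp add: chain_pow_const)
  thus ?thesis by (simp add: cum_loss_def)
qed

lemma total1_le:
  assumes arm: "0 \<le> a" "0 \<le> b" "a + b \<le> 1"
    and cl: "closed_chain a b f S" and x: "x \<in> S"
    and L: "\<forall>y\<in>S. 0 \<le> loss a b \<rho> lam H \<phi> (f y) y"
    and bnd: "\<forall>y\<in>S. \<bar>\<phi> y\<bar> \<le> M"
  shows "total1 a b \<rho> lam f x T \<le> real T * H + 2 * M"
  using total1_loss[OF arm, where \<phi> = \<phi> and H = H and f = f and x = x and T = T and \<rho> = \<rho> and lam = lam] cum_loss_nonneg[where T = T, OF arm cl x L]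
    chain_pow_bounded[where k = T, OF arm cl x bnd] bspec[OF bnd x] by linarith

lemma total1_ge:
  assumes arm: "0 \<le> a" "0 \<le> b" "a + b \<le> 1"
    and cl: "closed_chain a b f S" and x: "x \<in> S"
    and L: "\<forall>y\<in>S. loss a b \<rho> lam H \<phi> (f y) y = 0"
    and bnd: "\<forall>y\<in>S. \<bar>\<phi> y\<bar> \<le> M"
  shows "total1 a b \<rho> lam f x T \<ge> real T * H - 2 * M"
  using total1_loss[OF arm, where \<phi> = \<phi> and H = H and f = f and x = x and T = T and \<rho> = \<rho> and lam = lam] cum_loss_zero[where T = T, OF arm cl x L]
    chain_pow_bounded[where k = T, OF arm cl x bnd] bspec[OF bnd x] by linarith

section \<open>Limits of averages and the optimal gain of a single arm\<close>

lemma limsup_average_le: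
  assumes "\<And>T. X T \<le> real T * H + C"
  shows "limsup (\<lambda>T. ereal (X T / real T)) \<le> ereal H"
proof -
  have lim: "(\<lambda>T. ereal (H + C / real T)) \<longlonglongrightarrow> ereal (H + 0)"
    by (intro tendsto_intros lim_const_over_n)
  have "eventually (\<lambda>T. ereal (X T / real T) \<le> ereal (H + C / real T)) sequentially"
    using eventually_gt_at_top[of 0]
  proof eventually_elim
    case (elim T)
    hence "X T / real T \<le> (real T * H + C) / real T" using assms by (intro divide_right_mono) auto
    thus ?case using elim by (simp add: add_divide_distrib)
  qed
  hence "limsup (\<lambda>T. ereal (X T / real T)) \<le> limsup (\<lambda>T. ereal (H + C / real T))"
    by (rule Limsup_mono)
  also have "\<dots> = ereal H" using lim_imp_Limsup[OF _ lim] by simp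
  finally show ?thesis .
qed

lemma liminf_average_ge:
  assumes "\<And>T. X T \<ge> real T * H - C"
  shows "liminf (\<lambda>T. ereal (X T / real T)) \<ge> ereal H"
proof -
  have lim: "(\<lambda>T. ereal (H - C / real T)) \<longlonglongrightarrow> ereal (H - 0)"
    by (intro tendsto_intros lim_const_over_n)
  have "eventually (\<lambda>T. ereal (H - C / real T) \<le> ereal (X T / real T)) sequentially"
    using eventually_gt_at_top[of 0]
  proof eventually_elim
    case (elim T)
    hence "(real T * H - C) / real T \<le> X T / real T" using assms by (intro divide_right_mono) auto
    thus ?case using elim by (simp add: diff_divide_distrib)
  qed
  hence "liminf (\<lambda>T. ereal (H - C / real T)) \<le> liminf (\<lambda>T. ereal (X T / real T))"
    by (rule Liminf_mono)
  moreover have "liminf (\<lambda>T. ereal (H - C / real T)) = ereal H"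
    using lim_imp_Liminf[OF _ lim] by simp
  ultimately show ?thesis by simp
qed

lemma H_single_le:
  assumes arm: "0 \<le> a" "0 \<le> b" "a + b \<le> 1"
    and cl: "closed_info a b S" "x \<in> S"
    and sup: "supersolution a b \<rho> lam S H \<phi>"
    and bnd: "\<forall>y\<in>S. \<bar>\<phi> y\<bar> \<le> M"
  shows "H_single a b \<rho> x lam \<le> ereal H"
  unfolding H_single_def opt_value_def
proof (rule SUP_least, rule limsup_average_le)
  fix \<pi> :: "unit policy" and T
  show "total (\<lambda>_. a) (\<lambda>_. b) (\<lambda>_. \<rho>) lam (\<lambda>_. x) \<pi> T \<le> real T * H + 2 * M"
    using total_le_supersolution[of "\<lambda>_. a" "\<lambda>_. b" "\<lambda>_. S" "\<lambda>_. x" "\<lambda>_. \<rho>" lam "\<lambda>_. H" "\<lambda>_. \<phi>"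
        "\<lambda>_. M" lam \<pi> T] assms by (simp add: UNIV_unit)
qed

lemma stationary_le_H_single:
  "avg_value (\<lambda>_. a) (\<lambda>_. b) (\<lambda>_. \<rho>) lam (\<lambda>_. x) (stationary_policy x f) \<le> H_single a b \<rho> x lam"
  unfolding H_single_def opt_value_def avg_value_def
  by (rule SUP_upper2[of "stationary_policy x f"]) (auto intro: Liminf_le_Limsup)

lemma H_single_eq:
  assumes arm: "0 \<le> a" "0 \<le> b" "a + b \<le> 1"
    and cl: "closed_info a b S" and x: "x \<in> S"
    and sup: "supersolution a b \<rho> lam S H \<phi>"
    and bnd: "\<forall>y\<in>S. \<bar>\<phi> y\<bar> \<le> M"
    and zero: "\<forall>y\<in>S. loss a b \<rho> lam H \<phi> (f y) y = 0"
  shows "H_single a b \<rho> x lam = ereal H"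
    and "avg_value (\<lambda>_. a) (\<lambda>_. b) (\<lambda>_. \<rho>) lam (\<lambda>_. x) (stationary_policy x f) = ereal H"
proof -
  let ?v = "avg_value (\<lambda>_. a) (\<lambda>_. b) (\<lambda>_. \<rho>) lam (\<lambda>_. x) (stationary_policy x f)"
  have 1: "H_single a b \<rho> x lam \<le> ereal H"
    by (rule H_single_le[OF arm cl x sup bnd])
  have 2: "ereal H \<le> ?v" unfolding avg_value_def
    by (rule liminf_average_ge[where C = "2 * M"])
       (rule total1_ge[OF arm closed_info_chain[OF cl] x zero bnd])
  show "H_single a b \<rho> x lam = ereal H" "?v = ereal H"
    using 1 2 stationary_le_H_single[of a b \<rho> lam x f] by (auto intro: antisym order_trans)
qed

text \<open>
  Second-order optimality certificate. Along a gain-optimal policy the losses vanish on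
  average, so \<open>upper\<close> makes the mean of \<open>\<phi>\<close> along it asymptotically nonnegative;
  along \<open>f\<close> it is nonpositive by \<open>lower\<close>.
\<close>

locale bias_certificate =
  fixes a b \<rho> lam H :: real and S :: "info set" and \<phi> w w' :: "info \<Rightarrow> real"
    and C M :: real and f :: "info \<Rightarrow> bool"
  assumes arm: "0 \<le> a" "0 \<le> b" "a + b \<le> 1"
    and cl: "closed_info a b S"
    and sup: "supersolution a b \<rho> lam S H \<phi>"
    and bnd: "\<forall>y\<in>S. \<bar>\<phi> y\<bar> \<le> M" "\<forall>y\<in>S. \<bar>w y\<bar> \<le> M"
      "\<forall>y\<in>S. \<bar>w' y\<bar> \<le> M"
    and C: "0 \<le> C"
    and upper: "\<And>x play. x \<in> S \<Longrightarrow>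
      act_next a b play w x - w x \<le> \<phi> x + C * loss a b \<rho> lam H \<phi> play x"
    and zero: "\<forall>y\<in>S. loss a b \<rho> lam H \<phi> (f y) y = 0"
    and lower: "\<And>x. x \<in> S \<Longrightarrow> \<phi> x \<le> act_next a b (f x) w' x - w' x"
begin

lemmas H_single = H_single_eq(1)[OF arm cl _ sup bnd(1) zero]

lemmas avg_value = H_single_eq(2)[OF arm cl _ sup bnd(1) zero]

lemma bias_ge:
  assumes x: "x \<in> S"
  shows "ereal (\<phi> x) \<le> bias a b \<rho> lam f x"
proof -
  let ?P = "chain_op a b f"
  note cc = closed_info_chain[OF cl, of f]
  have "(\<Sum>T<N. total1 a b \<rho> lam f x T - real T * H) \<ge> real N * \<phi> x - 2 * M" for N
  proof -
    have "(\<Sum>T<N. total1 a b \<rho> lam f x T - real T * H) = (\<Sum>T<N. \<phi> x - (?P ^^ T) \<phi> x)"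
      using cum_loss_zero[OF arm cc x zero]
      by (intro sum.cong refl) (simp add: total1_loss[OF arm, where \<phi> = \<phi> and H = H])
    also have "\<dots> = real N * \<phi> x - (\<Sum>T<N. (?P ^^ T) \<phi> x)"
      by (simp add: sum_subtractf)
    finally have 1: "(\<Sum>T<N. total1 a b \<rho> lam f x T - real T * H) =
        real N * \<phi> x - (\<Sum>T<N. (?P ^^ T) \<phi> x)" .
    have "(\<Sum>T<N. (?P ^^ T) \<phi> x) \<le> (\<Sum>T<N. (?P ^^ T) (\<lambda>y. ?P w' y - w' y) x)"
      using lower by (intro sum_mono chain_pow_mono[OF arm cc x]) (simp add: chain_op_def)
    also have "\<dots> = (?P ^^ N) w' x - w' x" by (rule sum_chain_telescope)
    also have "\<dots> \<le> 2 * M"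
      using chain_pow_bounded[where k = N, OF arm cc x bnd(3)] bspec[OF bnd(3) x] by linarith
    finally show ?thesis using 1 by linarith
  qed
  thus ?thesis unfolding bias_def H_single[OF x] real_of_ereal.simps
    by (intro liminf_average_ge[where C = "2 * M"])
qed

lemma bias_le:
  assumes x: "x \<in> S"
    and gain: "avg_value (\<lambda>_. a) (\<lambda>_. b) (\<lambda>_. \<rho>) lam (\<lambda>_. x) (stationary_policy x f') = ereal H"
  shows "bias a b \<rho> lam f' x \<le> ereal (\<phi> x)"
proof (rule ereal_le_epsilon2)
  fix e :: real assume e: "e > 0"
  let ?P = "chain_op a b f'" and ?L = "\<lambda>y. loss a b \<rho> lam H \<phi> (f' y) y"
  let ?cum = "cum_loss a b \<rho> lam H \<phi> f' x" and ?t = "total1 a b \<rho> lam f' x"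
  \<comment> \<open>The summand \<open>1\<close> keeps the denominator positive when
    \<open>C = 0\<close>.\<close>
  define e' where "e' = e / (2 * (C + 1))"
  have e': "e' > 0" "C * e' \<le> e / 2" using e C by (auto simp: e'_def field_simps)
  note cc = closed_info_chain[OF cl, of f']
  have L: "\<forall>y\<in>S. 0 \<le> ?L y" using sup by (simp add: supersolution_loss)
  \<comment> \<open>Summed along the chain of \<open>f'\<close>, \<open>upper\<close> leaves a
    telescoped \<open>w\<close> and \<open>C\<close> times the accumulated losses.\<close>
  have S_le: "(\<Sum>T<N. ?t T - real T * H) \<le> real N * \<phi> x + 2 * M + C * ?cum N" for N
  proof -
    have "(\<Sum>T<N. ?t T - real T * H) \<le>
        (\<Sum>T<N. \<phi> x + (- (?P ^^ T) (\<lambda>y. ?P w y - w y) x + C * (?P ^^ T) ?L x))"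
    proof (rule sum_mono)
      fix T
      have "(?P ^^ T) (\<lambda>y. 1 * (?P w y - w y) + (- C) * ?L y) x \<le> (?P ^^ T) \<phi> x"
        using upper by (intro chain_pow_mono[OF arm cc x]) (auto simp: chain_op_def algebra_simps)
      hence "(?P ^^ T) (\<lambda>y. ?P w y - w y) x - C * (?P ^^ T) ?L x \<le> (?P ^^ T) \<phi> x"
        unfolding chain_pow_linear by simp
      thus "?t T - real T * H \<le> \<phi> x + (- (?P ^^ T) (\<lambda>y. ?P w y - w y) x + C * (?P ^^ T) ?L x)"
        using cum_loss_nonneg[where T = T, OF arm cc x L]
        by (simp add: total1_loss[OF arm, where \<phi> = \<phi> and H = H])
    qed
    also have "\<dots> = real N * \<phi> x - ((?P ^^ N) w x - w x) + C * ?cum N"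
      unfolding cum_loss_def sum_chain_telescope[symmetric]
      by (simp add: sum.distrib sum_negf sum_distrib_left sum_subtractf)
    finally show ?thesis
      using chain_pow_bounded[where k = N, OF arm cc x bnd(2)] bspec[OF bnd(2) x] by linarith
  qed
  have cum_le: "?cum N \<le> real N * H + 2 * M - ?t N" for N
    using chain_pow_bounded[where k = N, OF arm cc x bnd(1)] bspec[OF bnd(1) x]
    by (simp add: total1_loss[OF arm, where \<phi> = \<phi> and H = H])
  \<comment> \<open>Since \<open>f'\<close> has gain \<open>H\<close>, \<open>cum_le\<close> makes
    its losses up to \<open>N\<close> at most \<open>2 * M + real N * e'\<close> eventually, hence
    negligible after division by \<open>N\<close>.\<close>
  have "eventually (\<lambda>N. ereal (H - e') < ereal (?t N / real N)) sequentially"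
    using gain e'(1) unfolding avg_value_def
    by (intro less_LiminfD) (simp del: ereal_less_eq)
  moreover have "eventually (\<lambda>N. (2 * M + C * (2 * M)) / real N < e / 2) sequentially"
    using e by (intro order_tendstoD(2)[OF lim_const_over_n]) auto
  ultimately have "eventually (\<lambda>N. ereal ((\<Sum>T<N. ?t T - real T * H) / real N) \<le> ereal (\<phi> x + e)) sequentially"
    using eventually_gt_at_top[of 0]
  proof eventually_elim
    case (elim N)
    have "?t N \<ge> real N * H - real N * e'" using elim by (simp add: field_simps)
    hence "?cum N \<le> 2 * M + real N * e'" using cum_le[of N] by linarith
    hence "C * ?cum N \<le> C * (2 * M) + real N * (C * e')"
      using C mult_left_mono[of "?cum N" "2 * M + real N * e'" C] by (simp add: algebra_simps)
    also have "real N * (C * e') \<le> real N * (e / 2)" using e' by (intro mult_left_mono) auto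
    finally have "(\<Sum>T<N. ?t T - real T * H) \<le>
        real N * \<phi> x + (2 * M + C * (2 * M)) + real N * (e / 2)" using S_le[of N] by linarith
    moreover have "2 * M + C * (2 * M) \<le> real N * (e / 2)"
      using elim by (simp add: field_simps)
    ultimately have "(\<Sum>T<N. ?t T - real T * H) \<le> real N * (\<phi> x + e)"
      by (simp add: algebra_simps)
    thus ?case using elim by (simp add: field_simps)
  qed
  hence "liminf (\<lambda>N. ereal ((\<Sum>T<N. ?t T - real T * H) / real N)) \<le> liminf (\<lambda>N. ereal (\<phi> x + e))"
    by (rule Liminf_mono)
  thus "bias a b \<rho> lam f' x \<le> ereal (\<phi> x) + ereal e"
    unfolding bias_def H_single[OF x] by (simp add: Liminf_const)
qed

end

text \<open>The decision rule is fixed, but its certificate may vary with the start, as frozen arms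
  require.\<close>

lemma optimal_singleI:
  assumes "\<And>x. snd x \<ge> 1 \<Longrightarrow> \<exists>H S \<phi> w w' C M. x \<in> S \<and> bias_certificate a b \<rho> lam H S \<phi> w w' C M f"
  shows "optimal_single a b \<rho> lam f"
  unfolding optimal_single_def gain_optimal_def
proof (intro conjI allI impI)
  fix x :: info assume x: "1 \<le> snd x"
  obtain H S \<phi> w w' C M where xS: "x \<in> S" and c: "bias_certificate a b \<rho> lam H S \<phi> w w' C M f"
    using assms[OF x] by blast
  show "avg_value (\<lambda>_. a) (\<lambda>_. b) (\<lambda>_. \<rho>) lam (\<lambda>_. x) (stationary_policy x f) = H_single a b \<rho> x lam"
    unfolding bias_certificate.H_single[OF c xS] bias_certificate.avg_value[OF c xS] ..
next
  fix f' and x :: info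
  assume g: "\<forall>x. 1 \<le> snd x \<longrightarrow>
      avg_value (\<lambda>_. a) (\<lambda>_. b) (\<lambda>_. \<rho>) lam (\<lambda>_. x) (stationary_policy x f') = H_single a b \<rho> x lam"
    and x: "1 \<le> snd x"
  obtain H S \<phi> w w' C M where xS: "x \<in> S" and c: "bias_certificate a b \<rho> lam H S \<phi> w w' C M f"
    using assms[OF x] by blast
  have "avg_value (\<lambda>_. a) (\<lambda>_. b) (\<lambda>_. \<rho>) lam (\<lambda>_. x) (stationary_policy x f') = ereal H"
    using g[rule_format, OF x] unfolding bias_certificate.H_single[OF c xS] .
  from bias_certificate.bias_le[OF c xS this] bias_certificate.bias_ge[OF c xS]
  show "bias a b \<rho> lam f' x \<le> bias a b \<rho> lam f x" by (rule order_trans)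
qed

text \<open>
  Playing where it is strictly suboptimal in an arm that is worthless at penalty \<open>lam\<close>
  shows up in the bias, though not in the gain.
\<close>

lemma not_play_if_worthless:
  assumes arm: "0 \<le> a" "0 \<le> b" "a + b \<le> 1"
    and cl: "closed_info a b S" and x: "x \<in> S" "snd x \<ge> 1"
    and sup: "supersolution a b \<rho> lam S 0 \<phi>"
    and nonneg: "\<And>y. y \<in> S \<Longrightarrow> 0 \<le> \<phi> y" and bnd: "\<And>y. y \<in> S \<Longrightarrow> \<phi> y \<le> M"
    and x0: "\<phi> x = 0" and c: "loss a b \<rho> lam 0 \<phi> True x > 0"
    and f': "gain_optimal a b \<rho> lam f'" "\<And>T. total1 a b \<rho> lam f' x T \<ge> 0"
    and opt: "optimal_single a b \<rho> lam f"
  shows "\<not> f x"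
proof
  assume fx: "f x"
  let ?c = "loss a b \<rho> lam 0 \<phi> True x"
  note cc = closed_info_chain[OF cl, of f]
  have "H_single a b \<rho> x lam \<le> ereal 0"
    using nonneg bnd by (intro H_single_le[OF arm cl x(1) sup, of M]) auto
  moreover have "ereal 0 \<le> avg_value (\<lambda>_. a) (\<lambda>_. b) (\<lambda>_. \<rho>) lam (\<lambda>_. x) (stationary_policy x f')"
    unfolding avg_value_def using f'(2) by (intro liminf_average_ge[where C = 0]) simp
  ultimately have H0: "H_single a b \<rho> x lam = 0"
    using stationary_le_H_single[of a b \<rho> lam x f'] by (simp add: zero_ereal_def)
  have L: "\<forall>y\<in>S. 0 \<le> loss a b \<rho> lam 0 \<phi> (f y) y"
    using sup by (simp add: supersolution_loss)
  \<comment> \<open>The first step already loses \<open>?c\<close>, and nothing makes up for it: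
    \<open>\<phi>\<close> is \<open>0\<close> at the start and nonnegative later.\<close>
  have neg: "total1 a b \<rho> lam f x T \<le> - ?c" if "T \<ge> 1" for T
  proof -
    have "(chain_op a b f ^^ k) (\<lambda>y. loss a b \<rho> lam 0 \<phi> (f y) y) x \<ge> 0" for k
      using chain_pow_mono[OF arm cc x(1), of "\<lambda>_. 0" "\<lambda>y. loss a b \<rho> lam 0 \<phi> (f y) y" k] L
      by (simp add: chain_pow_const)
    hence "(\<Sum>k\<in>{0}. (chain_op a b f ^^ k) (\<lambda>y. loss a b \<rho> lam 0 \<phi> (f y) y) x)
        \<le> cum_loss a b \<rho> lam 0 \<phi> f x T"
      unfolding cum_loss_def using that by (intro sum_mono2) auto
    moreover have "0 \<le> (chain_op a b f ^^ T) \<phi> x"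
      using chain_pow_mono[OF arm cc x(1), of "\<lambda>_. 0" \<phi> T] nonneg by (simp add: chain_pow_const)
    ultimately show ?thesis
      using total1_loss[OF arm, where \<phi> = \<phi> and H = 0] x0 fx by simp
  qed
  have "bias a b \<rho> lam f x \<le> limsup (\<lambda>N. ereal ((\<Sum>T<N. total1 a b \<rho> lam f x T) / real N))"
    unfolding bias_def by (simp add: H0 Liminf_le_Limsup)
  also have "\<dots> \<le> ereal (- ?c)"
  proof (rule limsup_average_le)
    fix N
    \<comment> \<open>The term for \<open>T = 0\<close> is \<open>0\<close> instead of at most
      \<open>- ?c\<close>; the added \<open>?c\<close> compensates.\<close>
    show "(\<Sum>T<N. total1 a b \<rho> lam f x T) \<le> real N * (- ?c) + ?c"
    proof (induction N)
      case (Suc N)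
      show ?case
      proof (cases "N = 0")
        case False
        thus ?thesis using Suc neg[of N] by (simp add: algebra_simps)
      qed (use c in \<open>simp add: total1_eq[OF arm]\<close>)
    qed (use c in simp)
  qed
  also have "\<dots> < 0" using c by simp
  finally have "bias a b \<rho> lam f x < 0" .
  have "0 \<le> bias a b \<rho> lam f' x"
    unfolding bias_def using f'(2)
    by (simp add: H0 zero_ereal_def[symmetric] sum_nonneg Liminf_bounded)
  also have "\<dots> \<le> bias a b \<rho> lam f x"
    using opt f'(1) x(2) unfolding optimal_single_def by blast
  finally show False using \<open>bias a b \<rho> lam f x < 0\<close> by simp
qed

section \<open>The optimality equation of a single arm\<close>

lemma frozen_belief: "belief 0 0 s t = of_bool s"
  by (induction t) auto

locale arm =
  fixes a b \<rho> :: real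
  assumes a0: "0 \<le> a" and b0: "0 \<le> b" and ab: "a + b < 1" and r0: "0 \<le> \<rho>"
begin

abbreviation u :: "nat \<Rightarrow> real" where "u \<equiv> belief a b False"

abbreviation v :: "nat \<Rightarrow> real" where "v \<equiv> belief a b True"

lemma ab': "a + b \<le> 1" using ab by simp

lemmas arm = a0 b0 ab'

lemmas bel = belief_bounds[OF arm]

section \<open>Monotonicity and concavity of the beliefs\<close>

lemma u_Suc: "u (Suc t) = u t + a * (1 - a - b) ^ t"
proof (induction t)
  case (Suc t)
  have "u (Suc (Suc t)) = a + (1 - a - b) * u (Suc t)" by simp
  also have "\<dots> = a + (1 - a - b) * (u t + a * (1 - a - b) ^ t)" by (simp only: Suc)
  also have "\<dots> = u (Suc t) + a * (1 - a - b) ^ Suc t" by (simp add: algebra_simps)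
  finally show ?case .
qed simp

lemma v_Suc: "v (Suc t) = v t - b * (1 - a - b) ^ t"
proof (induction t)
  case (Suc t)
  have "v (Suc (Suc t)) = a + (1 - a - b) * v (Suc t)" by simp
  also have "\<dots> = a + (1 - a - b) * (v t - b * (1 - a - b) ^ t)" by (simp only: Suc)
  also have "\<dots> = v (Suc t) - b * (1 - a - b) ^ Suc t" by (simp add: algebra_simps)
  finally show ?case .
qed simp

lemma v_1: "v (Suc 0) = 1 - b" by simp

lemma u_mono: "s \<le> t \<Longrightarrow> u s \<le> u t"
proof (rule lift_Suc_mono_le[of u])
  show "u n \<le> u (Suc n)" for n using a0 ab by (simp add: u_Suc del: belief.simps)
qed

lemma belief_le: "t \<ge> 1 \<Longrightarrow> belief a b s t \<le> 1 - b"
proof (cases t)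
  case (Suc k)
  have "(1 - a - b) * belief a b s k \<le> (1 - a - b) * 1"
    using ab bel[of s k] by (intro mult_left_mono) auto
  thus ?thesis using Suc by simp
qed simp

lemma u_ge: "t \<ge> 1 \<Longrightarrow> a \<le> u t"
  using u_mono[of 1 t] by simp

lemma u_less: "a > 0 \<Longrightarrow> u t < u (Suc t)"
  using ab by (simp add: u_Suc del: belief.simps)

lemma power_d_mono: "s \<le> t \<Longrightarrow> (1 - a - b) ^ t \<le> (1 - a - b) ^ s"
  using a0 b0 ab by (intro power_decreasing) auto

text \<open>By \<open>u_Suc\<close>, \<open>u t\<close> is a sum of \<open>t\<close> decreasing
  increments, none of them smaller than the next one.\<close>

lemma increment_le: "real t * (a * (1 - a - b) ^ t) \<le> u t"
proof (induction t)
  case (Suc t)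
  have "a * (1 - a - b) ^ Suc t \<le> a * (1 - a - b) ^ t"
    using mult_left_mono[OF power_d_mono[of t "Suc t"] a0] by simp
  hence "real (Suc t) * (a * (1 - a - b) ^ Suc t) \<le> real (Suc t) * (a * (1 - a - b) ^ t)"
    by (rule mult_left_mono) simp
  also have "\<dots> \<le> u t + a * (1 - a - b) ^ t" using Suc by (simp add: algebra_simps)
  also have "\<dots> = u (Suc t)" by (rule u_Suc[symmetric])
  finally show ?case .
qed simp

text \<open>\<open>u\<close> is concave and vanishes at \<open>0\<close>, so \<open>u t / t\<close>
  decreases. This orders the play frequencies of the thresholds and bounds the value of an early
  play.\<close>

lemma u_ratio:
  assumes "1 \<le> s" "s \<le> t"
  shows "real s * u t \<le> real t * u s"
  using assms(2)
proof (induction t rule: dec_induct)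
  case (step t)
  have t: "t > 0" using step assms(1) by simp
  have "real t * (real s * u (Suc t)) = real s * (real t * u t + real t * (a * (1 - a - b) ^ t))"
    by (simp add: u_Suc algebra_simps del: belief.simps)
  also have "\<dots> \<le> real s * (real t * u t + u t)"
    using increment_le[of t] by (intro mult_left_mono add_left_mono) auto
  also have "\<dots> = real (Suc t) * (real s * u t)" by (simp add: algebra_simps)
  also have "\<dots> \<le> real (Suc t) * (real t * u s)" using step by (intro mult_left_mono) auto
  also have "\<dots> = real t * (real (Suc t) * u s)" by (simp add: algebra_simps)
  finally show ?case using t by simp
qed simp

definition states :: "info set" where "states = {x. snd x \<ge> 1}"

lemma in_states [simp]: "(s, t) \<in> states \<longleftrightarrow> t \<ge> 1" "x \<in> states \<longleftrightarrow> snd x \<ge> 1"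
  by (auto simp: states_def)

lemma closed_states: "closed_info a b states"
  by (auto simp: closed_info_def)

text \<open>
  A solution of the optimality equation with positive gain \<open>H\<close>. Measured from \<open>(b, 1)\<close>,
  an observed good state is worth \<open>K\<close> (with the reward of that observation), so that
  playing after \<open>m\<close> steps and paying the gain in between is worth
  \<open>K * u m - lam - m * H\<close>; the threshold \<open>s\<close> maximises this, with maximum \<open>0\<close>.
\<close>

definition gain_triple :: "real \<Rightarrow> real \<Rightarrow> real \<Rightarrow> nat \<Rightarrow> bool" where
  "gain_triple lam H K s \<longleftrightarrow> 0 \<le> lam \<and> 0 < H \<and> 1 \<le> s \<and> b * K = \<rho> - lam - H \<and>
     K * u s = lam + real s * H \<and> (\<forall>m\<ge>1. K * u m \<le> lam + real m * H)"

text \<open>Until the threshold a bad arm accrues \<open>H\<close> per step; otherwise a state is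
  worth a play. The value \<open>c\<close> at \<open>(False, 1)\<close> is left free because the
  bias requires a particular normalisation.\<close>

definition triple_sol :: "real \<Rightarrow> real \<Rightarrow> real \<Rightarrow> nat \<Rightarrow> real \<Rightarrow> info \<Rightarrow> real" where
  "triple_sol lam H K s c x =
     (if \<not> fst x \<and> snd x \<le> s then c + (real (snd x) - 1) * H
      else c + K * belief a b (fst x) (snd x) - lam - H)"

definition threshold :: "nat \<Rightarrow> info \<Rightarrow> bool" where
  "threshold s x \<longleftrightarrow> fst x \<or> s \<le> snd x"

lemma gain_triple_K: assumes "gain_triple lam H K s" shows "K > 0"
proof -
  have "0 < real s * H" using assms by (simp add: gain_triple_def)
  hence "0 < K * u s" using assms unfolding gain_triple_def by linarith
  thus ?thesis using bel[of False s] by (auto simp: zero_less_mult_iff)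
qed

text \<open>Threshold \<open>s\<close> is at least as good as \<open>s + 1\<close>, which bounds the
  next increment of \<open>K * u\<close> by \<open>H\<close>; increments decrease, so waiting beyond
  \<open>s\<close> never pays.\<close>

lemma gain_triple_increment:
  assumes "gain_triple lam H K s" "s \<le> t"
  shows "K * (a * (1 - a - b) ^ t) \<le> K * (a * (1 - a - b) ^ s)" "K * (a * (1 - a - b) ^ s) \<le> H"
proof -
  show "K * (a * (1 - a - b) ^ t) \<le> K * (a * (1 - a - b) ^ s)"
    using gain_triple_K[OF assms(1)] a0 power_d_mono[OF assms(2)] by (intro mult_left_mono) auto
  have "K * u (Suc s) \<le> lam + real (Suc s) * H" "K * u s = lam + real s * H"
    using assms(1) unfolding gain_triple_def by (blast intro: le_SucI)+
  thus "K * (a * (1 - a - b) ^ s) \<le> H"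
    unfolding u_Suc distrib_left of_nat_Suc distrib_right by linarith
qed

context
  fixes lam H K c :: real and s :: nat
  assumes tr: "gain_triple lam H K s"
begin

lemma triple_sol_good: "triple_sol lam H K s c (True, Suc 0) = c + K - \<rho>"
  and triple_sol_bad: "triple_sol lam H K s c (False, Suc 0) = c"
  using tr by (auto simp: triple_sol_def gain_triple_def algebra_simps)

lemma loss_play: "loss a b \<rho> lam H (triple_sol lam H K s c) True x =
    (if \<not> fst x \<and> snd x \<le> s then lam + real (snd x) * H - K * u (snd x) else 0)"
  by (cases "fst x")
     (auto simp: loss_def act_rew_def act_next_def triple_sol_good triple_sol_bad
        triple_sol_def[of _ _ _ _ _ x] algebra_simps)

lemma loss_wait_good: "loss a b \<rho> lam H (triple_sol lam H K s c) False (True, t) \<ge> H"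
proof -
  have "0 \<le> K * (b * (1 - a - b) ^ t)" using gain_triple_K[OF tr] b0 ab by simp
  thus ?thesis
    by (simp add: loss_def act_rew_def act_next_def triple_sol_def v_Suc algebra_simps del: belief.simps)
qed

lemma loss_wait_early:
  "t < s \<Longrightarrow> loss a b \<rho> lam H (triple_sol lam H K s c) False (False, t) = 0"
  by (simp add: loss_def act_rew_def act_next_def triple_sol_def algebra_simps)

lemma loss_wait_late:
  assumes "s \<le> t"
  shows "loss a b \<rho> lam H (triple_sol lam H K s c) False (False, t) = H - K * (a * (1 - a - b) ^ t)"
proof -
  \<comment> \<open>At \<open>t = s\<close> the two branches of \<open>triple_sol\<close> agree, by
    the equation that \<open>s\<close> satisfies.\<close>
  have "triple_sol lam H K s c (False, t) = c + K * u t - lam - H"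
    using assms tr by (cases "t = s") (auto simp: triple_sol_def gain_triple_def algebra_simps)
  thus ?thesis using assms
    by (simp add: loss_def act_rew_def act_next_def triple_sol_def[of _ _ _ _ _ "(False, Suc t)"]
        u_Suc algebra_simps del: belief.simps)
qed

lemma triple_supersolution: "supersolution a b \<rho> lam states H (triple_sol lam H K s c)"
  unfolding supersolution_loss
proof (intro ballI allI)
  fix x play assume x: "x \<in> states"
  obtain g t where [simp]: "x = (g, t)" by (cases x)
  show "0 \<le> loss a b \<rho> lam H (triple_sol lam H K s c) play x"
  proof (cases play)
    case True
    have "K * u t \<le> lam + real t * H" using tr x by (auto simp: gain_triple_def)
    thus ?thesis using True by (simp add: loss_play)
  next
    case False
    have H: "H > 0" using tr by (simp add: gain_triple_def)
    show ?thesis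
    proof (cases g)
      case True
      thus ?thesis using False loss_wait_good[of t] H by simp
    next
      case g: False
      show ?thesis
      proof (cases "t < s")
        case True
        thus ?thesis using False g loss_wait_early by simp
      next
        case ge: False
        thus ?thesis using False g loss_wait_late[of t] gain_triple_increment[OF tr, of t] by simp
      qed
    qed
  qed
qed

lemma triple_zero_loss:
  "\<forall>y\<in>states. loss a b \<rho> lam H (triple_sol lam H K s c) (threshold s y) y = 0"
proof
  fix y assume "y \<in> states"
  obtain g t where [simp]: "y = (g, t)" by (cases y)
  show "loss a b \<rho> lam H (triple_sol lam H K s c) (threshold s y) y = 0"
    using tr loss_wait_early[of t] by (cases "threshold s y")
      (auto simp: loss_play threshold_def gain_triple_def not_le)
qed

lemma triple_bounded: "\<forall>y\<in>states. \<bar>triple_sol lam H K s c y\<bar> \<le> \<bar>c\<bar> + real s * H + K + lam + H"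
proof
  fix y assume y: "y \<in> states"
  obtain g t where [simp]: "y = (g, t)" by (cases y)
  have H: "H > 0" "lam \<ge> 0" using tr by (auto simp: gain_triple_def)
  have K: "K > 0" by (rule gain_triple_K[OF tr])
  have Kb: "0 \<le> K * belief a b g t" "K * belief a b g t \<le> K"
    using K bel[of g t] by (auto intro: mult_left_le)
  have s: "0 \<le> real s * H" using H by simp
  show "\<bar>triple_sol lam H K s c y\<bar> \<le> \<bar>c\<bar> + real s * H + K + lam + H"
  proof (cases "\<not> g \<and> t \<le> s")
    case True
    have "0 \<le> (real t - 1) * H" using H y by simp
    moreover have "(real t - 1) * H \<le> real s * H" using H True by (intro mult_right_mono) auto
    moreover have "triple_sol lam H K s c y = c + (real t - 1) * H"
      using True by (simp add: triple_sol_def)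
    ultimately show ?thesis using H K by linarith
  next
    case False
    hence "triple_sol lam H K s c y = c + K * belief a b g t - lam - H"
      by (auto simp: triple_sol_def)
    thus ?thesis using H K Kb s by linarith
  qed
qed

end

lemma gain_triple_H_single:
  assumes "gain_triple lam H K s" "snd x \<ge> 1"
  shows "H_single a b \<rho> x lam = ereal H"
  using H_single_eq(1)[OF arm closed_states _ triple_supersolution[OF assms(1), of 0]
      triple_bounded[OF assms(1)] triple_zero_loss[OF assms(1)], of x] assms(2) by simp

section \<open>Worthless arms\<close>

text \<open>The optimality inequalities for gain \<open>0\<close> with relative value
  \<open>G\<close> in good and \<open>0\<close> in bad states: \<open>G\<close> bounds what a good
  arm can still earn before it is found bad and abandoned.\<close>

definition worthless :: "real \<Rightarrow> real \<Rightarrow> bool" where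
  "worthless lam G \<longleftrightarrow> 0 \<le> G \<and> \<rho> * (1 - b) - lam \<le> b * G \<and> (\<forall>t\<ge>1. (\<rho> + G) * u t \<le> lam)"

definition worthless_sol :: "real \<Rightarrow> info \<Rightarrow> real" where
  "worthless_sol G x = (if fst x then G else 0)"

lemma worthless_supersolution:
  assumes "worthless lam G"
  shows "supersolution a b \<rho> lam states 0 (worthless_sol G)"
  unfolding supersolution_def
proof (intro ballI allI)
  fix x play assume x: "x \<in> states"
  obtain g t where [simp]: "x = (g, t)" by (cases x)
  have t: "t \<ge> 1" using x by simp
  show "act_rew a b \<rho> lam play x + act_next a b play (worthless_sol G) x \<le> 0 + worthless_sol G x"
  proof (cases "play \<and> g")
    case True
    have "(\<rho> + G) * v t \<le> (\<rho> + G) * (1 - b)"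
      using r0 assms belief_le[OF t] by (intro mult_left_mono) (auto simp: worthless_def)
    thus ?thesis using True assms
      by (simp add: worthless_def act_rew_def act_next_def worthless_sol_def algebra_simps)
  next
    case False
    thus ?thesis using assms t
      by (auto simp: worthless_def act_rew_def act_next_def worthless_sol_def algebra_simps)
  qed
qed

lemma loss_never: "loss a b \<rho> lam 0 (worthless_sol G) False y = 0"
  by (simp add: loss_def act_rew_def act_next_def worthless_sol_def)

lemma worthless_H_single:
  assumes "worthless lam G" "snd x \<ge> 1"
  shows "H_single a b \<rho> x lam = 0"
    and "avg_value (\<lambda>_. a) (\<lambda>_. b) (\<lambda>_. \<rho>) lam (\<lambda>_. x) (stationary_policy x (\<lambda>_. False)) = 0"
proof -
  have "\<forall>y\<in>states. \<bar>worthless_sol G y\<bar> \<le> G" using assms by (auto simp: worthless_sol_def worthless_def)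
  from H_single_eq[OF arm closed_states _ worthless_supersolution[OF assms(1)] this,
      where f = "\<lambda>_. False" and x = x]
  show "H_single a b \<rho> x lam = 0"
    and "avg_value (\<lambda>_. a) (\<lambda>_. b) (\<lambda>_. \<rho>) lam (\<lambda>_. x) (stationary_policy x (\<lambda>_. False)) = 0"
    using assms(2) by (simp_all add: loss_never zero_ereal_def)
qed

lemma worthless_not_play:
  assumes w: "worthless lam G" and x: "snd x \<ge> 1" "worthless_sol G x = 0"
    and strict: "belief a b (fst x) (snd x) * (\<rho> + G) < lam"
    and opt: "optimal_single a b \<rho> lam f"
  shows "\<not> f x"
proof (rule not_play_if_worthless[OF arm closed_states _ x(1) worthless_supersolution[OF w] _ _ x(2) _ _ _ opt])
  show "gain_optimal a b \<rho> lam (\<lambda>_. False)"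
    unfolding gain_optimal_def using worthless_H_single[OF w] by simp
  show "0 \<le> total1 a b \<rho> lam (\<lambda>_. False) x T" for T
  proof -
    have "chain_rew a b \<rho> lam (\<lambda>_. False) = (\<lambda>_. 0)"
      by (simp add: fun_eq_iff chain_rew_def act_rew_def)
    thus ?thesis by (simp add: total1_eq[OF arm] chain_pow_const)
  qed
  show "0 \<le> worthless_sol G y" "worthless_sol G y \<le> G" for y
    using w by (auto simp: worthless_sol_def worthless_def)
  show "0 < loss a b \<rho> lam 0 (worthless_sol G) True x"
    using strict x(2) by (simp add: loss_def act_rew_def act_next_def worthless_sol_def algebra_simps)
qed (use x in simp)

lemma worthless_small: "\<rho> * (1 - b) \<le> lam \<Longrightarrow> worthless lam 0"
proof -
  assume le: "\<rho> * (1 - b) \<le> lam"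
  have "\<rho> * u t \<le> lam" if "t \<ge> 1" for t
    using mult_left_mono[OF belief_le[OF that, of False] r0] le by linarith
  thus ?thesis using le by (simp add: worthless_def)
qed

text \<open>A bad arm never recovers. The chosen \<open>G\<close> is the expected net income from
  \<open>(True, 1)\<close> when the arm is played until it is found bad.\<close>

lemma worthless_a0: "a = 0 \<Longrightarrow> b > 0 \<Longrightarrow> lam \<ge> 0 \<Longrightarrow> lam \<le> \<rho> * (1 - b) \<Longrightarrow>
    worthless lam ((\<rho> * (1 - b) - lam) / b)"
proof -
  assume *: "a = 0" "b > 0" "lam \<ge> 0" "lam \<le> \<rho> * (1 - b)"
  have "u t = 0" for t using *(1) by (induction t) auto
  thus ?thesis using * unfolding worthless_def by simp
qed

section \<open>Frozen arms\<close>

text \<open>The hidden state is known for ever, so on each of its two classes every play pays the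
  same and constant functions suffice.\<close>

lemma frozen_certificate:
  assumes "a = 0" "b = 0" "lam \<ge> 0"
  shows "bias_certificate a b \<rho> lam (if g then max 0 (\<rho> - lam) else 0) {x. fst x = g \<and> snd x \<ge> 1}
    (\<lambda>_. 0) (\<lambda>_. 0) (\<lambda>_. 0) 0 0 (\<lambda>x. fst x \<and> lam \<le> \<rho>)"
  unfolding assms(1,2)
proof
  show "closed_info 0 0 {x. fst x = g \<and> 1 \<le> snd x}"
    by (auto simp: closed_info_def frozen_belief)
  show "supersolution 0 0 \<rho> lam {x. fst x = g \<and> 1 \<le> snd x} (if g then max 0 (\<rho> - lam) else 0) (\<lambda>_. 0)"
    using assms(3) by (auto simp: supersolution_def act_rew_def act_next_def frozen_belief)
  show "\<forall>y\<in>{x. fst x = g \<and> 1 \<le> snd x}. loss 0 0 \<rho> lam (if g then max 0 (\<rho> - lam) else 0)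
      (\<lambda>_. 0) (fst y \<and> lam \<le> \<rho>) y = 0"
    using assms(3) by (auto simp: loss_def act_rew_def act_next_def frozen_belief)
qed (simp_all add: act_next_def)

lemma frozen_optimal:
  assumes "a = 0" "b = 0" "lam \<ge> 0"
  shows "optimal_single a b \<rho> lam (\<lambda>x. fst x \<and> lam \<le> \<rho>)"
proof (rule optimal_singleI)
  fix x :: info assume "snd x \<ge> 1"
  show "\<exists>H S \<phi> w w' C M. x \<in> S \<and> bias_certificate a b \<rho> lam H S \<phi> w w' C M (\<lambda>x. fst x \<and> lam \<le> \<rho>)"
    by (intro exI conjI, rule CollectI[of "\<lambda>y. fst y = fst x \<and> snd y \<ge> 1"])
       (use \<open>snd x \<ge> 1\<close> frozen_certificate[OF assms] in simp_all)
qed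

end

section \<open>Optimal thresholds\<close>

text \<open>Beyond \<open>N\<close> nothing beats \<open>t0\<close>, so a finite search finds a
  global minimiser. The least one is taken because strict inequality before \<open>s\<close>
  survives a small change of the penalty.\<close>

lemma least_minimiser:
  fixes g :: "nat \<Rightarrow> real"
  assumes t0: "1 \<le> t0" and N: "\<And>m. N \<le> m \<Longrightarrow> g t0 \<le> g m"
  obtains s where "1 \<le> s" "\<And>m. 1 \<le> m \<Longrightarrow> g s \<le> g m" "\<And>m. 1 \<le> m \<Longrightarrow> m < s \<Longrightarrow> g s < g m"
proof -
  define A where "A = {1..max N t0}"
  have A: "finite A" "t0 \<in> A" using t0 by (auto simp: A_def)
  hence "Min (g ` A) \<in> g ` A" by (intro Min_in) auto
  then obtain s1 where s1: "s1 \<in> A" "g s1 = Min (g ` A)" by auto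
  hence min: "g s1 \<le> g m" if "m \<in> A" for m using A that by simp
  define P where "P s \<longleftrightarrow> 1 \<le> s \<and> (\<forall>m\<ge>1. g s \<le> g m)" for s
  have "P s1" unfolding P_def
  proof (intro conjI allI impI)
    fix m :: nat assume "1 \<le> m"
    show "g s1 \<le> g m"
    proof (cases "m \<in> A")
      case False
      hence "N \<le> m" using \<open>1 \<le> m\<close> by (auto simp: A_def)
      thus ?thesis using N min[OF A(2)] by (meson order_trans)
    qed (rule min)
  qed (use s1 in \<open>auto simp: A_def\<close>)
  hence L: "P (LEAST s. P s)" by (rule LeastI)
  have "g (LEAST s. P s) < g m" if m: "1 \<le> m" "m < (LEAST s. P s)" for m
  proof -
    have "\<not> P m" using not_less_Least[OF m(2)] .
    then obtain m' where "1 \<le> m'" "g m' < g m" using m(1) by (auto simp: P_def not_le)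
    thus ?thesis using L by (auto simp: P_def intro: le_less_trans)
  qed
  thus ?thesis using that[of "LEAST s. P s"] L by (auto simp: P_def)
qed

context arm
begin

text \<open>Renewal reward: net reward over length of a mean cycle between bad observations, both
  multiplied by \<open>b\<close>. The play at age \<open>t\<close> succeeds with probability
  \<open>u t\<close> and then starts a run of good observations of mean length
  \<open>1 / b\<close>.\<close>

definition F :: "real \<Rightarrow> nat \<Rightarrow> real" where
  "F lam t = ((\<rho> - lam) * u t - lam * b) / (u t + real t * b)"

lemma F_denominator: "b > 0 \<Longrightarrow> 1 \<le> t \<Longrightarrow> u t + real t * b > 0"
  using bel[of False t] by (intro add_nonneg_pos) auto

text \<open>With \<open>K = (\<rho> - lam - H) / b\<close> the right-hand side is the condition of
  \<open>gain_triple\<close> at \<open>m\<close>, so a maximiser of \<open>F\<close> with positive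
  gain yields a gain triple.\<close>

lemma F_le_iff:
  assumes "b > 0" "1 \<le> m"
  shows "F lam m \<le> H \<longleftrightarrow> (\<rho> - lam - H) * u m \<le> b * (lam + real m * H)"
  unfolding F_def pos_divide_le_eq[OF F_denominator[OF assms]] by (simp add: algebra_simps)

lemma F_less_iff:
  assumes "b > 0" "1 \<le> m"
  shows "F lam m < H \<longleftrightarrow> (\<rho> - lam - H) * u m < b * (lam + real m * H)"
  unfolding F_def pos_divide_less_eq[OF F_denominator[OF assms]] by (simp add: algebra_simps)

lemma F_maximiser:
  assumes b: "b > 0" and lam: "lam \<ge> 0" and t0: "1 \<le> t0" "F lam t0 > 0"
  obtains s where "1 \<le> s" "F lam s > 0" "\<And>m. 1 \<le> m \<Longrightarrow> F lam m \<le> F lam s"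
    "\<And>m. 1 \<le> m \<Longrightarrow> m < s \<Longrightarrow> F lam m < F lam s"
proof -
  \<comment> \<open>Beyond \<open>N\<close>, the gain \<open>F lam t0\<close> charged over
    \<open>m\<close> steps exceeds all that a cycle can return.\<close>
  obtain N :: nat where N: "\<rho> / (b * F lam t0) < real N" using reals_Archimedean2 by blast
  have far: "F lam m \<le> F lam t0" if m: "Suc N \<le> m" for m
  proof -
    have "\<rho> < real N * (b * F lam t0)" using N b t0 by (simp add: pos_divide_less_eq)
    also have "\<dots> \<le> real m * (b * F lam t0)" using m b t0 by (intro mult_right_mono) auto
    finally have \<rho>: "\<rho> \<le> b * (real m * F lam t0)" by (simp add: algebra_simps)
    have "(\<rho> - lam - F lam t0) * u m \<le> \<rho> * u m"
      using lam t0 bel[of False m] by (intro mult_right_mono) auto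
    also have "\<dots> \<le> \<rho>" using r0 bel[of False m] by (intro mult_left_le) auto
    also have "\<dots> \<le> b * (lam + real m * F lam t0)"
      using \<rho> b lam by (simp add: distrib_left add_increasing)
    finally show ?thesis using b m by (subst F_le_iff) auto
  qed
  obtain s where "1 \<le> s" "\<And>m. 1 \<le> m \<Longrightarrow> - F lam s \<le> - F lam m"
    "\<And>m. 1 \<le> m \<Longrightarrow> m < s \<Longrightarrow> - F lam s < - F lam m"
    by (rule least_minimiser[OF t0(1), of "Suc N" "\<lambda>t. - F lam t"]) (use far in auto)
  thus ?thesis using that[of s] t0 by force
qed

lemma gain_triple_F:
  assumes b: "b > 0" and lam: "lam \<ge> 0" and s: "1 \<le> s" "F lam s > 0"
    and max: "\<And>m. 1 \<le> m \<Longrightarrow> F lam m \<le> F lam s"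
  shows "gain_triple lam (F lam s) ((\<rho> - lam - F lam s) / b) s"
proof -
  let ?H = "F lam s"
  have le: "(\<rho> - lam - ?H) * u m \<le> b * (lam + real m * ?H)" if "1 \<le> m" for m
    using max[OF that] F_le_iff[OF b that] by simp
  have "\<not> (\<rho> - lam - ?H) * u s < b * (lam + real s * ?H)"
    using F_less_iff[OF b s(1), of lam ?H] by simp
  hence "(\<rho> - lam - ?H) * u s = b * (lam + real s * ?H)" using le[OF s(1)] by simp
  thus ?thesis using b lam s le unfolding gain_triple_def
    by (auto simp: field_simps)
qed

text \<open>For \<open>b = 0\<close> the equation for \<open>K\<close> degenerates to
  \<open>H = \<rho> - lam\<close>. Instead \<open>K\<close> is the minimum of \<open>g\<close>,
  where \<open>g m\<close> is the expected cost of attempts every \<open>m\<close> steps until the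
  first good observation, with waiting charged at the gain.\<close>

lemma gain_triple_b0:
  assumes "b = 0" "a > 0" "lam \<ge> 0" "\<rho> > lam"
  obtains K s where "gain_triple lam (\<rho> - lam) K s"
proof -
  let ?H = "\<rho> - lam"
  define g where "g m = (lam + real m * ?H) / u m" for m
  have u: "u m > 0" if "1 \<le> m" for m using u_ge[OF that] assms by linarith
  obtain N :: nat where N: "g 1 / ?H < real N" using reals_Archimedean2 by blast
  have far: "g 1 \<le> g m" if m: "Suc N \<le> m" for m
  proof -
    have "g 1 < real N * ?H" using N assms by (simp add: pos_divide_less_eq)
    also have "\<dots> \<le> real m * ?H" using m assms by (intro mult_right_mono) auto
    also have "\<dots> \<le> lam + real m * ?H" using assms by simp
    also have "\<dots> \<le> (lam + real m * ?H) / u m"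
      using u[of m] bel[of False m] m assms by (simp add: le_divide_eq mult_left_le)
    finally show ?thesis by (simp add: g_def)
  qed
  obtain s where s: "1 \<le> s" "\<And>m. 1 \<le> m \<Longrightarrow> g s \<le> g m"
    by (rule least_minimiser[of 1 "Suc N" g]) (use far in auto)
  have "gain_triple lam ?H (g s) s"
    unfolding gain_triple_def
  proof (intro conjI allI impI)
    show "g s * u s = lam + real s * ?H" using u[OF s(1)] by (simp add: g_def)
    fix m :: nat assume m: "1 \<le> m"
    show "g s * u m \<le> lam + real m * ?H"
      using s(2)[OF m] u[OF m] by (simp add: g_def[of m] pos_le_divide_eq)
  qed (use assms s in auto)
  thus ?thesis using that by blast
qed

lemma worthless_F:
  assumes "b > 0" "lam < \<rho> * (1 - b)" "\<And>m. 1 \<le> m \<Longrightarrow> F lam m \<le> 0"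
  shows "worthless lam ((\<rho> * (1 - b) - lam) / b)"
proof -
  have "(\<rho> + (\<rho> * (1 - b) - lam) / b) * u m \<le> lam" if "1 \<le> m" for m
  proof -
    have "(\<rho> - lam) * u m \<le> b * lam"
      using assms(3)[OF that] F_le_iff[OF assms(1) that, of lam 0] by simp
    moreover have "\<rho> + (\<rho> * (1 - b) - lam) / b = (\<rho> - lam) / b"
      using assms(1) by (simp add: field_simps)
    ultimately show ?thesis using assms(1) by (simp add: field_simps)
  qed
  thus ?thesis using assms by (simp add: worthless_def)
qed

lemma supersolution_exists:
  assumes lam: "lam \<ge> 0" and x: "snd x \<ge> 1"
  obtains H S \<phi> M where "0 \<le> H" "closed_info a b S" "x \<in> S" "supersolution a b \<rho> lam S H \<phi>"
    "\<forall>y\<in>S. \<bar>\<phi> y\<bar> \<le> M" "H_single a b \<rho> x lam = ereal H"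
proof -
  note sol = that
  have W: ?thesis if "worthless lam G" for G
  proof (rule sol[OF _ closed_states _ worthless_supersolution[OF \<open>worthless lam G\<close>]])
    show "\<forall>y\<in>states. \<bar>worthless_sol G y\<bar> \<le> G"
      using \<open>worthless lam G\<close> by (auto simp: worthless_sol_def worthless_def)
  qed (use worthless_H_single(1)[OF \<open>worthless lam G\<close> x] x in auto)
  have T: ?thesis if "gain_triple lam H K s" for H K s
    by (rule sol[OF _ closed_states _ triple_supersolution[OF \<open>gain_triple lam H K s\<close>, of 0]
          triple_bounded[OF \<open>gain_triple lam H K s\<close>] gain_triple_H_single[OF \<open>gain_triple lam H K s\<close> x]])
       (use \<open>gain_triple lam H K s\<close> x in \<open>auto simp: gain_triple_def\<close>)
  consider "\<rho> * (1 - b) \<le> lam" | "lam < \<rho> * (1 - b)" "a = 0" "b > 0" | "a = 0" "b = 0"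
    | "lam < \<rho> * (1 - b)" "a > 0" "b = 0" | "lam < \<rho> * (1 - b)" "b > 0"
    using a0 b0 by linarith
  thus ?thesis
  proof cases
    case 1
    thus ?thesis using W worthless_small by blast
  next
    case 2
    show ?thesis by (rule W[OF worthless_a0[OF 2(2,3) lam]]) (use 2(1) in simp)
  next
    case 3
    note c = frozen_certificate[OF 3 lam, of "fst x"]
    show ?thesis
      using sol[OF _ bias_certificate.cl[OF c] _ bias_certificate.sup[OF c] bias_certificate.bnd(1)[OF c]
          bias_certificate.H_single[OF c]] x by auto
  next
    case 4
    from 4(1,3) have "lam < \<rho>" by simp
    from gain_triple_b0[OF 4(3,2) lam this] obtain K s where "gain_triple lam (\<rho> - lam) K s" .
    thus ?thesis by (rule T)
  next
    case 5
    show ?thesis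
    proof (cases "\<exists>t\<ge>1. F lam t > 0")
      case True
      then obtain t where "1 \<le> t" "F lam t > 0" by blast
      from F_maximiser[OF 5(2) lam this] obtain s where "1 \<le> s" "F lam s > 0"
        "\<And>m. 1 \<le> m \<Longrightarrow> F lam m \<le> F lam s" by metis
      thus ?thesis using T gain_triple_F[OF 5(2) lam] by blast
    next
      case False
      thus ?thesis using W worthless_F[OF 5(2,1)] by (auto simp: not_less)
    qed
  qed
qed

section \<open>Bias-optimal threshold policies\<close>

lemma act_next_bounded:
  assumes "x \<in> states" "\<forall>y\<in>states. \<bar>w y\<bar> \<le> M"
  shows "\<bar>act_next a b play w x\<bar> \<le> M"
proof (cases play)
  case True
  let ?p = "belief a b (fst x) (snd x)"
  have p: "0 \<le> ?p" "?p \<le> 1" using bel by auto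
  have "\<bar>w (True, 1)\<bar> \<le> M" "\<bar>w (False, 1)\<bar> \<le> M" using assms(2) by auto
  hence "\<bar>?p * w (True, 1)\<bar> \<le> ?p * M" "\<bar>(1 - ?p) * w (False, 1)\<bar> \<le> (1 - ?p) * M"
    using p by (auto simp: abs_mult intro: mult_left_mono)
  hence "\<bar>?p * w (True, 1) + (1 - ?p) * w (False, 1)\<bar> \<le> ?p * M + (1 - ?p) * M" by linarith
  thus ?thesis using True by (simp add: act_next_def algebra_simps)
next
  case False
  thus ?thesis using assms by (auto simp: act_next_def)
qed

text \<open>
  With \<open>b > 0\<close> the mean of the relative value under the threshold policy depends on the
  additive constant \<open>c\<close>, which is chosen to make it \<open>0\<close>: then the Poisson equation for
  the relative value has a bounded solution.
\<close>

lemma strict_threshold_optimal: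
  assumes tr: "gain_triple lam H K s" and b: "b > 0"
    and strict: "\<And>m. 1 \<le> m \<Longrightarrow> m \<noteq> s \<Longrightarrow> K * u m < lam + real m * H"
  shows "optimal_single a b \<rho> lam (threshold s)"
proof -
  have H: "H > 0" and lam: "lam \<ge> 0" and s: "1 \<le> s" using tr by (auto simp: gain_triple_def)
  \<comment> \<open>\<open>D\<close> is the mean cycle length under threshold \<open>s\<close>, and
    \<open>c\<close> is the constant for which the relative values over a mean cycle add up to
    zero.\<close>
  define D where "D = real s + u s / b"
  have D: "D > 0" using s b bel[of False s] by (simp add: D_def add_pos_nonneg)
  define c where "c = (- H * real s * (real s - 1) / 2 - u s * (K - \<rho>) / b) / D"
  define h where "h = triple_sol lam H K s c"
  \<comment> \<open>With \<open>w\<close> normalised to \<open>0\<close> at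
    \<open>(False, 1)\<close>, the Poisson equation at \<open>(True, 1)\<close> reads
    \<open>- b * wg = h (True, 1)\<close>.\<close>
  define wg where "wg = - (c + K - \<rho>) / b"
  \<comment> \<open>Before the threshold \<open>w\<close> sums the affine values of
    \<open>h\<close>, hence the quadratic term.\<close>
  define w :: "info \<Rightarrow> real" where
    "w x = (if \<not> fst x \<and> snd x \<le> s
      then (real (snd x) - 1) * c + H * (real (snd x) - 1) * (real (snd x) - 2) / 2
      else belief a b (fst x) (snd x) * wg - h x)" for x
  have cD: "c * real s + c * (u s / b) = - H * real s * (real s - 1) / 2 - u s * (K - \<rho>) / b"
  proof -
    have "c * D = - H * real s * (real s - 1) / 2 - u s * (K - \<rho>) / b"
      using D by (simp add: c_def)
    thus ?thesis by (simp add: D_def distrib_left)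
  qed
  have h_good: "h (True, Suc 0) = c + K - \<rho>" and h_bad: "h (False, Suc 0) = c"
    unfolding h_def by (rule triple_sol_good[OF tr], rule triple_sol_bad[OF tr])
  have bwg: "b * wg = - h (True, Suc 0)" using b by (simp add: wg_def h_good)
  have w_good: "w (True, Suc 0) = wg"
    using bwg by (simp add: w_def v_1 algebra_simps del: belief.simps)
  have w_bad: "w (False, Suc 0) = 0" using s by (simp add: w_def)
  have h_s: "h (False, s) = c + (real s - 1) * H" by (simp add: h_def triple_sol_def)
  \<comment> \<open>At \<open>s\<close> both formulas for \<open>w\<close> have to agree; this is
    the equation that determines \<open>c\<close>.\<close>
  have w_late: "w (False, t) = u t * wg - h (False, t)" if "s \<le> t" for t
  proof (cases "t = s")
    case True
    have "u s * wg = - (c * (u s / b)) - u s * (K - \<rho>) / b"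
      using b by (simp add: wg_def field_simps)
    also have "\<dots> = c * real s + H * real s * (real s - 1) / 2" using cD by linarith
    finally show ?thesis using True by (simp add: w_def h_s field_simps)
  next
    case False
    thus ?thesis using that by (simp add: w_def)
  qed
  have poisson: "act_next a b (threshold s x) w x - w x = h x" if x: "x \<in> states" for x
  proof -
    obtain g t where [simp]: "x = (g, t)" by (cases x)
    show ?thesis
    proof (cases "threshold s x")
      case True
      have "w x = belief a b g t * wg - h x"
        using True w_late[of t] by (cases g) (auto simp: threshold_def w_def)
      thus ?thesis using True by (simp add: act_next_def w_good w_bad)
    next
      case False
      hence t: "\<not> g" "Suc t \<le> s" by (auto simp: threshold_def)
      have "h x = c + (real t - 1) * H" using t by (simp add: h_def triple_sol_def)
      thus ?thesis using False t by (simp add: act_next_def w_def field_simps)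
    qed
  qed
  define Mh where "Mh = \<bar>c\<bar> + real s * H + K + lam + H"
  define M where "M = Mh + \<bar>wg\<bar> + real s * \<bar>c\<bar> + H * real s * real s"
  have h_bnd: "\<forall>y\<in>states. \<bar>h y\<bar> \<le> Mh" unfolding h_def Mh_def by (rule triple_bounded[OF tr])
  have Mh: "0 \<le> Mh" using h_bnd[rule_format, of "(True, 1)"] by simp
  hence M: "Mh \<le> M" "0 \<le> M" using H by (auto simp: M_def)
  have w_bnd: "\<forall>y\<in>states. \<bar>w y\<bar> \<le> M"
  proof
    fix y assume y: "y \<in> states"
    obtain g t where [simp]: "y = (g, t)" by (cases y)
    show "\<bar>w y\<bar> \<le> M"
    proof (cases "\<not> g \<and> t \<le> s")
      case True
      have t: "0 \<le> real t - 1" "real t - 1 \<le> real s" "\<bar>real t - 2\<bar> \<le> real s" using True y s by auto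
      have "\<bar>w y\<bar> \<le> \<bar>(real t - 1) * c\<bar> + \<bar>H * (real t - 1) * (real t - 2) / 2\<bar>"
        using True by (simp add: w_def)
      also have "\<bar>(real t - 1) * c\<bar> \<le> real s * \<bar>c\<bar>"
        using t by (simp add: abs_mult mult_right_mono)
      also have "\<bar>H * (real t - 1) * (real t - 2) / 2\<bar> = (H * ((real t - 1) * \<bar>real t - 2\<bar>)) / 2"
        using H t by (simp add: abs_mult)
      also have "\<dots> \<le> H * ((real t - 1) * \<bar>real t - 2\<bar>)" using H t by simp
      also have "\<dots> \<le> H * (real s * real s)"
        using H t by (intro mult_left_mono mult_mono) auto
      finally show ?thesis using Mh by (simp add: M_def)
    next
      case False
      have "\<bar>belief a b g t * wg\<bar> \<le> 1 * \<bar>wg\<bar>"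
        using bel[of g t] unfolding abs_mult by (intro mult_right_mono) auto
      moreover have "w y = belief a b g t * wg - h y" using False by (auto simp: w_def)
      moreover have "\<bar>h y\<bar> \<le> Mh" using h_bnd y by blast
      moreover have "0 \<le> real s * \<bar>c\<bar>" "0 \<le> H * real s * real s" using H by auto
      ultimately show ?thesis unfolding M_def by linarith
    qed
  qed
  \<comment> \<open>A uniform price of deviating: early plays are finitely many, late waits cost at
    least as much as the wait at \<open>s\<close>, and waits in good states at least
    \<open>H\<close>.\<close>
  obtain e where e: "e > 0" "\<And>x. x \<in> states \<Longrightarrow> e \<le> loss a b \<rho> lam H h (\<not> threshold s x) x"
  proof -
    define gap where "gap m = lam + real m * H - K * u m" for m
    define e1 where "e1 = Min (insert 1 (gap ` {1..<s}))"
    define e2 where "e2 = H - K * (a * (1 - a - b) ^ s)"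
    have e1: "e1 > 0" using strict by (auto simp: e1_def gap_def)
    have "K * u (Suc s) < lam + real (Suc s) * H" using strict[of "Suc s"] by simp
    hence e2: "e2 > 0" using tr unfolding e2_def gain_triple_def u_Suc
      by (simp add: algebra_simps)
    have "min (min e1 e2) H \<le> loss a b \<rho> lam H h (\<not> threshold s x) x" if x: "x \<in> states" for x
    proof -
      obtain g t where [simp]: "x = (g, t)" by (cases x)
      consider "g" | "\<not> g" "t < s" | "\<not> g" "s \<le> t" by linarith
      thus ?thesis
      proof cases
        case 1
        thus ?thesis using loss_wait_good[OF tr, of c t] by (simp add: h_def threshold_def)
      next
        case 2
        have "e1 \<le> gap t" using 2 x unfolding e1_def by (intro Min_le) auto
        thus ?thesis using 2 by (simp add: h_def threshold_def loss_play[OF tr] gap_def)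
      next
        case 3
        have "e2 \<le> H - K * (a * (1 - a - b) ^ t)"
          using gain_triple_increment(1)[OF tr 3(2)] by (simp add: e2_def)
        thus ?thesis using 3 loss_wait_late[OF tr 3(2), of c] by (simp add: h_def threshold_def)
      qed
    qed
    thus ?thesis using that[of "min (min e1 e2) H"] e1 e2 H by simp
  qed
  have zero: "\<forall>y\<in>states. loss a b \<rho> lam H h (threshold s y) y = 0"
    unfolding h_def by (rule triple_zero_loss[OF tr])
  \<comment> \<open>After a deviation the Poisson equation fails by at most \<open>3 * M\<close>,
    which \<open>3 * M / e\<close> times the loss covers.\<close>
  have "bias_certificate a b \<rho> lam H states h w w (3 * M / e) M (threshold s)"
  proof
    show "0 \<le> 3 * M / e" using M e by simp
    fix x play assume x: "x \<in> states"
    show "act_next a b play w x - w x \<le> h x + 3 * M / e * loss a b \<rho> lam H h play x"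
    proof (cases "play = threshold s x")
      case True
      thus ?thesis using poisson[OF x] zero x by simp
    next
      case False
      hence "play = (\<not> threshold s x)" by blast
      hence "e \<le> loss a b \<rho> lam H h play x" using e(2)[OF x] by simp
      hence "3 * M / e * e \<le> 3 * M / e * loss a b \<rho> lam H h play x"
        using M e by (intro mult_left_mono) auto
      hence "3 * M \<le> 3 * M / e * loss a b \<rho> lam H h play x" using e(1) by simp
      moreover have "\<bar>act_next a b play w x\<bar> \<le> M" "\<bar>w x\<bar> \<le> M" "\<bar>h x\<bar> \<le> M"
        using act_next_bounded[OF x w_bnd] w_bnd h_bnd x M(1) by (blast, blast, force)
      ultimately show ?thesis by linarith
    qed
  next
    fix x assume x: "x \<in> states"
    show "h x \<le> act_next a b (threshold s x) w x - w x" using poisson[OF x] by simp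
  next
    show "supersolution a b \<rho> lam states H h"
      unfolding h_def by (rule triple_supersolution[OF tr])
  qed (use arm closed_states w_bnd h_bnd M zero in \<open>auto intro: order_trans\<close>)
  thus ?thesis using optimal_singleI[of a b \<rho> lam "threshold s"] by (metis in_states(2))
qed

text \<open>Under the threshold policy the arm ends up good and is played for ever. Taking
  \<open>c = \<rho> - K\<close> makes the relative value \<open>0\<close> in good states and
  nonpositive in bad ones, so the zero function serves as \<open>w'\<close>. Thresholds may tie, so
  deviations need not have a positive price; \<open>w\<close> is a Lyapunov function that bounds the
  time spent in bad states.\<close>

lemma absorbing_threshold_optimal:
  assumes tr: "gain_triple lam H K s" and b: "b = 0" and a: "a > 0"
  shows "optimal_single a b \<rho> lam (threshold s)"
proof -
  have H: "H > 0" "H = \<rho> - lam" and lam: "lam \<ge> 0" and s: "1 \<le> s"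
    using tr b unfolding gain_triple_def by auto
  have K: "K > 0" by (rule gain_triple_K[OF tr])
  define h where "h = triple_sol lam H K s (\<rho> - K)"
  have v: "v t = 1" for t using b by (induction t) auto
  have h_good: "h (True, t) = 0" for t by (simp add: h_def triple_sol_def v H)
  have h_le: "h (False, t) \<le> 0" if "1 \<le> t" for t
  proof -
    have Ku: "K * u m \<le> K" for m using K bel[of False m] by (intro mult_left_le) auto
    show ?thesis
    proof (cases "t \<le> s")
      case True
      have "real t * H \<le> real s * H" using True H(1) by (intro mult_right_mono) auto
      moreover have "K * u s = lam + real s * H" using tr by (simp add: gain_triple_def)
      moreover have "h (False, t) = \<rho> - K + real t * H - H"
        using True by (simp add: h_def triple_sol_def algebra_simps)
      ultimately show ?thesis using Ku[of s] H by linarith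
    next
      case False
      thus ?thesis using Ku[of t] H by (simp add: h_def triple_sol_def)
    qed
  qed
  define Mh where "Mh = \<bar>\<rho> - K\<bar> + real s * H + K + lam + H"
  have h_bnd: "\<forall>y\<in>states. \<bar>h y\<bar> \<le> Mh" unfolding h_def Mh_def by (rule triple_bounded[OF tr])
  have Mh: "0 \<le> Mh" using h_bnd[rule_format, of "(True, 1)"] by simp
  have sup: "supersolution a b \<rho> lam states H h"
    unfolding h_def by (rule triple_supersolution[OF tr])
  hence loss0: "0 \<le> loss a b \<rho> lam H h play x" if "x \<in> states" for play x
    using that by (simp add: supersolution_loss)
  \<comment> \<open>The increments of \<open>u\<close> tend to \<open>0\<close>, so from some age
    \<open>t1\<close> on each wait loses at least \<open>H / 2\<close>.\<close>
  have "(\<lambda>t. K * (a * (1 - a) ^ t)) \<longlonglongrightarrow> K * (a * 0)"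
    using a ab b by (intro tendsto_intros LIMSEQ_realpow_zero) auto
  hence "eventually (\<lambda>t. K * (a * (1 - a) ^ t) < H / 2) sequentially"
    using H(1) by (intro order_tendstoD(2)) auto
  hence "eventually (\<lambda>t. K * (a * (1 - a) ^ t) < H / 2 \<and> s \<le> t) sequentially"
    using eventually_ge_at_top[of s] by (rule eventually_conj)
  then obtain t1 where t1: "\<And>t. t1 \<le> t \<Longrightarrow> K * (a * (1 - a) ^ t) < H / 2 \<and> s \<le> t"
    by (auto simp: eventually_sequentially)
  have late: "H / 2 \<le> loss a b \<rho> lam H h False (False, t)" if "t1 \<le> t" for t
    using t1[OF that] loss_wait_late[OF tr, of t "\<rho> - K"] b by (simp add: h_def)
  \<comment> \<open>A play is absorbed with probability at least \<open>a\<close>;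
    \<open>a * B\<close> then outweighs the at most \<open>t1 * Mh\<close> regained when the age
    restarts, with \<open>Mh\<close> to spare.\<close>
  define B where "B = (real t1 + 1) * Mh / a"
  define w :: "info \<Rightarrow> real" where
    "w x = (if fst x then 0 else B + (real t1 - real (min (snd x) t1)) * Mh)" for x
  have B: "0 \<le> B" "a * B = (real t1 + 1) * Mh" using Mh a by (auto simp: B_def)
  define M where "M = B + (real t1 + 1) * Mh"
  have MhM: "Mh \<le> M" using B Mh by (simp add: M_def algebra_simps)
  have min_bnd: "0 \<le> (real t1 - real (min t t1)) * Mh" "(real t1 - real (min t t1)) * Mh \<le> real t1 * Mh" for t
    using Mh by (auto intro!: mult_right_mono)
  have w_nonneg: "0 \<le> w y" for y using B min_bnd(1)[of "snd y"] by (simp add: w_def)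
  have w_le: "w y \<le> B + real t1 * Mh" for y using B Mh min_bnd(2)[of "snd y"] by (simp add: w_def)
  have w_bnd: "\<bar>w y\<bar> \<le> M" for y
    using w_nonneg[of y] w_le[of y] Mh by (simp add: M_def algebra_simps)
  have "bias_certificate a b \<rho> lam H states h w (\<lambda>_. 0) (2 * Mh / H) M (threshold s)"
  proof
    show "0 \<le> 2 * Mh / H" using Mh H(1) by simp
    fix x play assume x: "x \<in> states"
    obtain g t where [simp]: "x = (g, t)" by (cases x)
    have t: "1 \<le> t" using x by simp
    have CL: "0 \<le> 2 * Mh / H * loss a b \<rho> lam H h play x"
      using loss0[OF x] Mh H(1) by (intro mult_nonneg_nonneg) auto
    have hx: "- Mh \<le> h x" using bspec[OF h_bnd x] by linarith
    show "act_next a b play w x - w x \<le> h x + 2 * Mh / H * loss a b \<rho> lam H h play x"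
    proof (cases g)
      case True
      thus ?thesis using CL by (cases play) (auto simp: act_next_def w_def v h_good)
    next
      case False
      show ?thesis
      proof (cases play)
        case True
        have "(1 - u t) * w (False, 1) \<le> (1 - a) * (B + real t1 * Mh)"
          using u_ge[OF t] w_nonneg w_le bel[of False t] a ab b by (intro mult_mono) auto
        also have "\<dots> \<le> B + real t1 * Mh - a * B" using a Mh by (simp add: algebra_simps)
        finally have "(1 - u t) * w (False, 1) \<le> B - Mh" using B(2) by (simp add: algebra_simps)
        moreover have "B \<le> w x" using False min_bnd(1)[of t] by (simp add: w_def)
        moreover have "act_next a b play w x = (1 - u t) * w (False, 1)"
          using True False by (simp add: act_next_def w_def)
        ultimately show ?thesis using CL hx by linarith
      next
        case p: False
        show ?thesis
        proof (cases "t1 \<le> t")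
          case True
          have "2 * Mh / H * (H / 2) \<le> 2 * Mh / H * loss a b \<rho> lam H h play x"
            using late[OF True] p False Mh H(1) by (intro mult_left_mono) auto
          hence "Mh \<le> 2 * Mh / H * loss a b \<rho> lam H h play x" using H(1) by simp
          moreover have "act_next a b play w x = w x"
            using p False True by (simp add: act_next_def w_def)
          ultimately show ?thesis using hx by linarith
        next
          case t1: False
          have "act_next a b play w x - w x = - Mh"
            using p False t1 by (simp add: act_next_def w_def algebra_simps)
          thus ?thesis using CL hx by linarith
        qed
      qed
    qed
  next
    fix x assume x: "x \<in> states"
    obtain g t where [simp]: "x = (g, t)" by (cases x)
    show "h x \<le> act_next a b (threshold s x) (\<lambda>_. 0) x - 0"
      using h_good h_le x by (cases g) (auto simp: act_next_def)
  next
    show "\<forall>y\<in>states. loss a b \<rho> lam H h (threshold s y) y = 0"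
      unfolding h_def by (rule triple_zero_loss[OF tr])
  qed (use arm closed_states w_bnd h_bnd sup MhM Mh in \<open>auto intro: order_trans\<close>)
  thus ?thesis using optimal_singleI[of a b \<rho> lam "threshold s"] by (metis in_states(2))
qed

end

section \<open>Bounds for the Whittle index\<close>

context arm
begin

lemma whittle_ge:
  assumes "optimal_single a b \<rho> lam f" "f x"
  shows "ereal lam \<le> whittle_index a b \<rho> x"
  unfolding whittle_index_def using assms by (intro SUP_upper) auto

text \<open>The index is a supremum, so a strict bound needs a margin below
  \<open>lam\<close>.\<close>

lemma whittle_less:
  assumes "l < lam" "\<And>lam' f. l < lam' \<Longrightarrow> optimal_single a b \<rho> lam' f \<Longrightarrow> \<not> f x"
  shows "whittle_index a b \<rho> x < ereal lam"
proof -
  have "whittle_index a b \<rho> x \<le> ereal l"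
    unfolding whittle_index_def using assms(2) by (intro SUP_least) (auto simp: not_less[symmetric])
  thus ?thesis using assms(1) by (simp add: le_less_trans)
qed

text \<open>
  The slope of \<open>F l s\<close> in \<open>l\<close> is minus the frequency of plays of the policy with
  threshold \<open>s\<close>, which decreases with \<open>s\<close>. This gives indexability.
\<close>

lemma F_diff:
  assumes b: "b > 0" and s: "1 \<le> s" "s < m" and l: "l < l'"
  shows "F l' s - F l' m < F l s - F l m"
proof -
  \<comment> \<open>The frequency of plays: \<open>1 + u t / b\<close> plays in a mean cycle of
    length \<open>t + u t / b\<close>.\<close>
  define N where "N t = (u t + b) / (u t + real t * b)" for t
  have F: "F l t = \<rho> * u t / (u t + real t * b) - l * N t" for l t
    by (simp add: F_def N_def diff_divide_distrib[symmetric] algebra_simps)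
  have um: "u s \<le> u m" using s by (intro u_mono) simp
  have "real s * u m \<le> real m * u s" using u_ratio[of s m] s by simp
  moreover have "real s * b < real m * b" using b s by simp
  ultimately have "real s * u m - u m + real s * b < real m * u s - u s + real m * b"
    using um by linarith
  hence "b * (real s * u m - u m + real s * b) < b * (real m * u s - u s + real m * b)"
    using b by simp
  hence "(u m + b) * (u s + real s * b) < (u s + b) * (u m + real m * b)"
    by (simp add: algebra_simps)
  hence "N m < N s"
    using F_denominator[OF b, of s] F_denominator[OF b, of m] s by (simp add: N_def divide_less_eq less_divide_eq mult.commute)
  hence "0 < (l' - l) * (N s - N m)" using l by simp
  thus ?thesis by (simp add: F algebra_simps)
qed

lemma F_antimono:
  assumes b: "b > 0" and t: "1 \<le> t" and l: "l \<le> l'"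
  shows "F l' t \<le> F l t"
proof -
  have "l * (u t + b) \<le> l' * (u t + b)" using l b bel[of False t] by (intro mult_right_mono) auto
  hence "(\<rho> - l') * u t - l' * b \<le> (\<rho> - l) * u t - l * b" by (simp add: algebra_simps)
  thus ?thesis unfolding F_def using F_denominator[OF b t] by (intro divide_right_mono) auto
qed

lemma F_tendsto: "b > 0 \<Longrightarrow> 1 \<le> t \<Longrightarrow> ((\<lambda>l. F l t) \<longlongrightarrow> F lam t) (at_left lam)"
  unfolding F_def using F_denominator[of t] by (intro tendsto_intros) auto

lemma F_eventually_less:
  assumes "b > 0" "1 \<le> m" "finite A" "\<And>s. s \<in> A \<Longrightarrow> 1 \<le> s" "\<And>s. s \<in> A \<Longrightarrow> F lam s < F lam m"
  shows "eventually (\<lambda>l. \<forall>s\<in>A. F l s < F l m) (at_left lam)"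
proof (rule eventually_ball_finite[OF assms(3)], rule ballI)
  fix s assume "s \<in> A"
  hence "((\<lambda>l. F l m - F l s) \<longlongrightarrow> F lam m - F lam s) (at_left lam)" "0 < F lam m - F lam s"
    using assms by (auto intro!: tendsto_diff F_tendsto)
  hence "eventually (\<lambda>l. 0 < F l m - F l s) (at_left lam)" by (rule order_tendstoD)
  thus "eventually (\<lambda>l. F l s < F l m) (at_left lam)" by simp
qed

lemma eventually_near_left:
  fixes lam z :: real
  assumes "z < lam"
  shows "eventually (\<lambda>l. z < l \<and> l < lam) (at_left lam)"
  using eventually_at_left_real[OF assms] by simp

text \<open>Just below \<open>lam\<close>, the least maximiser \<open>s\<close> becomes the unique
  one: it still beats smaller thresholds by continuity, and it beats larger ones by
  \<open>F_diff\<close>. So \<open>strict_threshold_optimal\<close> applies at penalties arbitrarily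
  close to \<open>lam\<close>.\<close>

lemma whittle_ge_threshold:
  assumes b: "b > 0" and lam: "lam > 0" and s: "1 \<le> s" "F lam s > 0"
    and max: "\<And>m. 1 \<le> m \<Longrightarrow> F lam m \<le> F lam s"
    and least: "\<And>m. 1 \<le> m \<Longrightarrow> m < s \<Longrightarrow> F lam m < F lam s"
    and x: "threshold s x"
  shows "ereal lam \<le> whittle_index a b \<rho> x"
proof (rule ccontr)
  assume "\<not> ereal lam \<le> whittle_index a b \<rho> x"
  hence "whittle_index a b \<rho> x < ereal lam" by simp
  then obtain z where z: "whittle_index a b \<rho> x < ereal z" "ereal z < ereal lam"
    by (rule ereal_dense3[elim_format]) auto
  have "eventually (\<lambda>l. \<forall>m\<in>{1..<s}. F l m < F l s) (at_left lam)"
    using least by (intro F_eventually_less[OF b s(1)]) auto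
  moreover have "eventually (\<lambda>l. max 0 z < l \<and> l < lam) (at_left lam)"
    using z lam by (intro eventually_near_left) auto
  ultimately have "eventually (\<lambda>l. (\<forall>m\<in>{1..<s}. F l m < F l s) \<and> max 0 z < l \<and> l < lam) (at_left lam)"
    by eventually_elim auto
  then obtain l where l: "\<forall>m\<in>{1..<s}. F l m < F l s" "0 < l" "z < l" "l < lam"
    by (auto dest!: eventually_happens)
  have less: "F l m < F l s" if m: "1 \<le> m" "m \<noteq> s" for m
  proof (cases "m < s")
    case True
    thus ?thesis using l(1) m by auto
  next
    case False
    hence "s < m" using m by simp
    from F_diff[OF b s(1) this l(4)] max[OF m(1)] show ?thesis by simp
  qed
  have pos: "F l s > 0" using F_antimono[OF b s(1), of l lam] l s(2) by simp
  have tr: "gain_triple l (F l s) ((\<rho> - l - F l s) / b) s"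
    using less l(2) pos s(1) by (intro gain_triple_F[OF b]) (auto intro: less_imp_le le_cases)
  have "optimal_single a b \<rho> l (threshold s)"
  proof (rule strict_threshold_optimal[OF tr b])
    fix m assume m: "1 \<le> m" "m \<noteq> s"
    show "(\<rho> - l - F l s) / b * u m < l + real m * F l s"
      using less[OF m] F_less_iff[OF b m(1), of l "F l s"] b by (simp add: field_simps)
  qed
  from whittle_ge[OF this x] have "ereal l \<le> whittle_index a b \<rho> x" .
  thus False using z(1) l(3) by (metis ereal_less_eq(3) leD le_less_trans less_imp_le)
qed

section \<open>Upper bounds for the index\<close>

lemma whittle_less_small:
  assumes "\<rho> * (1 - b) < lam" "1 \<le> snd x"
  shows "whittle_index a b \<rho> x < ereal lam"
proof (rule whittle_less[OF assms(1)])
  fix lam' f assume l: "\<rho> * (1 - b) < lam'" and opt: "optimal_single a b \<rho> lam' f"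
  have "belief a b (fst x) (snd x) * (\<rho> + 0) \<le> (1 - b) * \<rho>"
    using belief_le[OF assms(2)] r0 by (auto intro: mult_right_mono)
  also have "\<dots> < lam'" using l by (simp add: mult.commute)
  finally show "\<not> f x"
    using l assms(2) opt by (intro worthless_not_play[OF worthless_small]) (auto simp: worthless_sol_def)
qed

text \<open>If \<open>a > 0\<close> and \<open>\<rho> + G > 0\<close>, the belief still grows, so
  the weak inequality at age \<open>t + 1\<close> is strict at age \<open>t\<close>; otherwise the
  left-hand side is \<open>0\<close>.\<close>

lemma worthless_strict:
  assumes "worthless lam G" "lam > 0" "1 \<le> t"
  shows "u t * (\<rho> + G) < lam"
proof (cases "a > 0 \<and> \<rho> + G > 0")
  case True
  hence "u t * (\<rho> + G) < u (Suc t) * (\<rho> + G)" using u_less by (intro mult_strict_right_mono) auto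
  also have "\<dots> \<le> lam" using assms(1) unfolding worthless_def by (metis le_SucI assms(3) mult.commute)
  finally show ?thesis .
next
  case False
  have "\<rho> + G \<ge> 0" using assms(1) r0 by (simp add: worthless_def)
  moreover have "u t = 0" if "a = 0" for t using that by (induction t) auto
  ultimately have "u t * (\<rho> + G) = 0" using False a0 by (metis antisym_conv not_le mult_eq_0_iff)
  thus ?thesis using assms(2) by linarith
qed

lemma worthless_not_play_bad:
  assumes "worthless lam G" "lam > 0" "1 \<le> t" "optimal_single a b \<rho> lam f"
  shows "\<not> f (False, t)"
  using assms worthless_strict[OF assms(1-3)]
  by (intro worthless_not_play[OF assms(1)]) (auto simp: worthless_sol_def)

text \<open>An arm seen bad stays bad, so any positive penalty forbids the play.\<close>

lemma whittle_less_a0: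
  assumes a: "a = 0" and lam: "lam > 0" and t: "1 \<le> t"
  shows "whittle_index a b \<rho> (False, t) < ereal lam"
proof (rule whittle_less[OF lam])
  fix lam' f assume l: "0 < lam'" and opt: "optimal_single a b \<rho> lam' f"
  consider "\<rho> * (1 - b) \<le> lam'" | "lam' \<le> \<rho> * (1 - b)" "b > 0" | "b = 0" using b0 by linarith
  thus "\<not> f (False, t)"
  proof cases
    case 1
    thus ?thesis using worthless_not_play_bad[OF worthless_small _ t opt] l by blast
  next
    case 2
    thus ?thesis using worthless_not_play_bad[OF worthless_a0[OF a] _ t opt] l by auto
  next
    case 3
    let ?f = "\<lambda>x. fst x \<and> lam' \<le> \<rho>"
    note c = frozen_certificate[OF a 3 less_imp_le[OF l], of False]
    show ?thesis
    proof (rule not_play_if_worthless[OF arm bias_certificate.cl[OF c] _ _ _ _ _ _ _ _ _ opt,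
          where \<phi> = "\<lambda>_. 0" and M = 0 and f' = ?f])
      show "gain_optimal a b \<rho> lam' ?f"
        using frozen_optimal[OF a 3, of lam'] l by (simp add: optimal_single_def)
      show "0 \<le> total1 a b \<rho> lam' ?f (False, t) T" for T
        using total1_ge[OF arm closed_info_chain[OF bias_certificate.cl[OF c]] _
            bias_certificate.zero[OF c] bias_certificate.bnd(1)[OF c], of "(False, t)" T] t by simp
      show "0 < loss a b \<rho> lam' 0 (\<lambda>_. 0) True (False, t)"
        using l a 3 by (simp add: loss_def act_rew_def act_next_def frozen_belief)
    qed (use t bias_certificate.sup[OF c] in auto)
  qed
qed

definition best :: "real \<Rightarrow> nat \<Rightarrow> bool" where
  "best lam s \<longleftrightarrow> 1 \<le> s \<and> F lam s > 0 \<and> (\<forall>m\<ge>1. F lam m \<le> F lam s)"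

text \<open>
  The first play after a bad observation fixes the gain of the policy up to the decisions
  in good states; comparing with the best decisions there bounds the gain by \<open>F lam s\<close>.
\<close>

lemma optimal_play_best:
  assumes b: "b > 0" and lam: "lam > 0" and t: "1 \<le> t"
    and opt: "optimal_single a b \<rho> lam f" and play: "f (False, t)"
  shows "\<exists>s\<le>t. best lam s"
proof -
  have "\<exists>t\<ge>1. F lam t > 0"
  proof (rule ccontr)
    assume no: "\<not> ?thesis"
    show False
    proof (cases "lam < \<rho> * (1 - b)")
      case True
      thus ?thesis using worthless_F[OF b True] no worthless_not_play_bad[OF _ lam t opt] play
        by (auto simp: not_less)
    next
      case False
      thus ?thesis using worthless_small[of lam] worthless_not_play_bad[OF _ lam t opt] play by auto
    qed
  qed
  then obtain t0 where t0: "1 \<le> t0" "F lam t0 > 0" by blast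
  obtain s' where s': "1 \<le> s'" "F lam s' > 0" "\<And>m. 1 \<le> m \<Longrightarrow> F lam m \<le> F lam s'"
    using F_maximiser[OF b less_imp_le[OF lam] t0] by metis
  let ?H = "F lam s'"
  have tr: "gain_triple lam ?H ((\<rho> - lam - ?H) / b) s'"
    by (rule gain_triple_F[OF b less_imp_le[OF lam] s'])
  define s where "s = (LEAST m. 1 \<le> m \<and> f (False, m))"
  have s: "1 \<le> s" "f (False, s)"
    unfolding s_def using LeastI[of "\<lambda>m. 1 \<le> m \<and> f (False, m)" t] t play by auto
  have st: "s \<le> t" unfolding s_def by (rule Least_le) (use t play in simp)
  have first: "m = s" if "1 \<le> m" "m \<le> s" "f (False, m)" for m
    using Least_le[of "\<lambda>m. 1 \<le> m \<and> f (False, m)" m] that by (auto simp: s_def)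
  have "?H \<le> F lam s"
  proof (rule ccontr)
    assume less: "\<not> ?H \<le> F lam s"
    \<comment> \<open>Under \<open>\<phi>\<close> below, waiting loses exactly \<open>h\<close> in a
      good state and nothing in a bad one; hence the truncation at \<open>0\<close>.\<close>
    define h where "h = max 0 (F lam s)"
    have h: "0 \<le> h" "h < ?H" "F lam s \<le> h" using less s' by (auto simp: h_def)
    \<comment> \<open>This makes the loss of a play in \<open>(True, 1)\<close> zero at gain
      \<open>h\<close>.\<close>
    define G where "G = (\<rho> * (1 - b) - lam - h) / b"
    have "0 < (\<rho> - lam - ?H) / b" by (rule gain_triple_K[OF tr])
    hence "0 < \<rho> - lam - ?H" using b by (simp add: zero_less_divide_iff)
    hence pos: "0 < \<rho> - lam - h" using h by linarith
    have rG: "\<rho> + G = (\<rho> - lam - h) / b" using b by (simp add: G_def field_simps)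
    \<comment> \<open>\<open>f\<close> plays a bad arm at age \<open>s\<close> at the latest, so the
      chain started at \<open>(False, 1)\<close> stays in \<open>S\<close>, and
      \<open>\<phi>\<close> is tested against the actions of \<open>f\<close> only.\<close>
    define S where "S = {x::info. 1 \<le> snd x \<and> (fst x \<or> snd x \<le> s)}"
    define \<phi> :: "info \<Rightarrow> real" where "\<phi> x = (if fst x then G else (real (snd x) - 1) * h)" for x
    have cl: "closed_chain a b f S"
      unfolding closed_chain_def
    proof
      fix x assume x: "x \<in> S"
      have "Suc (snd x) \<le> s" if "\<not> fst x" "\<not> f x"
        using that s(2) x by (cases x; cases "snd x = s") (auto simp: S_def)
      thus "if f x then (belief a b (fst x) (snd x) \<noteq> 0 \<longrightarrow> (True, 1) \<in> S) \<and>
          (belief a b (fst x) (snd x) \<noteq> 1 \<longrightarrow> (False, 1) \<in> S) else (fst x, Suc (snd x)) \<in> S"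
        using x s(1) by (auto simp: S_def)
    qed
    have L: "\<forall>y\<in>S. 0 \<le> loss a b \<rho> lam h \<phi> (f y) y"
    proof
      fix y assume y: "y \<in> S"
      obtain g m where [simp]: "y = (g, m)" by (cases y)
      have m: "1 \<le> m" using y by (simp add: S_def)
      show "0 \<le> loss a b \<rho> lam h \<phi> (f y) y"
      proof (cases "f y")
        case False
        thus ?thesis using h(1)
          by (cases g) (auto simp: loss_def act_rew_def act_next_def \<phi>_def algebra_simps)
      next
        case True
        show ?thesis
        proof (cases g)
          case g: True
          have "v m * (\<rho> + G) \<le> (1 - b) * (\<rho> + G)"
            using belief_le[OF m] rG pos b by (intro mult_right_mono) auto
          also have "\<dots> = lam + h + G" using b by (simp add: G_def field_simps)
          finally show ?thesis using True g
            by (simp add: loss_def act_rew_def act_next_def \<phi>_def algebra_simps)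
        next
          case g: False
          hence [simp]: "m = s" using first[OF m] y True by (auto simp: S_def)
          have "(\<rho> - lam - h) * u s \<le> b * (lam + real s * h)"
            using h(3) F_le_iff[OF b s(1)] by simp
          hence "(\<rho> + G) * u s \<le> lam + real s * h"
            unfolding rG using b by (simp add: field_simps)
          thus ?thesis using True g
            by (simp add: loss_def act_rew_def act_next_def \<phi>_def algebra_simps)
        qed
      qed
    qed
    have bnd: "\<forall>y\<in>S. \<bar>\<phi> y\<bar> \<le> \<bar>G\<bar> + real s * h"
    proof
      fix y assume y: "y \<in> S"
      have "0 \<le> real s * h" using h by simp
      moreover have "0 \<le> (real (snd y) - 1) * h \<and> (real (snd y) - 1) * h \<le> real s * h" if "\<not> fst y"
        using y that h by (auto simp: S_def intro!: mult_right_mono)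
      ultimately show "\<bar>\<phi> y\<bar> \<le> \<bar>G\<bar> + real s * h" by (cases "fst y") (auto simp: \<phi>_def)
    qed
    have "(False, 1) \<in> S" using s by (simp add: S_def)
    note le = total1_le[OF arm cl this L bnd]
    have "avg_value (\<lambda>_. a) (\<lambda>_. b) (\<lambda>_. \<rho>) lam (\<lambda>_. (False, 1)) (stationary_policy (False, 1) f)
      \<le> limsup (\<lambda>T. ereal (total1 a b \<rho> lam f (False, 1) T / real T))"
      unfolding avg_value_def by (rule Liminf_le_Limsup) simp
    also have "\<dots> \<le> ereal h" using le by (rule limsup_average_le)
    finally have "avg_value (\<lambda>_. a) (\<lambda>_. b) (\<lambda>_. \<rho>) lam (\<lambda>_. (False, 1)) (stationary_policy (False, 1) f)
      \<le> ereal h" .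
    moreover have "avg_value (\<lambda>_. a) (\<lambda>_. b) (\<lambda>_. \<rho>) lam (\<lambda>_. (False, 1)) (stationary_policy (False, 1) f)
      = ereal ?H"
      using opt gain_triple_H_single[OF tr, of "(False, 1)"]
      by (simp add: optimal_single_def gain_optimal_def)
    ultimately show False using h(2) by simp
  qed
  hence "best lam s" unfolding best_def using s s' by (auto intro: order_trans)
  thus ?thesis using st by blast
qed

text \<open>Either a threshold beyond \<open>t\<close> strictly beats all those up to
  \<open>t\<close>; by continuity it does so slightly below \<open>lam\<close>, and by
  \<open>F_diff\<close> at all higher penalties. Or the gains up to \<open>t\<close> are negative at
  \<open>lam\<close>, hence also from slightly below \<open>lam\<close> on, by continuity and
  \<open>F_antimono\<close>.\<close>

lemma whittle_less_threshold:
  assumes b: "b > 0" and lam: "lam > 0" and t: "1 \<le> t" and no: "\<not> (\<exists>s\<le>t. best lam s)"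
  shows "whittle_index a b \<rho> (False, t) < ereal lam"
proof -
  have near: "eventually (\<lambda>l. 0 < l \<and> l < lam) (at_left lam)"
    by (rule eventually_near_left[OF lam])
  have "\<exists>l. 0 < l \<and> l < lam \<and> (\<forall>lam'>l. \<forall>s\<le>t. \<not> best lam' s)"
  proof (cases "\<exists>m>t. \<forall>s\<in>{1..t}. F lam s < F lam m")
    case True
    then obtain m where m: "m > t" "\<forall>s\<in>{1..t}. F lam s < F lam m" by blast
    have "eventually (\<lambda>l. \<forall>s\<in>{1..t}. F l s < F l m) (at_left lam)"
      using m t by (intro F_eventually_less[OF b]) auto
    from eventually_conj[OF this near] obtain l where
      l: "\<forall>s\<in>{1..t}. F l s < F l m" "0 < l" "l < lam" by (auto dest!: eventually_happens)
    have "\<not> best lam' s" if "l < lam'" "s \<le> t" for lam' s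
    proof
      assume "best lam' s"
      hence s: "1 \<le> s" "F lam' m \<le> F lam' s" using m t by (auto simp: best_def)
      have "F lam' s - F lam' m < F l s - F l m" using s that m by (intro F_diff[OF b]) auto
      moreover have "F l s < F l m" using l(1) s that by auto
      ultimately show False using s(2) by simp
    qed
    thus ?thesis using l by blast
  next
    case False
    have "Max (F lam ` {1..t}) \<in> F lam ` {1..t}" using t by (intro Max_in) auto
    then obtain s0 where s0: "s0 \<in> {1..t}" "F lam s0 = Max (F lam ` {1..t})" by auto
    hence s0_max: "F lam s \<le> F lam s0" if "s \<in> {1..t}" for s using that by simp
    have s0_best: "F lam m \<le> F lam s0" if "1 \<le> m" for m
    proof (cases "m \<le> t")
      case False
      then obtain s where "s \<in> {1..t}" "F lam m \<le> F lam s"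
        using \<open>\<not> (\<exists>m>t. \<forall>s\<in>{1..t}. F lam s < F lam m)\<close>
        by (meson not_less not_le)
      thus ?thesis using s0_max by (blast intro: order_trans)
    qed (use s0_max that in auto)
    hence "\<not> F lam s0 > 0" using no s0(1) by (auto simp: best_def)
    hence nonpos: "F lam m \<le> 0" if "1 \<le> m" for m using s0_best[OF that] by simp
    \<comment> \<open>At gain \<open>0\<close> waiting is free: if \<open>m\<close> broke even,
      \<open>m + 1\<close> with its higher belief would have positive gain.\<close>
    have neg: "F lam m < 0" if m: "1 \<le> m" for m
    proof (rule ccontr)
      assume "\<not> ?thesis"
      hence eq: "\<not> (\<rho> - lam) * u m < b * lam" using F_less_iff[OF b m, of lam 0] by simp
      have "0 < b * lam" using b lam by simp
      hence "0 < (\<rho> - lam) * u m" using eq by linarith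
      hence pos: "0 < \<rho> - lam" "u m > 0" using bel[of False m] by (auto simp: zero_less_mult_iff)
      have "a \<noteq> 0"
      proof
        assume "a = 0"
        hence "u m = 0" by (induction m) auto
        thus False using pos by simp
      qed
      hence "u m < u (Suc m)" using a0 by (intro u_less) simp
      hence "(\<rho> - lam) * u m < (\<rho> - lam) * u (Suc m)" using pos by (intro mult_strict_left_mono)
      moreover have "(\<rho> - lam) * u (Suc m) \<le> b * lam"
        using nonpos[of "Suc m"] F_le_iff[OF b, of "Suc m" lam 0] by simp
      ultimately show False using eq by linarith
    qed
    have "eventually (\<lambda>l. \<forall>s\<in>{1..t}. F l s < 0) (at_left lam)"
      using neg by (intro eventually_ball_finite ballI order_tendstoD(2)[OF F_tendsto[OF b]]) auto
    from eventually_conj[OF this near] obtain l where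
      l: "\<forall>s\<in>{1..t}. F l s < 0" "0 < l" "l < lam" by (auto dest!: eventually_happens)
    have "\<not> best lam' s" if "l < lam'" "s \<le> t" for lam' s
      using F_antimono[OF b, of s l lam'] l(1) that by (force simp: best_def)
    thus ?thesis using l by blast
  qed
  then obtain l where l: "0 < l" "l < lam" "\<And>lam' s. l < lam' \<Longrightarrow> s \<le> t \<Longrightarrow> \<not> best lam' s"
    by blast
  show ?thesis
  proof (rule whittle_less[OF l(2)])
    fix lam' f assume "l < lam'" "optimal_single a b \<rho> lam' f"
    thus "\<not> f (False, t)" using optimal_play_best[OF b _ t] l by (meson less_trans)
  qed
qed

end

section \<open>Potentials for the index policy\<close>

definition exploitable :: "real \<Rightarrow> real \<Rightarrow> real \<Rightarrow> info \<Rightarrow> bool" where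
  "exploitable b \<rho> lam y \<longleftrightarrow> y = (True, 1) \<and> lam \<le> \<rho> * (1 - b)"

definition play_value :: "real \<Rightarrow> real \<Rightarrow> real \<Rightarrow> (info \<Rightarrow> real) \<Rightarrow> info \<Rightarrow> real" where
  "play_value a b \<rho> \<psi> y = act_rew a b \<rho> 0 True y + act_next a b True \<psi> y"

text \<open>
  A play of an arm whose index reaches \<open>lam\<close> gains \<open>lam\<close>; if no index reaches \<open>lam\<close>,
  every arm gains its \<open>H\<close>, the played one included. Either way a step of
  Threshold-Whittle gains \<open>lam\<close> in reward and potential.
\<close>

definition index_potential ::
  "real \<Rightarrow> real \<Rightarrow> real \<Rightarrow> real \<Rightarrow> real \<Rightarrow> info set \<Rightarrow> (info \<Rightarrow> real) \<Rightarrow> bool"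
where
  "index_potential a b \<rho> lam H S \<psi> \<longleftrightarrow> (\<forall>y\<in>S.
     (if exploitable b \<rho> lam y then lam + \<psi> y \<le> play_value a b \<rho> \<psi> y
      else \<psi> y \<le> \<psi> (fst y, Suc (snd y)) \<and>
        (if ereal lam \<le> whittle_index a b \<rho> y then lam + \<psi> y \<le> play_value a b \<rho> \<psi> y
         else \<psi> y + H \<le> \<psi> (fst y, Suc (snd y)) \<and> H + \<psi> y \<le> play_value a b \<rho> \<psi> y)))"

lemma if_step:
  assumes "E \<or> Q \<Longrightarrow> A" "\<not> E \<Longrightarrow> B" "\<not> E \<Longrightarrow> \<not> Q \<Longrightarrow> C"
  shows "if E then A else B \<and> (if Q then A else C)"
  using assms by auto

context arm
begin

text \<open>A fresh exploitable arm earns \<open>lam\<close> by its play. An aged good arm chosen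
  for its index may earn less, but its play lifts the potential from \<open>- lam\<close> back to
  \<open>0\<close>.\<close>

lemma potential_worthless:
  assumes lam: "lam > 0"
    and S: "S \<subseteq> states"
    and cold: "\<And>y. y \<in> S \<Longrightarrow> \<not> fst y \<or> \<rho> * (1 - b) < lam \<Longrightarrow> whittle_index a b \<rho> y < ereal lam"
  shows "index_potential a b \<rho> lam 0 S (\<lambda>y. if fst y \<and> snd y \<noteq> 1 \<and> lam \<le> \<rho> * (1 - b) then - lam else 0)"
    (is "index_potential _ _ _ _ _ _ ?\<psi>")
  unfolding index_potential_def
proof
  fix y assume y: "y \<in> S"
  obtain g t where [simp]: "y = (g, t)" by (cases y)
  have t: "1 \<le> t" using S y by auto
  have pv: "play_value a b \<rho> ?\<psi> y = belief a b g t * \<rho>"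
    by (simp add: play_value_def act_rew_def act_next_def)
  have pos: "0 \<le> belief a b g t * \<rho>" using bel[of g t] r0 by simp
  have aged: "?\<psi> y \<le> ?\<psi> (fst y, Suc (snd y))" if "\<not> exploitable b \<rho> lam y"
    using that t by (auto simp: exploitable_def)
  have play: "lam + ?\<psi> y \<le> belief a b g t * \<rho>"
    if "exploitable b \<rho> lam y \<or> ereal lam \<le> whittle_index a b \<rho> y"
  proof -
    have P: "g" "lam \<le> \<rho> * (1 - b)"
      using that cold[OF y] by (auto simp: exploitable_def not_less[symmetric])
    show ?thesis
    proof (cases "t = 1")
      case True
      thus ?thesis using P by (simp add: mult.commute)
    next
      case False
      thus ?thesis using P pos by simp
    qed
  qed
  have neg: "?\<psi> y \<le> 0" using lam by simp
  show "if exploitable b \<rho> lam y then lam + ?\<psi> y \<le> play_value a b \<rho> ?\<psi> y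
      else ?\<psi> y \<le> ?\<psi> (fst y, Suc (snd y)) \<and>
        (if ereal lam \<le> whittle_index a b \<rho> y then lam + ?\<psi> y \<le> play_value a b \<rho> ?\<psi> y
         else ?\<psi> y + 0 \<le> ?\<psi> (fst y, Suc (snd y)) \<and> 0 + ?\<psi> y \<le> play_value a b \<rho> ?\<psi> y)"
    unfolding pv add_0_left add_0_right
  proof (rule if_step)
    show "?\<psi> y \<le> ?\<psi> (fst y, Suc (snd y)) \<and> ?\<psi> y \<le> belief a b g t * \<rho>"
      if "\<not> exploitable b \<rho> lam y"
      using aged[OF that] neg pos by (meson order_trans)
  qed (erule play, erule aged)
qed

text \<open>At \<open>(True, 1)\<close> and \<open>(False, 1)\<close> this is the relative value for
  \<open>c = 0\<close>, so a play returns the belief times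
  \<open>K = (\<rho> - lam - F lam s) / b\<close>.\<close>

lemma potential_recurrent:
  assumes lam: "lam > 0" and b: "b > 0" and P: "lam \<le> \<rho> * (1 - b)"
    and s: "1 \<le> s" "F lam s > 0"
    and max: "\<And>m. 1 \<le> m \<Longrightarrow> F lam m \<le> F lam s"
    and least: "\<And>m. 1 \<le> m \<Longrightarrow> m < s \<Longrightarrow> F lam m < F lam s"
  shows "index_potential a b \<rho> lam (F lam s) states
    (\<lambda>y. if fst y then (if snd y = 1 then (\<rho> - lam - F lam s) / b - \<rho> else - lam)
         else (real (min (snd y) s) - 1) * F lam s)"
    (is "index_potential _ _ _ _ _ _ ?\<psi>")
  unfolding index_potential_def
proof
  let ?H = "F lam s" and ?K = "(\<rho> - lam - F lam s) / b"
  have tr: "gain_triple lam ?H ?K s" by (rule gain_triple_F[OF b less_imp_le[OF lam] s max])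
  have K: "?K > 0" by (rule gain_triple_K[OF tr])
  have Ks: "?K * u s = lam + real s * ?H" using tr by (simp add: gain_triple_def)
  fix y assume y: "y \<in> states"
  obtain g t where [simp]: "y = (g, t)" by (cases y)
  have t: "1 \<le> t" using y by simp
  have pv: "play_value a b \<rho> ?\<psi> y = belief a b g t * ?K"
    using s(1) unfolding play_value_def act_rew_def act_next_def
    by (simp add: algebra_simps del: belief.simps)
  have pos: "0 \<le> belief a b g t * ?K" using bel[of g t] K by (intro mult_nonneg_nonneg) auto
  have hot: "ereal lam \<le> whittle_index a b \<rho> y" if "g \<or> s \<le> t"
    using that by (intro whittle_ge_threshold[OF b lam s max least]) (auto simp: threshold_def)
  \<comment> \<open>A bad arm has index at least \<open>lam\<close> only from some optimal threshold
    on, and \<open>s\<close> is the least of these.\<close>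
  have hot_iff: "s \<le> t" if h: "ereal lam \<le> whittle_index a b \<rho> y" and "\<not> g"
  proof -
    have "\<exists>s'\<le>t. best lam s'"
      using whittle_less_threshold[OF b lam t] that by (auto simp: not_less[symmetric])
    then obtain s' where "s' \<le> t" "1 \<le> s'" "F lam s \<le> F lam s'" using s(1) by (auto simp: best_def)
    thus ?thesis using least[of s'] by (cases "s \<le> s'") auto
  qed
  have aged: "?\<psi> y \<le> ?\<psi> (fst y, Suc (snd y))" if "\<not> exploitable b \<rho> lam y"
  proof (cases g)
    case True
    thus ?thesis using that P t by (auto simp: exploitable_def)
  next
    case False
    have "(real (min t s) - 1) * ?H \<le> (real (min (Suc t) s) - 1) * ?H"
      using s(2) by (intro mult_right_mono) auto
    thus ?thesis using False by simp
  qed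
  have play: "lam + ?\<psi> y \<le> belief a b g t * ?K" if h: "exploitable b \<rho> lam y \<or> ereal lam \<le> whittle_index a b \<rho> y"
  proof (cases g)
    case True
    show ?thesis
    proof (cases "t = 1")
      case t1: True
      have "belief a b g t = 1 - b" using True t1 by simp
      hence "belief a b g t * ?K = ?K - b * ?K" by (simp only: left_diff_distrib mult_1)
      also have "b * ?K = \<rho> - lam - ?H" using b by simp
      finally show ?thesis using True t1 s(2) by simp
    next
      case False
      thus ?thesis using True pos by simp
    qed
  next
    case False
    hence st: "s \<le> t" using hot_iff h by (auto simp: exploitable_def)
    have "?K * u s \<le> ?K * u t" using K u_mono[OF st] by (intro mult_left_mono) auto
    thus ?thesis using False Ks s(2) st by (simp add: min_absorb2 algebra_simps)
  qed
  have cold: "?\<psi> y + ?H \<le> ?\<psi> (fst y, Suc (snd y)) \<and> ?H + ?\<psi> y \<le> belief a b g t * ?K"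
    if c: "\<not> ereal lam \<le> whittle_index a b \<rho> y"
  proof -
    have "\<not> (g \<or> s \<le> t)" using hot c by blast
    hence g: "\<not> g" and ts: "t < s" by auto
    \<comment> \<open>A cold arm may have to be played before its threshold. As
      \<open>u t / t \<ge> u s / s\<close> and \<open>?K * u s \<ge> real s * ?H\<close>, the early
      play still returns \<open>real t * ?H\<close>.\<close>
    have "real t * (?K * u s) \<le> real s * (?K * u t)"
      using mult_left_mono[OF u_ratio[OF t less_imp_le[OF ts]] less_imp_le[OF K]]
      by (simp only: mult.left_commute[of ?K])
    moreover have "real t * (real s * ?H) \<le> real t * (?K * u s)"
      unfolding Ks using lam by (intro mult_left_mono) auto
    ultimately have "real s * (real t * ?H) \<le> real s * (?K * u t)" by (simp add: mult.left_commute)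
    hence "real t * ?H \<le> ?K * u t" by (rule mult_left_le_imp_le) (use s(1) in simp)
    moreover have "?\<psi> y = real t * ?H - ?H" "?\<psi> (fst y, Suc (snd y)) = real t * ?H"
      "belief a b g t * ?K = ?K * u t"
      using g ts by (simp_all add: min_absorb1 algebra_simps)
    ultimately show ?thesis by (intro conjI) linarith+
  qed
  show "if exploitable b \<rho> lam y then lam + ?\<psi> y \<le> play_value a b \<rho> ?\<psi> y
      else ?\<psi> y \<le> ?\<psi> (fst y, Suc (snd y)) \<and>
        (if ereal lam \<le> whittle_index a b \<rho> y then lam + ?\<psi> y \<le> play_value a b \<rho> ?\<psi> y
         else ?\<psi> y + ?H \<le> ?\<psi> (fst y, Suc (snd y)) \<and> ?H + ?\<psi> y \<le> play_value a b \<rho> ?\<psi> y)"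
    unfolding pv by (rule if_step) (erule play, erule aged, rule cold, assumption)
qed

text \<open>
  With \<open>b = 0\<close> a good arm is played for ever once it has been observed, so bad states are
  transient and their potential may simply be taken small.
\<close>

lemma potential_absorbing:
  assumes lam: "lam > 0" and b: "b = 0" and P: "lam \<le> \<rho>"
    and S: "S \<subseteq> states" "\<And>t. (False, t) \<in> S \<Longrightarrow> a > 0"
    and hot: "\<And>y. y \<in> S \<Longrightarrow> lam < \<rho> \<Longrightarrow> threshold s y \<Longrightarrow> ereal lam \<le> whittle_index a b \<rho> y"
  shows "index_potential a b \<rho> lam (\<rho> - lam) S
    (\<lambda>y. if fst y then (if snd y = 1 then 0 else - lam)
         else real (min (snd y) s) * (\<rho> - lam) - (lam + (real s + 1) * (\<rho> - lam)) / a)"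
    (is "index_potential _ _ _ _ _ _ ?\<psi>")
  unfolding index_potential_def
proof
  let ?H = "\<rho> - lam"
  fix y assume y: "y \<in> S"
  obtain g t where [simp]: "y = (g, t)" by (cases y)
  have t: "1 \<le> t" using S y by auto
  have v: "v t = 1" for t using b by (induction t) auto
  have aged: "?\<psi> y \<le> ?\<psi> (fst y, Suc (snd y))" if "\<not> exploitable b \<rho> lam y"
  proof (cases g)
    case True
    thus ?thesis using that P b t by (auto simp: exploitable_def)
  next
    case False
    have "real (min t s) * ?H \<le> real (min (Suc t) s) * ?H"
      using P by (intro mult_right_mono) auto
    thus ?thesis using False by simp
  qed
  have waiting: "?\<psi> y + ?H \<le> ?\<psi> (fst y, Suc (snd y))"
    if "\<not> exploitable b \<rho> lam y" and c: "\<not> ereal lam \<le> whittle_index a b \<rho> y"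
  proof (cases "lam < \<rho>")
    case True
    hence "\<not> threshold s y" using hot[OF y True] c by blast
    hence "\<not> g" "t < s" by (simp_all add: threshold_def)
    thus ?thesis by (simp add: min_absorb1 algebra_simps)
  next
    case False
    thus ?thesis using aged[OF that(1)] P by simp
  qed
  have play: "max lam ?H + ?\<psi> y \<le> play_value a b \<rho> ?\<psi> y"
  proof (cases g)
    case True
    have "play_value a b \<rho> ?\<psi> y = \<rho>"
      using True by (simp add: play_value_def act_rew_def act_next_def v)
    moreover have "max lam ?H \<le> \<rho>" using P lam by simp
    moreover have "?\<psi> y \<le> 0" using True lam by simp
    ultimately show ?thesis by linarith
  next
    case False
    hence a: "a > 0" using S(2) y by simp
    \<comment> \<open>With probability at least \<open>a\<close> the play finds the arm good and
      removes the debt \<open>D\<close>; \<open>a * D\<close> pays for \<open>lam + ?H\<close> and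
      for the age credit, at most \<open>real s * ?H\<close>, that a play forfeits.\<close>
    define D where "D = (lam + (real s + 1) * ?H) / a"
    have "a * D = lam + (real s + 1) * ?H" using a by (simp add: D_def)
    hence D: "a * D = lam + real s * ?H + ?H" by (simp only: distrib_right mult_1 add.assoc)
    have D0: "0 \<le> D" using lam P a by (simp add: D_def)
    have "a * D \<le> u t * D" using u_ge[OF t] D0 by (rule mult_right_mono)
    moreover have "0 \<le> u t * \<rho>" using bel[of False t] r0 by simp
    moreover have "0 \<le> (1 - u t) * (real (min 1 s) * ?H)" using bel[of False t] P by simp
    moreover have "real (min t s) * ?H \<le> real s * ?H" using P by (intro mult_right_mono) auto
    moreover have "play_value a b \<rho> ?\<psi> y = u t * \<rho> + (1 - u t) * (real (min 1 s) * ?H) - D + u t * D"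
      using False unfolding D_def[symmetric]
      by (simp add: play_value_def act_rew_def act_next_def algebra_simps)
    moreover have "?\<psi> y = real (min t s) * ?H - D" using False by (simp add: D_def)
    moreover have "max lam ?H \<le> lam + ?H" using lam P by simp
    ultimately show ?thesis using D by linarith
  qed
  hence play': "lam + ?\<psi> y \<le> play_value a b \<rho> ?\<psi> y" "?H + ?\<psi> y \<le> play_value a b \<rho> ?\<psi> y"
    by linarith+
  show "if exploitable b \<rho> lam y then lam + ?\<psi> y \<le> play_value a b \<rho> ?\<psi> y
      else ?\<psi> y \<le> ?\<psi> (fst y, Suc (snd y)) \<and>
        (if ereal lam \<le> whittle_index a b \<rho> y then lam + ?\<psi> y \<le> play_value a b \<rho> ?\<psi> y
         else ?\<psi> y + ?H \<le> ?\<psi> (fst y, Suc (snd y)) \<and> ?H + ?\<psi> y \<le> play_value a b \<rho> ?\<psi> y)"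
  proof (rule if_step)
    show "?\<psi> y + ?H \<le> ?\<psi> (fst y, Suc (snd y)) \<and> ?H + ?\<psi> y \<le> play_value a b \<rho> ?\<psi> y"
      if "\<not> exploitable b \<rho> lam y" "\<not> ereal lam \<le> whittle_index a b \<rho> y"
      using waiting[OF that] play'(2) by (rule conjI)
  qed (rule play'(1), erule aged)
qed

lemma index_potential_exists:
  assumes lam: "lam > 0" and x: "snd x \<ge> 1" and H: "H_single a b \<rho> x lam = ereal H"
  shows "\<exists>S \<psi> M. closed_info a b S \<and> x \<in> S \<and> (\<forall>y\<in>S. \<bar>\<psi> y\<bar> \<le> M) \<and> index_potential a b \<rho> lam H S \<psi>"
proof -
  have bounded_worthless:
    "\<forall>y\<in>S. \<bar>if fst y \<and> snd y \<noteq> 1 \<and> lam \<le> \<rho> * (1 - b) then - lam else 0\<bar> \<le> lam"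
    for S :: "info set" using lam by auto
  have bounded_absorbing: "\<forall>y\<in>S. \<bar>if fst y then (if snd y = 1 then 0 else - lam)
      else real (min (snd y) s) * (\<rho> - lam) - D\<bar> \<le> lam + real s * (\<rho> - lam) + \<bar>D\<bar>"
    if P: "lam \<le> \<rho>" for S :: "info set" and s D
  proof
    fix y :: info
    have "0 \<le> real (min (snd y) s) * (\<rho> - lam)" "real (min (snd y) s) * (\<rho> - lam) \<le> real s * (\<rho> - lam)"
      using P by (auto intro!: mult_right_mono)
    thus "\<bar>if fst y then (if snd y = 1 then 0 else - lam)
      else real (min (snd y) s) * (\<rho> - lam) - D\<bar> \<le> lam + real s * (\<rho> - lam) + \<bar>D\<bar>"
      using lam by auto
  qed
  have W: ?thesis if "H = 0" "closed_info a b S" "x \<in> S" "S \<subseteq> states"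
    "\<And>y. y \<in> S \<Longrightarrow> \<not> fst y \<or> \<rho> * (1 - b) < lam \<Longrightarrow> whittle_index a b \<rho> y < ereal lam" for S
  proof -
    define \<psi> where "\<psi> y = (if fst y \<and> snd y \<noteq> 1 \<and> lam \<le> \<rho> * (1 - b) then - lam else 0)" for y :: info
    have "index_potential a b \<rho> lam H S \<psi>"
      unfolding \<psi>_def that(1) by (rule potential_worthless[OF lam that(4)]) (rule that(5))
    moreover have "\<forall>y\<in>S. \<bar>\<psi> y\<bar> \<le> lam" unfolding \<psi>_def by (rule bounded_worthless)
    ultimately show ?thesis using that(2,3) by blast
  qed
  have A: ?thesis if "H = \<rho> - lam" "closed_info a b S" "x \<in> S" "b = 0" "lam \<le> \<rho>" "S \<subseteq> states"
    "\<And>t. (False, t) \<in> S \<Longrightarrow> a > 0"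
    "\<And>y. y \<in> S \<Longrightarrow> lam < \<rho> \<Longrightarrow> threshold s y \<Longrightarrow> ereal lam \<le> whittle_index a b \<rho> y" for S s
  proof -
    define \<psi> where "\<psi> y = (if fst y then (if snd y = 1 then 0 else - lam)
      else real (min (snd y) s) * (\<rho> - lam) - (lam + (real s + 1) * (\<rho> - lam)) / a)" for y :: info
    have "index_potential a b \<rho> lam H S \<psi>"
      unfolding \<psi>_def that(1)
      by (rule potential_absorbing[OF lam that(4-6)]) (rule that(7), assumption, rule that(8))
    moreover have "\<forall>y\<in>S. \<bar>\<psi> y\<bar> \<le> lam + real s * (\<rho> - lam) + \<bar>(lam + (real s + 1) * (\<rho> - lam)) / a\<bar>"
      unfolding \<psi>_def by (rule bounded_absorbing[OF that(5)])
    ultimately show ?thesis using that(2,3) by blast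
  qed
  consider "\<rho> * (1 - b) < lam" | "lam \<le> \<rho> * (1 - b)" "b > 0" | "lam \<le> \<rho>" "b = 0" "a > 0"
    | "lam \<le> \<rho>" "b = 0" "a = 0"
    using a0 b0 by fastforce
  thus ?thesis
  proof cases
    case 1
    have "H = 0" using H worthless_H_single(1)[OF worthless_small[of lam] x] 1 by simp
    thus ?thesis using whittle_less_small[OF 1] x by (intro W[OF _ closed_states]) auto
  next
    case 2
    show ?thesis
    proof (cases "\<exists>t\<ge>1. F lam t > 0")
      case True
      then obtain t0 where "1 \<le> t0" "F lam t0 > 0" by blast
      from F_maximiser[OF 2(2) less_imp_le[OF lam] this] obtain s where s: "1 \<le> s" "F lam s > 0"
        "\<And>m. 1 \<le> m \<Longrightarrow> F lam m \<le> F lam s" "\<And>m. 1 \<le> m \<Longrightarrow> m < s \<Longrightarrow> F lam m < F lam s" by metis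
      have HF: "H = F lam s"
        using H gain_triple_H_single[OF gain_triple_F[OF 2(2) less_imp_le[OF lam] s(1-3)] x] by simp
      define \<psi> where "\<psi> y = (if fst y then (if snd y = 1 then (\<rho> - lam - F lam s) / b - \<rho> else - lam)
         else (real (min (snd y) s) - 1) * F lam s)" for y :: info
      have ip: "index_potential a b \<rho> lam H states \<psi>"
        unfolding \<psi>_def HF by (rule potential_recurrent[OF lam 2(2,1) s])
      have "\<bar>\<psi> y\<bar> \<le> \<bar>(\<rho> - lam - F lam s) / b - \<rho>\<bar> + lam + real s * F lam s" if "y \<in> states" for y
      proof -
        have "0 \<le> (real (min (snd y) s) - 1) * F lam s"
          "(real (min (snd y) s) - 1) * F lam s \<le> real s * F lam s"
          using that s by (auto intro!: mult_right_mono mult_nonneg_nonneg)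
        thus ?thesis using lam by (auto simp: \<psi>_def)
      qed
      thus ?thesis using ip closed_states x by (metis in_states(2))
    next
      case False
      have nb: "\<not> best lam m" for m using False by (auto simp: best_def)
      have "worthless lam (if lam < \<rho> * (1 - b) then (\<rho> * (1 - b) - lam) / b else 0)"
        using worthless_F[OF 2(2)] worthless_small[of lam] False by (auto simp: not_less)
      hence "H = 0" using H worthless_H_single(1)[OF _ x] by fastforce
      moreover have "whittle_index a b \<rho> y < ereal lam" if "y \<in> states" "\<not> fst y" for y
        using whittle_less_threshold[OF 2(2) lam, of "snd y"] that nb by (cases y) auto
      ultimately show ?thesis using 2(1) x by (intro W[OF _ closed_states]) auto
    qed
  next
    case 3
    show ?thesis
    proof (cases "lam < \<rho>")
      case True
      from gain_triple_b0[OF 3(2,3) less_imp_le[OF lam] True] obtain K s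
        where tr: "gain_triple lam (\<rho> - lam) K s" .
      have "H = \<rho> - lam" using H gain_triple_H_single[OF tr x] by simp
      thus ?thesis
        using 3 x whittle_ge[OF absorbing_threshold_optimal[OF tr 3(2,3)]]
        by (intro A[OF _ closed_states]) auto
    next
      case False
      \<comment> \<open>Here \<open>lam = \<rho>\<close>, so the gain \<open>0\<close> equals
        \<open>\<rho> - lam\<close> and the requirement on indices in \<open>A\<close> is
        vacuous.\<close>
      hence "H = 0" using H worthless_H_single(1)[OF worthless_small[of lam] x] 3(2) by simp
      thus ?thesis using False 3 x by (intro A[OF _ closed_states]) auto
    qed
  next
    case 4
    note c = frozen_certificate[OF 4(3,2) less_imp_le[OF lam], of "fst x"]
    have Hx: "H = (if fst x then max 0 (\<rho> - lam) else 0)"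
      using H bias_certificate.H_single[OF c, of x] x by simp
    show ?thesis
    proof (cases "fst x")
      case True
      have "ereal lam \<le> whittle_index a b \<rho> y" if "fst y" for y
        using whittle_ge[OF frozen_optimal[OF 4(3,2)], of lam y] lam 4(1) that by simp
      thus ?thesis using 4 Hx True x by (intro A[OF _ bias_certificate.cl[OF c]]) auto
    next
      case False
      have "whittle_index a b \<rho> y < ereal lam" if "\<not> fst y" "1 \<le> snd y" for y
        using whittle_less_a0[OF 4(3) lam that(2)] that(1) by (cases y) auto
      thus ?thesis using 4 Hx False x by (intro W[OF _ bias_certificate.cl[OF c]]) auto
    qed
  qed
qed

end

section \<open>The main theorem\<close>

lemma info_of_age:
  assumes "\<forall>i. snd (x0 i) \<ge> 1"
  shows "snd (info_of x0 h i) \<ge> 1"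
  using assms by (induction h arbitrary: i) (auto simp: Let_def split: option.splits)

text \<open>Age \<open>1\<close> means observed in the last step. Initially several arms may have
  age \<open>1\<close>, hence the nonempty history.\<close>

lemma info_of_fresh:
  assumes "\<forall>i. snd (x0 i) \<ge> 1" "h \<noteq> []" "snd (info_of x0 h i) = 1" "snd (info_of x0 h j) = 1"
  shows "i = j"
proof -
  obtain e g where [simp]: "h = e # g" using assms(2) by (cases h) auto
  have "\<exists>s. e = Some (k, s)" if "snd (info_of x0 h k) = 1" for k
    using that info_of_age[OF assms(1), of g k]
    by (auto simp: Let_def split: option.splits if_splits prod.splits)
  from this[OF assms(3)] this[OF assms(4)] show ?thesis by auto
qed

lemma net_reward_nonneg:
  assumes "\<forall>i. r i \<ge> 0"
  shows "net_reward r 0 h \<ge> 0"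
  unfolding net_reward_def using assms by (intro sum_list_nonneg) (auto split: option.splits)

lemma threshold_whittle_step:
  fixes \<alpha> \<beta> r :: "'a::finite \<Rightarrow> real"
  assumes age: "\<forall>i. snd (x0 i) \<ge> 1"
    and tw: "threshold_whittle \<alpha> \<beta> r x0 lam \<pi>" and act: "act \<in> set_pmf (\<pi> h)" and h: "h \<noteq> []"
    and lam: "lam = (\<Sum>i\<in>UNIV. H i)"
    and S: "\<And>i. info_of x0 h i \<in> S i"
    and pot: "\<And>i. index_potential (\<alpha> i) (\<beta> i) (r i) lam (H i) (S i) (\<psi> i)"
  shows "(\<Sum>i\<in>UNIV. \<psi> i (info_of x0 h i)) + lam \<le>
    (\<Sum>i\<in>UNIV. act_rew (\<alpha> i) (\<beta> i) (r i) 0 (act = Some i) (info_of x0 h i)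
        + act_next (\<alpha> i) (\<beta> i) (act = Some i) (\<psi> i) (info_of x0 h i))"
    (is "_ \<le> (\<Sum>i\<in>UNIV. ?step i)")
proof -
  define x where "x = info_of x0 h"
  define W where "W i = whittle_index (\<alpha> i) (\<beta> i) (r i) (x i)" for i
  define E where "E = {i. x i = (True, 1) \<and> r i * (1 - \<beta> i) \<ge> lam}"
  have E: "i \<in> E \<longleftrightarrow> exploitable (\<beta> i) (r i) lam (x i)" for i
    by (simp add: E_def exploitable_def)
  have "set_pmf (\<pi> h) \<subseteq> Some ` (if E \<noteq> {} then E else {i. \<forall>j. W j \<le> W i})"
    using tw unfolding threshold_whittle_def Let_def E_def W_def x_def by blast
  then obtain j where j: "act = Some j" "j \<in> (if E \<noteq> {} then E else {i. \<forall>j. W j \<le> W i})"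
    using act by blast
  have P: "if i \<in> E then lam + \<psi> i (x i) \<le> play_value (\<alpha> i) (\<beta> i) (r i) (\<psi> i) (x i)
      else \<psi> i (x i) \<le> \<psi> i (fst (x i), Suc (snd (x i))) \<and>
        (if ereal lam \<le> W i then lam + \<psi> i (x i) \<le> play_value (\<alpha> i) (\<beta> i) (r i) (\<psi> i) (x i)
         else \<psi> i (x i) + H i \<le> \<psi> i (fst (x i), Suc (snd (x i))) \<and>
           H i + \<psi> i (x i) \<le> play_value (\<alpha> i) (\<beta> i) (r i) (\<psi> i) (x i))" for i
    using pot[of i] S[of i] unfolding index_potential_def E W_def x_def by blast
  have step: "?step i = (if i = j then play_value (\<alpha> i) (\<beta> i) (r i) (\<psi> i) (x i)
      else \<psi> i (fst (x i), Suc (snd (x i))))" for i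
    using j(1) by (auto simp: play_value_def act_rew_def act_next_def x_def)
  show ?thesis
  proof (cases "E \<noteq> {} \<or> ereal lam \<le> W j")
    case True
    have "\<psi> i (x i) + (if i = j then lam else 0) \<le> ?step i" for i
    proof (cases "i = j")
      case i: True
      have "j \<in> E \<or> ereal lam \<le> W j" using True j(2) by (auto split: if_splits)
      thus ?thesis using P[of i] i unfolding step by (auto split: if_splits)
    next
      case False
      \<comment> \<open>Only an unplayed exploitable arm could lose potential; it would be fresh
        together with \<open>j\<close>.\<close>
      have "i \<notin> E"
      proof
        assume i: "i \<in> E"
        hence "j \<in> E" using j(2) by (auto split: if_splits)
        with i have "snd (info_of x0 h i) = 1" "snd (info_of x0 h j) = 1"
          by (auto simp: E_def x_def)
        thus False using info_of_fresh[OF age h] False by blast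
      qed
      thus ?thesis using P[of i] False unfolding step by (auto split: if_splits)
    qed
    hence "(\<Sum>i\<in>UNIV. \<psi> i (x i) + (if i = j then lam else 0)) \<le> (\<Sum>i\<in>UNIV. ?step i)"
      by (intro sum_mono)
    thus ?thesis by (simp add: sum.distrib x_def)
  next
    case False
    \<comment> \<open>The maximal index is below \<open>lam\<close>, hence all are; each arm gains
      \<open>H i\<close>, whether played or not, and these add up to \<open>lam\<close>.\<close>
    hence cold: "\<not> ereal lam \<le> W i" for i
      using j(2) by (auto split: if_splits dest: order_trans)
    have "\<psi> i (x i) + H i \<le> ?step i" for i
      using P[of i] cold[of i] False unfolding step by (auto simp: add.commute)
    hence "(\<Sum>i\<in>UNIV. \<psi> i (x i) + H i) \<le> (\<Sum>i\<in>UNIV. ?step i)" by (intro sum_mono)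
    thus ?thesis by (simp add: sum.distrib x_def lam)
  qed
qed

theorem theorem4:
  fixes \<alpha> \<beta> r :: "'a::finite \<Rightarrow> real"
    and \<delta> lam :: real
    and x0 :: "'a \<Rightarrow> info"
    and \<pi> :: "'a policy"
  assumes "\<delta> > 0"
    and "\<And>i. \<alpha> i \<ge> 0" and "\<And>i. \<beta> i \<ge> 0" and "\<And>i. \<alpha> i + \<beta> i \<le> 1 - \<delta>"
    and "\<And>i. r i \<ge> 0"
    and "\<And>i. snd (x0 i) \<ge> 1"
    and "ereal lam = (\<Sum>i\<in>UNIV. H_single (\<alpha> i) (\<beta> i) (r i) (x0 i) lam)"
    and "threshold_whittle \<alpha> \<beta> r x0 lam \<pi>"
  shows "avg_value \<alpha> \<beta> r 0 x0 \<pi> \<ge> opt_value \<alpha> \<beta> r 0 x0 / 2"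
proof -
  have lt1: "\<alpha> i + \<beta> i < 1" for i using assms(1) assms(4)[of i] by linarith
  have arm: "arm (\<alpha> i) (\<beta> i) (r i)" for i
    by unfold_locales (fact assms(2,3,5) lt1)+
  have le1: "\<alpha> i + \<beta> i \<le> 1" for i using lt1[of i] by simp
  have r0: "\<forall>i. r i \<ge> 0" using assms(5) by blast
  note par = assms(2,3) le1
  \<comment> \<open>Never playing has value \<open>0\<close>. This makes \<open>lam\<close>
    nonnegative, being a sum of optimal values.\<close>
  have "0 \<le> H_single (\<alpha> i) (\<beta> i) (r i) (x0 i) lam" for i
  proof -
    have "chain_rew (\<alpha> i) (\<beta> i) (r i) lam (\<lambda>_. False) = (\<lambda>_. 0)"
      by (simp add: fun_eq_iff chain_rew_def act_rew_def)
    hence "total1 (\<alpha> i) (\<beta> i) (r i) lam (\<lambda>_. False) (x0 i) T = 0" for T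
      by (simp add: total1_eq[OF par] chain_pow_const)
    thus ?thesis
      using stationary_le_H_single[of "\<alpha> i" "\<beta> i" "r i" lam "x0 i" "\<lambda>_. False"]
      by (simp add: avg_value_def zero_ereal_def[symmetric] Liminf_const)
  qed
  hence "0 \<le> ereal lam" unfolding assms(7) by (intro sum_nonneg)
  hence lam0: "0 \<le> lam" by simp
  have "\<exists>H S \<phi> M. 0 \<le> H \<and> closed_info (\<alpha> i) (\<beta> i) S \<and> x0 i \<in> S \<and>
      supersolution (\<alpha> i) (\<beta> i) (r i) lam S H \<phi> \<and> (\<forall>y\<in>S. \<bar>\<phi> y\<bar> \<le> M) \<and>
      H_single (\<alpha> i) (\<beta> i) (r i) (x0 i) lam = ereal H" for i
    using arm.supersolution_exists[OF arm lam0 assms(6)] by metis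
  then obtain H S \<phi> M where up: "\<And>i. closed_info (\<alpha> i) (\<beta> i) (S i)" "\<And>i. x0 i \<in> S i"
      "\<And>i. supersolution (\<alpha> i) (\<beta> i) (r i) lam (S i) (H i) (\<phi> i)"
      "\<And>i. \<forall>y\<in>S i. \<bar>\<phi> i y\<bar> \<le> M i"
    and H: "\<And>i. H_single (\<alpha> i) (\<beta> i) (r i) (x0 i) lam = ereal (H i)"
    by metis
  have lam: "lam = (\<Sum>i\<in>UNIV. H i)" using assms(7) by (simp add: H)
  have opt: "opt_value \<alpha> \<beta> r 0 x0 \<le> ereal (2 * lam)"
    unfolding opt_value_def
  proof (rule SUP_least, rule limsup_average_le)
    fix \<pi>' :: "'a policy" and T
    have "total \<alpha> \<beta> r 0 x0 \<pi>' T \<le> real T * (lam - 0 + (\<Sum>i\<in>UNIV. H i)) + 2 * (\<Sum>i\<in>UNIV. M i)"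
      by (rule total_le_supersolution[OF par up(1-3) _ lam0]) (rule bspec[OF up(4)])
    thus "total \<alpha> \<beta> r 0 x0 \<pi>' T \<le> real T * (2 * lam) + 2 * (\<Sum>i\<in>UNIV. M i)"
      by (simp add: lam[symmetric])
  qed
  have "ereal lam \<le> avg_value \<alpha> \<beta> r 0 x0 \<pi>"
  proof (cases "lam = 0")
    case True
    \<comment> \<open>The potentials need a positive penalty; for \<open>lam = 0\<close> nonnegative
      rewards suffice.\<close>
    have "0 \<le> total \<alpha> \<beta> r 0 x0 \<pi> T" for T
      unfolding total_eq_hist using net_reward_nonneg[OF r0] by (intro Bochner_Integration.integral_nonneg)
    thus ?thesis unfolding avg_value_def True by (intro liminf_average_ge[where C = 0]) simp
  next
    case False
    hence pos: "0 < lam" using lam0 by simp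
    have "\<exists>S \<psi> M. closed_info (\<alpha> i) (\<beta> i) S \<and> x0 i \<in> S \<and> (\<forall>y\<in>S. \<bar>\<psi> y\<bar> \<le> M) \<and>
        index_potential (\<alpha> i) (\<beta> i) (r i) lam (H i) S \<psi>" for i
      by (rule arm.index_potential_exists[OF arm pos assms(6) H])
    then obtain S' \<psi> M' where low: "\<And>i. closed_info (\<alpha> i) (\<beta> i) (S' i)" "\<And>i. x0 i \<in> S' i"
        "\<And>i. \<forall>y\<in>S' i. \<bar>\<psi> i y\<bar> \<le> M' i"
        "\<And>i. index_potential (\<alpha> i) (\<beta> i) (r i) lam (H i) (S' i) (\<psi> i)"
      by metis
    define \<Psi> where "\<Psi> h = net_reward r 0 h + (\<Sum>i\<in>UNIV. \<psi> i (info_of x0 h i))" for h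
    define B where "B = (\<Sum>i\<in>UNIV. M' i)"
    let ?E = "\<lambda>T. measure_pmf.expectation (hist \<alpha> \<beta> x0 \<pi> T)"
    have in_S: "info_of x0 h i \<in> S' i" if "h \<in> set_pmf (hist \<alpha> \<beta> x0 \<pi> T)" for h i T
      by (rule info_of_in_closed[OF par low(1,2) that])
    have \<psi>_bnd: "\<bar>\<Sum>i\<in>UNIV. \<psi> i (info_of x0 h i)\<bar> \<le> B" if "h \<in> set_pmf (hist \<alpha> \<beta> x0 \<pi> T)" for h T
    proof -
      have "\<bar>\<Sum>i\<in>UNIV. \<psi> i (info_of x0 h i)\<bar> \<le> (\<Sum>i\<in>UNIV. \<bar>\<psi> i (info_of x0 h i)\<bar>)" by (rule sum_abs)
      also have "\<dots> \<le> B" unfolding B_def using low(3) in_S[OF that] by (intro sum_mono) blast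
      finally show ?thesis .
    qed
    have step: "?E T \<Psi> + lam \<le> ?E (Suc T) \<Psi>" if T: "T \<ge> 1" for T
    proof -
      have "?E (Suc T) (\<lambda>h. - \<Psi> h) \<le> ?E T (\<lambda>h. - \<Psi> h) + (- lam)"
      proof (rule expectation_hist_growth)
        fix h act assume h: "h \<in> set_pmf (hist \<alpha> \<beta> x0 \<pi> T)" and act: "act \<in> set_pmf (\<pi> h)"
        have "h \<noteq> []" using set_hist_length[OF h] T by auto
        from threshold_whittle_step[OF allI[OF assms(6)] assms(8) act this lam in_S[OF h] low(4)]
        have "\<Psi> h + lam \<le> measure_pmf.expectation (observe \<alpha> \<beta> x0 h act) \<Psi>"
          unfolding \<Psi>_def expectation_observe[OF par, where \<phi> = \<psi>] by linarith
        thus "measure_pmf.expectation (observe \<alpha> \<beta> x0 h act) (\<lambda>h. - \<Psi> h) \<le> - \<Psi> h + (- lam)"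
          by simp
      qed
      thus ?thesis by simp
    qed
    have E1: "?E 1 \<Psi> \<ge> - B"
    proof -
      have "?E 1 (\<lambda>_. - B) \<le> ?E 1 \<Psi>"
      proof (rule expectation_mono_finite)
        fix h assume "h \<in> set_pmf (hist \<alpha> \<beta> x0 \<pi> 1)"
        from \<psi>_bnd[OF this] net_reward_nonneg[OF r0, of h]
        show "- B \<le> \<Psi> h" unfolding \<Psi>_def by linarith
      qed simp
      thus ?thesis by simp
    qed
    have E: "?E (Suc T) \<Psi> \<ge> real T * lam - B" for T
    proof (induction T)
      case (Suc T)
      thus ?case using step[of "Suc T"] by (simp add: algebra_simps)
    qed (use E1 in simp)
    \<comment> \<open>The error consists of the uncounted first step, worth \<open>lam\<close>, and
      the potential at both ends, at most \<open>B\<close> each.\<close>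
    have "total \<alpha> \<beta> r 0 x0 \<pi> T \<ge> real T * lam - (lam + 2 * B)" for T
    proof (cases T)
      case 0
      have "B \<ge> 0" using \<psi>_bnd[of "[]" 0] by (simp add: order_trans[OF abs_ge_zero])
      thus ?thesis using 0 pos by (simp add: total_eq_hist net_reward_def)
    next
      case (Suc k)
      have "?E T \<Psi> \<le> ?E T (\<lambda>h. net_reward r 0 h + B)"
      proof (rule expectation_mono_finite)
        fix h assume "h \<in> set_pmf (hist \<alpha> \<beta> x0 \<pi> T)"
        from \<psi>_bnd[OF this] show "\<Psi> h \<le> net_reward r 0 h + B" unfolding \<Psi>_def by linarith
      qed simp
      thus ?thesis using E[of k] Suc
        by (simp add: total_eq_hist integrable_measure_pmf_finite algebra_simps)
    qed
    thus ?thesis unfolding avg_value_def by (rule liminf_average_ge)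
  qed
  moreover have "opt_value \<alpha> \<beta> r 0 x0 / 2 \<le> ereal lam"
  proof -
    have "opt_value \<alpha> \<beta> r 0 x0 / 2 \<le> ereal (2 * lam) / 2"
      using opt by (intro ereal_divide_right_mono) auto
    thus ?thesis by simp
  qed
  ultimately show ?thesis by (rule order_trans[rotated])
qed

end
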